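(* Fix integers $K\ge1$, $b\ge1$, constants $\eta,\xi_1,\dots,\xi_K,P_u,P_r,\sigma_r^2,\sigma_d^2>0$ and a ratio $\delta>0$. For the massive MIMO relay uplink with hybrid detection using $b$-bit quantized channel phases defined in the context, with $N_d/N_r=\delta$, let $\overline{R}_k$ be the ergodic rate of user $k\in\{1,\dots,K\}$. Then, in the regime of large antenna arrays ($N_d\to\infty$ with $N_d/N_r=\delta$ fixed), $\overline{R}_k$ is asymptotically lower bounded by $$\hat{R}_k=\frac12\log_2\left(1+\frac{\pi\eta\xi_kN_dP_rP_u\,\mathrm{sinc}^2\left(\frac{\pi}{2^b}\right)}{\sigma_r^2\eta P_r\left(\pi\delta\,\mathrm{sinc}^2\left(\frac{\pi}{2^b}\right)+4\right)+4\sigma_d^2\left(P_u\sum_{i=1}^K\xi_i+\sigma_r^2\right)}\right),$$ that is, $\liminf_{N_d\to\infty}\left(\overline{R}_k-\hat{R}_k\right)\ge0$. Here $\mathrm{sinc}(x)=\sin(x)/x$.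
   Context: $\mathbf{H}=[\mathbf{h}_1,\dots,\mathbf{h}_K]\in\mathbb{C}^{N_r\times K}$ has independent columns $\mathbf{h}_j\sim\mathcal{CN}(\mathbf{0}_{N_r},\xi_j\mathbf{I}_{N_r})$ (user-to-relay channel), and $\mathbf{G}\in\mathbb{C}^{N_d\times N_r}$, independent of $\mathbf{H}$, has i.i.d. $\mathcal{CN}(0,\eta)$ entries (relay-to-base-station channel); $\mathcal{CN}$ denotes the circularly symmetric complex Gaussian law. $P_u$ is the per-user power, $P_r$ the relay power, $\sigma_r^2,\sigma_d^2$ the noise variances at relay and base station. The relay amplification factor is $\alpha=\sqrt{\frac{P_r}{P_u\,\mathrm{Tr}(\mathbf{H}^H\mathbf{H})+\sigma_r^2N_r}}$. The quantized analog detector $\hat{\mathbf{W}}_a\in\mathbb{C}^{K\times N_d}$ has entries $[\hat{\mathbf{W}}_a]_{ij}=\frac{1}{\sqrt{N_d}}e^{\mathrm{j}\hat\phi_{ij}}$ ($\mathrm{j}$ in the exponent is the imaginary unit), where $\hat\phi_{ij}$ is the element of the codebook $\Psi=\{0,\pm\frac{1}{2^b}2\pi,\dots,\pm\frac{2^{b-1}-1}{2^b}2\pi,\pi\}$ ($2^b$ equally spaced phases) closest, modulo $2\pi$, to the phase $\angle[(\mathbf{GH})^H]_{ij}$ of the $(i,j)$ entry of $(\mathbf{GH})^H$. The digital zero-forcing detector is $\hat{\mathbf{W}}_d=(\hat{\mathbf{W}}_a\mathbf{G}\mathbf{H})^{-1}$. The signal-to-interference-plus-noise ratio of user $k$ is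 $$\gamma_k=\frac{P_u}{\sigma_r^2[\hat{\mathbf{W}}_d\hat{\mathbf{W}}_a\mathbf{G}\mathbf{G}^H\hat{\mathbf{W}}_a^H\hat{\mathbf{W}}_d^H]_{kk}+\frac{\sigma_d^2}{\alpha^2}[\hat{\mathbf{W}}_d\hat{\mathbf{W}}_a\hat{\mathbf{W}}_a^H\hat{\mathbf{W}}_d^H]_{kk}},$$ and the ergodic rate is $\overline{R}_k=\frac12\mathbb{E}\{\log_2(1+\gamma_k)\}$. *)

theory Defs
  imports
    "HOL-Probability.Probability"
    "HOL-Probability.Sinc_Integral"
    "Jordan_Normal_Form.Gauss_Jordan_Elimination"
    "Jordan_Normal_Form.Schur_Decomposition"
begin

text \<open>
  Matrices are those of \<^theory>\<open>Jordan_Normal_Form.Matrix\<close>, since the numbers of antennas vary.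
  Row and column indices, and hence users, are counted from 0.
\<close>

no_notation Inner_Product.real_inner_class.inner (infixl "\<bullet>" 70)
no_notation Finite_Cartesian_Product.vec_nth (infixl "$" 90)

subsection \<open>Random channels\<close>

context prob_space
begin

text \<open>The law CN(0, v): independent real and imaginary parts, each real Gaussian of variance v/2.\<close>

definition complex_normal :: "real \<Rightarrow> ('a \<Rightarrow> complex) \<Rightarrow> bool" where
  "complex_normal v Z \<longleftrightarrow>
     distributed M lborel (\<lambda>\<omega>. Re (Z \<omega>)) (normal_density 0 (sqrt (v / 2))) \<and>
     distributed M lborel (\<lambda>\<omega>. Im (Z \<omega>)) (normal_density 0 (sqrt (v / 2))) \<and>
     indep_var borel (\<lambda>\<omega>. Re (Z \<omega>)) borel (\<lambda>\<omega>. Im (Z \<omega>))"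

text \<open>The law CN(0, v I) on complex vectors of dimension N: as the covariance matrix is scalar,
  the coordinates are independent with law CN(0, v).\<close>

definition complex_normal_vec :: "nat \<Rightarrow> real \<Rightarrow> ('a \<Rightarrow> complex Matrix.vec) \<Rightarrow> bool" where
  "complex_normal_vec N v X \<longleftrightarrow>
     (\<forall>\<omega>\<in>space M. X \<omega> \<in> carrier_vec N) \<and>
     indep_vars (\<lambda>_. borel) (\<lambda>i \<omega>. X \<omega> $ i) {..<N} \<and>
     (\<forall>i<N. complex_normal v (\<lambda>\<omega>. X \<omega> $ i))"

end

text \<open>Independence of vector- or matrix-valued variables is independence of the families of their
  entries, taken as elements of the product measurable space.\<close>

locale relay_channel = prob_space M
  for M :: "'a measure"
    and K Nr Nd :: nat
    and \<xi> :: "nat \<Rightarrow> real"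
    and \<eta> :: real
    and H G :: "'a \<Rightarrow> complex mat" +
  assumes H_carrier: "\<And>\<omega>. \<omega> \<in> space M \<Longrightarrow> H \<omega> \<in> carrier_mat Nr K"
    and G_carrier: "\<And>\<omega>. \<omega> \<in> space M \<Longrightarrow> G \<omega> \<in> carrier_mat Nd Nr"
    and H_col: "\<And>j. j < K \<Longrightarrow> complex_normal_vec Nr (\<xi> j) (\<lambda>\<omega>. col (H \<omega>) j)"
    and H_cols_indep:
      "indep_vars (\<lambda>_. Pi\<^sub>M {..<Nr} (\<lambda>_. borel :: complex measure))
         (\<lambda>j \<omega>. \<lambda>i\<in>{..<Nr}. H \<omega> $$ (i, j)) {..<K}"
    and G_entry: "\<And>i j. i < Nd \<Longrightarrow> j < Nr \<Longrightarrow> complex_normal \<eta> (\<lambda>\<omega>. G \<omega> $$ (i, j))"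
    and G_entries_indep:
      "indep_vars (\<lambda>_. borel) (\<lambda>p \<omega>. G \<omega> $$ p) ({..<Nd} \<times> {..<Nr})"
    and H_G_indep:
      "indep_var
         (Pi\<^sub>M ({..<Nr} \<times> {..<K}) (\<lambda>_. borel :: complex measure))
         (\<lambda>\<omega>. \<lambda>p\<in>{..<Nr} \<times> {..<K}. H \<omega> $$ p)
         (Pi\<^sub>M ({..<Nd} \<times> {..<Nr}) (\<lambda>_. borel :: complex measure))
         (\<lambda>\<omega>. \<lambda>p\<in>{..<Nd} \<times> {..<Nr}. G \<omega> $$ p)"

subsection \<open>Hybrid detection with quantized phases\<close>

text \<open>The endpoint \<open>m = 2 ^ (b - 1)\<close> is the phase \<open>\<pi>\<close>.\<close>

definition codebook :: "nat \<Rightarrow> real set" where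
  "codebook b = (\<lambda>m::int. of_int m / 2 ^ b * (2 * pi)) ` {- (2 ^ (b - 1) - 1) .. 2 ^ (b - 1)}"

definition dist_mod_2pi :: "real \<Rightarrow> real \<Rightarrow> real" where
  "dist_mod_2pi x y = (INF m::int. \<bar>x - y + 2 * pi * of_int m\<bar>)"

text \<open>Ties occur only for finitely many phases in \<open>(-\<pi>, \<pi>]\<close>; there the choice is arbitrary but
  depends only on the phase.\<close>

definition quantize_phase :: "nat \<Rightarrow> real \<Rightarrow> real" where
  "quantize_phase b \<theta> = arg_min_on (\<lambda>\<psi>. dist_mod_2pi \<psi> \<theta>) (codebook b)"

definition analog_detector :: "nat \<Rightarrow> complex mat \<Rightarrow> complex mat \<Rightarrow> complex mat" where
  "analog_detector b G H = Matrix.mat (dim_col H) (dim_row G)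
     (\<lambda>(i, j). complex_of_real (1 / sqrt (real (dim_row G))) *
        cis (quantize_phase b (Arg (mat_adjoint (G * H) $$ (i, j)))))"

text \<open>The zero-forcing detector exists only if the effective channel is invertible, which may fail
  with positive probability for finite arrays. It is then taken to be 0; as
  \<^term>\<open>x / (0::real) = 0\<close>, such realizations contribute SINR 0 and hence rate 0.\<close>

definition digital_detector :: "nat \<Rightarrow> complex mat \<Rightarrow> complex mat \<Rightarrow> complex mat" where
  "digital_detector b G H =
     (case mat_inverse (analog_detector b G H * G * H) of
        Some W \<Rightarrow> W
      | None \<Rightarrow> 0\<^sub>m (dim_col H) (dim_col H))"

subsection \<open>Ergodic rate\<close>

definition mat_trace :: "complex mat \<Rightarrow> complex" where
  "mat_trace A = (\<Sum>i<dim_row A. A $$ (i, i))"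

text \<open>Here and below \<open>\<sigma>r\<close> and \<open>\<sigma>d\<close> are standard deviations. The trace, and the diagonal entries
  in \<open>sinr\<close>, are real; \<^const>\<open>Re\<close> only changes the type.\<close>

definition amplification :: "real \<Rightarrow> real \<Rightarrow> real \<Rightarrow> complex mat \<Rightarrow> real" where
  "amplification Pu Pr \<sigma>r H =
     sqrt (Pr / (Pu * Re (mat_trace (mat_adjoint H * H)) + \<sigma>r\<^sup>2 * real (dim_row H)))"

definition sinr ::
  "nat \<Rightarrow> real \<Rightarrow> real \<Rightarrow> real \<Rightarrow> real \<Rightarrow> complex mat \<Rightarrow> complex mat \<Rightarrow> nat \<Rightarrow> real" where
  "sinr b Pu Pr \<sigma>r \<sigma>d G H k =
     (let Wa = analog_detector b G H;
          Wd = digital_detector b G H;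
          \<alpha> = amplification Pu Pr \<sigma>r H
      in Pu /
         (\<sigma>r\<^sup>2 * Re ((Wd * Wa * G * mat_adjoint G * mat_adjoint Wa * mat_adjoint Wd) $$ (k, k)) +
          \<sigma>d\<^sup>2 / \<alpha>\<^sup>2 * Re ((Wd * Wa * mat_adjoint Wa * mat_adjoint Wd) $$ (k, k))))"

definition ergodic_rate ::
  "'a measure \<Rightarrow> nat \<Rightarrow> real \<Rightarrow> real \<Rightarrow> real \<Rightarrow> real \<Rightarrow>
   ('a \<Rightarrow> complex mat) \<Rightarrow> ('a \<Rightarrow> complex mat) \<Rightarrow> nat \<Rightarrow> real" where
  "ergodic_rate M b Pu Pr \<sigma>r \<sigma>d G H k =
     1 / 2 * (\<integral>\<omega>. log 2 (1 + sinr b Pu Pr \<sigma>r \<sigma>d (G \<omega>) (H \<omega>) k) \<partial>M)"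

definition rate_bound ::
  "nat \<Rightarrow> nat \<Rightarrow> (nat \<Rightarrow> real) \<Rightarrow> real \<Rightarrow> real \<Rightarrow> real \<Rightarrow> real \<Rightarrow> real \<Rightarrow> real \<Rightarrow> nat \<Rightarrow> nat \<Rightarrow> real"
  where
  "rate_bound K b \<xi> \<eta> \<delta> Pu Pr \<sigma>r \<sigma>d Nd k =
     1 / 2 * log 2 (1 +
       (pi * \<eta> * \<xi> k * real Nd * Pr * Pu * (sinc (pi / 2 ^ b))\<^sup>2) /
       (\<sigma>r\<^sup>2 * \<eta> * Pr * (pi * \<delta> * (sinc (pi / 2 ^ b))\<^sup>2 + 4) +
        4 * \<sigma>d\<^sup>2 * (Pu * (\<Sum>i<K. \<xi> i) + \<sigma>r\<^sup>2)))"

end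

theory Submission
  imports Defs "HOL-Real_Asymp.Real_Asymp"
begin

text \<open>
  Write \<open>\<rho>\<close> for the support function of the regular \<open>2\<^sup>b\<close>-gon with a vertex at 1. For a codebook phase
  \<open>\<psi>\<close> we have \<open>Re (cis \<psi> * z) \<le> \<rho> z\<close>, with equality if \<open>\<psi>\<close> is the quantized phase of \<open>cnj z\<close>. The polygon
  is a sum of segments, so \<open>\<rho>\<close> is a sum of terms \<open>\<bar>Re (\<zeta> * z)\<bar>\<close>, and its mean under a Gaussian law follows from
  the first absolute moment of a real normal variable. Equality yields the size of the diagonal of the effective
  channel \<open>Wa * G * H\<close> by Chebyshev's inequality; the inequality yields a sharp upper bound for the expected
  square norm of the rows of \<open>Wa * G\<close>, and hence for the off-diagonal entries, because a column of \<open>H\<close> is independent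
  of \<open>G\<close> and of the other columns.

  If the effective channel is close to diagonal, the rows of its inverse have deterministic bounds, so
  \<open>1 / sinr\<close> is at most a random variable \<open>Z\<close> whose mean is almost the inverse of the claimed SINR \<open>g\<close>.
  The tangent inequality \<open>ln (1 + x) \<ge> ln (1 + g) + 1 - (1 + g) / (1 + x)\<close> transfers this to the rate. The
  complementary event has probability \<open>O(1 / Nd)\<close>, which beats the logarithmic growth of \<open>ln (1 + g)\<close>;
  there the rate is only used to be nonnegative.
\<close>

subsection \<open>Quantized phases\<close>

text \<open>The phases depend on both channels, so the entries of \<open>Wa * G\<close> are not
  Gaussian. Row \<open>i\<close> of the phases, however, sees \<open>H\<close> only through its
  column \<open>i\<close>; with that column fixed, the base station antennas give independent
  summands, and only means per antenna are needed. These are bounded through \<open>\<rho>\<close>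
  and not through the modulus, which would give the constant of unquantized phases and lose the
  factor sinc^2 next to \<delta> in the denominator of the claim. The \<pi> and the 4 of the claim
  come from the mean of \<open>\<rho>\<close> under CN(0, \<eta>), which is sqrt (\<pi> \<eta>)
  sinc(\<pi>/2^b) / 2. The inverse SINR has no usable bound where the effective channel is nearly
  singular, so Jensen's inequality cannot be applied to the whole expectation; hence the split into
  two events. Dominance of the diagonal is required up to a relative tolerance e. For fixed e this
  leaves a constant error in the rate, while the constant in the O(1 / Nd) term blows up as e tends
  to 0; so the arrays grow first and e tends to 0 last.\<close>

text \<open>Support function of the regular polygon, as a sum over its \<open>2 ^ (b - 1)\<close> generating segments.\<close>

definition polygon_support :: "nat \<Rightarrow> complex \<Rightarrow> real" where
  "polygon_support b z = sin (pi / 2 ^ b) *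
     (\<Sum>m<2 ^ (b - 1). \<bar>Re (cis (real (2 * m + 1) * (pi / 2 ^ b) - pi / 2) * z)\<bar>)"

text \<open>The conjugate is there because the detector quantizes entries of the adjoint of
  \<open>G * H\<close>; multiplication by the weight turns \<open>z\<close> towards the positive
  real axis.\<close>

definition phase_weight :: "nat \<Rightarrow> complex \<Rightarrow> complex" where
  "phase_weight b z = cis (quantize_phase b (Arg (cnj z)))"

lemma half_turn: "b \<ge> 1 \<Longrightarrow> real (2 ^ (b - 1)) * (pi / 2 ^ b) = pi / 2"
  by (cases b) (auto simp: field_simps)

lemma polygon_angle:
  assumes "b \<ge> 1"
  shows "0 < sin (pi / 2 ^ b)" "0 < pi / 2 ^ b" "pi / 2 ^ b \<le> pi / 2"
proof -
  have "(2::real) ^ 1 \<le> 2 ^ b" using assms by (intro power_increasing) auto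
  then show "pi / 2 ^ b \<le> pi / 2" by (intro divide_left_mono) auto
  then have "pi / 2 ^ b < pi" using pi_gt_zero by linarith
  then show "0 < sin (pi / 2 ^ b)" by (intro sin_gt_zero) auto
qed simp

lemma polygon_support_rotate:
  assumes "b \<ge> 1"
  shows "polygon_support b (cis (2 * (pi / 2 ^ b)) * z) = polygon_support b z"
proof -
  define \<alpha> where "\<alpha> = pi / 2 ^ b"
  define f where "f m = \<bar>Re (cis (real (2 * m + 1) * \<alpha> - pi / 2) * z)\<bar>" for m
  define L where "L = (2::nat) ^ (b - 1)"
  have L: "real L * \<alpha> = pi / 2" using half_turn[OF assms] by (simp add: L_def \<alpha>_def)
  \<comment> \<open>One index past the last segment the direction has turned by \<pi>. The absolute
    value absorbs the sign, so rotating by one vertex merely shifts the sum cyclically.\<close>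
  have "cis (real (2 * L + 1) * \<alpha> - pi / 2) = - cis (real (2 * 0 + 1) * \<alpha> - pi / 2)"
  proof -
    have "real (2 * L + 1) * \<alpha> - pi / 2 = pi + (real (2 * 0 + 1) * \<alpha> - pi / 2)"
      using L by (simp add: algebra_simps)
    then show ?thesis by (simp only: cis_mult[symmetric] cis_pi) simp
  qed
  then have "f L = f 0" by (simp add: f_def del: of_nat_add of_nat_mult)
  then have "(\<Sum>m<L. f (Suc m)) = (\<Sum>m<L. f m)"
    using sum.lessThan_Suc_shift[of f L] by simp
  moreover have "f (Suc m) = \<bar>Re (cis (real (2 * m + 1) * \<alpha> - pi / 2) * (cis (2 * \<alpha>) * z))\<bar>" for m
    unfolding f_def mult.assoc[symmetric] cis_mult by (simp add: algebra_simps)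
  ultimately show ?thesis unfolding polygon_support_def f_def L_def \<alpha>_def by simp
qed

lemma polygon_support_rotate_int:
  assumes "b \<ge> 1"
  shows "polygon_support b (cis (of_int m * (2 * (pi / 2 ^ b))) * z) = polygon_support b z"
proof -
  have nat: "polygon_support b (cis (real n * (2 * (pi / 2 ^ b))) * z) = polygon_support b z" for n z
  proof (induction n)
    case (Suc n)
    have "cis (real (Suc n) * (2 * (pi / 2 ^ b))) * z
        = cis (2 * (pi / 2 ^ b)) * (cis (real n * (2 * (pi / 2 ^ b))) * z)"
      unfolding mult.assoc[symmetric] cis_mult by (simp add: algebra_simps add_divide_distrib)
    then show ?case by (simp only: polygon_support_rotate[OF assms] Suc)
  qed simp
  show ?thesis
  proof (cases "m \<ge> 0")
    case True
    then show ?thesis using nat[of "nat m" z] by simp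
  next
    case False
    define w where "w = cis (of_int m * (2 * (pi / 2 ^ b))) * z"
    have "z = cis (real (nat (- m)) * (2 * (pi / 2 ^ b))) * w"
      using False unfolding w_def mult.assoc[symmetric] cis_mult by simp
    then show ?thesis using nat[of "nat (- m)" w] unfolding w_def[symmetric] by simp
  qed
qed

text \<open>This is \<open>polygon_support\<close> without the absolute values. Geometrically, half
  the sum of the edges from the vertex -1 to the vertex 1 is the vertex 1; analytically,
  \<open>2 * sin \<alpha> * cos t\<close> is \<open>sin (t + \<alpha>) - sin (t - \<alpha>)\<close>
  and the sum telescopes.\<close>

lemma polygon_cos_sum:
  assumes "b \<ge> 1"
  shows "sin (pi / 2 ^ b) * (\<Sum>m<2 ^ (b - 1). cos (real (2 * m + 1) * (pi / 2 ^ b) - pi / 2 + x)) = cos x"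
proof -
  define \<alpha> where "\<alpha> = pi / 2 ^ b"
  define g where "g m = sin (x + real (2 * m) * \<alpha> - pi / 2) / 2" for m
  have "sin \<alpha> * cos (real (2 * m + 1) * \<alpha> - pi / 2 + x) = g (Suc m) - g m" for m
  proof -
    define t where "t = real (2 * m + 1) * \<alpha> - pi / 2 + x"
    have "x + real (2 * Suc m) * \<alpha> - pi / 2 = t + \<alpha>" "x + real (2 * m) * \<alpha> - pi / 2 = t - \<alpha>"
      by (simp_all add: t_def algebra_simps)
    then show ?thesis unfolding g_def t_def[symmetric] by (simp only:) (simp add: sin_add sin_diff field_simps)
  qed
  then have "sin \<alpha> * (\<Sum>m<L. cos (real (2 * m + 1) * \<alpha> - pi / 2 + x)) = g L - g 0" for L
    by (simp only: sum_distrib_left sum_lessThan_telescope)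
  moreover have "g (2 ^ (b - 1)) - g 0 = cos x"
  proof -
    have "real (2 * 2 ^ (b - 1)) * \<alpha> = pi"
      using half_turn[OF assms] unfolding \<alpha>_def of_nat_mult by linarith
    then have "x + real (2 * 2 ^ (b - 1)) * \<alpha> - pi / 2 = x + pi / 2" by simp
    then show ?thesis unfolding g_def by (simp only:) (simp add: sin_add sin_diff)
  qed
  ultimately show ?thesis unfolding \<alpha>_def by simp
qed

lemma Re_cis_mult: "Re (cis t * z) = cmod z * cos (t + Arg z)"
proof -
  have "cis t * z = cis t * (complex_of_real (cmod z) * cis (Arg z))"
    using rcis_cmod_Arg[of z] by (simp add: rcis_def)
  also have "\<dots> = complex_of_real (cmod z) * cis (t + Arg z)" by (simp add: cis_mult[symmetric])
  finally show ?thesis by simp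
qed

lemma Re_le_polygon_support:
  assumes "b \<ge> 1"
  shows "Re z \<le> polygon_support b z"
proof -
  define \<alpha> where "\<alpha> = pi / 2 ^ b"
  note R = Re_cis_mult[of _ z]
  have "Re z = cmod z * (sin \<alpha> * (\<Sum>m<2 ^ (b - 1). cos (real (2 * m + 1) * \<alpha> - pi / 2 + Arg z)))"
    using R[of 0] polygon_cos_sum[OF assms, of "Arg z"] unfolding \<alpha>_def by simp
  also have "\<dots> = sin \<alpha> * (\<Sum>m<2 ^ (b - 1). Re (cis (real (2 * m + 1) * \<alpha> - pi / 2) * z))"
    unfolding R by (simp add: sum_distrib_left mult_ac)
  also have "\<dots> \<le> polygon_support b z" unfolding polygon_support_def \<alpha>_def
    by (intro mult_left_mono sum_mono) (use polygon_angle[OF assms] in auto)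
  finally show ?thesis .
qed

lemma polygon_support_sector:
  assumes b: "b \<ge> 1" and "\<bar>Arg z\<bar> \<le> pi / 2 ^ b"
  shows "polygon_support b z = Re z"
proof -
  define \<alpha> where "\<alpha> = pi / 2 ^ b"
  note R = Re_cis_mult[of _ z]
  have pos: "0 \<le> Re (cis (real (2 * m + 1) * \<alpha> - pi / 2) * z)" if "m < 2 ^ (b - 1)" for m
  proof -
    define u where "u = real m * \<alpha>"
    have "real (m + 1) \<le> real (2 ^ (b - 1))" using that by (simp only: of_nat_le_iff)
    then have "real (m + 1) * \<alpha> \<le> real (2 ^ (b - 1)) * \<alpha>"
      by (rule mult_right_mono) (simp add: \<alpha>_def)
    also have "\<dots> = pi / 2" unfolding \<alpha>_def by (rule half_turn[OF b])
    finally have "real (m + 1) * \<alpha> \<le> pi / 2" .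
    then have "u + \<alpha> \<le> pi / 2" by (simp add: u_def algebra_simps)
    moreover have "0 \<le> u" by (simp add: u_def \<alpha>_def)
    moreover have "real (2 * m + 1) * \<alpha> = 2 * u + \<alpha>" by (simp add: u_def algebra_simps)
    moreover have "- \<alpha> \<le> Arg z" "Arg z \<le> \<alpha>" using assms(2) unfolding \<alpha>_def by linarith+
    ultimately have "0 \<le> cos (real (2 * m + 1) * \<alpha> - pi / 2 + Arg z)"
      by (intro cos_ge_zero) simp_all
    then show ?thesis unfolding R by simp
  qed
  have "Re z = cmod z * (sin \<alpha> * (\<Sum>m<2 ^ (b - 1). cos (real (2 * m + 1) * \<alpha> - pi / 2 + Arg z)))"
    using R[of 0] polygon_cos_sum[OF b, of "Arg z"] unfolding \<alpha>_def by simp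
  also have "\<dots> = sin \<alpha> * (\<Sum>m<2 ^ (b - 1). Re (cis (real (2 * m + 1) * \<alpha> - pi / 2) * z))"
    unfolding R by (simp add: sum_distrib_left mult_ac)
  also have "\<dots> = polygon_support b z" unfolding polygon_support_def \<alpha>_def[symmetric]
    by (intro arg_cong2[where f="(*)"] sum.cong) (use pos in auto)
  finally show ?thesis by simp
qed

lemma polygon_support_codebook:
  assumes "b \<ge> 1" "\<psi> \<in> codebook b"
  shows "polygon_support b (cis \<psi> * z) = polygon_support b z"
proof -
  obtain m :: int where "\<psi> = of_int m / 2 ^ b * (2 * pi)" using assms by (auto simp: codebook_def)
  then have "\<psi> = of_int m * (2 * (pi / 2 ^ b))" by simp
  then show ?thesis using polygon_support_rotate_int[OF assms(1)] by simp
qed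

section \<open>The nearest codebook phase\<close>

lemma codebook_finite: "finite (codebook b)" "codebook b \<noteq> {}"
proof -
  have "(1::int) \<in> {- (2 ^ (b - 1) - 1) .. 2 ^ (b - 1)}" by simp
  then show "codebook b \<noteq> {}" unfolding codebook_def by blast
qed (simp add: codebook_def)

lemma quantize_phase_arg_min:
  "quantize_phase b \<theta> \<in> codebook b"
  "\<psi> \<in> codebook b \<Longrightarrow> dist_mod_2pi (quantize_phase b \<theta>) \<theta> \<le> dist_mod_2pi \<psi> \<theta>"
  unfolding quantize_phase_def
  using codebook_finite arg_min_if_finite(1) arg_min_least by metis+

lemma dist_mod_2pi_bdd: "bdd_below (range (\<lambda>m::int. \<bar>x - y + 2 * pi * of_int m\<bar>))"
  by (rule bdd_belowI[of _ 0]) auto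

text \<open>Neighbouring codebook phases are \<open>2 * pi / 2 ^ b\<close> apart and the codebook is
  a full residue system, so rounding costs at most half a gap.\<close>

lemma quantize_phase_dist:
  assumes "b \<ge> 1"
  shows "dist_mod_2pi (quantize_phase b \<theta>) \<theta> \<le> pi / 2 ^ b"
proof -
  define L where "L = (2::int) ^ b"
  define h where "h = (2::int) ^ (b - 1)"
  have L: "L = 2 * h" "L > 0" "h > 0" using assms by (cases b; simp add: L_def h_def)+
  define m where "m = round (\<theta> * of_int L / (2 * pi))"
  \<comment> \<open>The codebook is asymmetric, containing \<pi> but not -\<pi>. The shift by
    \<open>h - 1\<close> before and after the reduction moves the residues into
    \<open>{- (h - 1) .. h}\<close>.\<close>
  define r where "r = (m + h - 1) mod L - (h - 1)"
  define q where "q = (m + h - 1) div L"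
  have m: "m = r + L * q" unfolding r_def q_def by (simp add: algebra_simps)
  have "0 \<le> (m + h - 1) mod L" "(m + h - 1) mod L < L" using L(2) by (auto simp del: mod_less)
  then have r: "r \<in> {- (h - 1) .. h}" unfolding r_def atLeastAtMost_iff using L(1) by linarith
  define \<psi> where "\<psi> = of_int r / 2 ^ b * (2 * pi)"
  have \<psi>: "\<psi> \<in> codebook b" unfolding codebook_def \<psi>_def using r by (auto simp: h_def)
  have LL: "of_int L = (2::real) ^ b" by (simp add: L_def)
  have "dist_mod_2pi \<psi> \<theta> \<le> \<bar>\<psi> - \<theta> + 2 * pi * of_int q\<bar>"
    unfolding dist_mod_2pi_def by (intro cINF_lower dist_mod_2pi_bdd) auto
  also have "\<psi> - \<theta> + 2 * pi * of_int q = (of_int m - \<theta> * of_int L / (2 * pi)) * (2 * pi / 2 ^ b)"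
    unfolding m \<psi>_def of_int_add of_int_mult LL by (simp add: field_simps)
  also have "\<bar>\<dots>\<bar> = \<bar>of_int m - \<theta> * of_int L / (2 * pi)\<bar> * (2 * pi / 2 ^ b)"
    by (simp add: abs_mult)
  also have "\<dots> \<le> 1 / 2 * (2 * pi / 2 ^ b)"
    unfolding m_def by (intro mult_right_mono of_int_round_abs_le) auto
  finally have "dist_mod_2pi \<psi> \<theta> \<le> pi / 2 ^ b" by simp
  then show ?thesis using quantize_phase_arg_min(2)[OF \<psi>, of \<theta>] by linarith
qed

text \<open>The distance is an infimum over shifts, so a shift is only obtained within
  \<open>a + e\<close>; continuity of the cosine then lets e tend to 0. Keeping
  \<open>e < pi / 2\<close> holds \<open>a + e\<close> in the range where the cosine
  decreases.\<close>

lemma cos_ge_dist_mod_2pi: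
  assumes "dist_mod_2pi x y \<le> a" "0 \<le> a" "a \<le> pi / 2"
  shows "cos a \<le> cos (x - y)"
proof -
  have "cos (a + e) \<le> cos (x - y)" if e: "0 < e" "e < pi / 2" for e
  proof -
    have "(INF m::int. \<bar>x - y + 2 * pi * of_int m\<bar>) < a + e"
      using assms(1) e by (simp add: dist_mod_2pi_def)
    then obtain m :: int where m: "\<bar>x - y + 2 * pi * of_int m\<bar> < a + e"
      using cINF_less_iff[OF _ dist_mod_2pi_bdd[of x y]] by auto
    have "cos (a + e) \<le> cos \<bar>x - y + 2 * pi * of_int m\<bar>"
      using m e assms by (intro cos_monotone_0_pi_le) auto
    also have "\<dots> = cos (x - y)"
      by (simp add: cos_add cos_int_2pin sin_int_2pin)
    finally show ?thesis .
  qed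
  then have "\<forall>\<^sub>F e in at_right 0. cos (a + e) \<le> cos (x - y)"
    using pi_gt_zero by (intro eventually_at_rightI[of 0 "pi/2"]) auto
  moreover have "((\<lambda>e. cos (a + e)) \<longlongrightarrow> cos (a + 0)) (at_right 0)"
    by (intro tendsto_intros)
  ultimately have "cos (a + 0) \<le> cos (x - y)"
    by (intro tendsto_upperbound[of "\<lambda>e. cos (a + e)"]) auto
  then show ?thesis by simp
qed

lemma phase_weight_unit: "cmod (phase_weight b z) = 1"
  by (simp add: phase_weight_def)

lemma Re_phase_weight_le:
  assumes "b \<ge> 1"
  shows "Re (phase_weight b y * z) \<le> polygon_support b z"
  using Re_le_polygon_support[OF assms, of "phase_weight b y * z"]
    polygon_support_codebook[OF assms quantize_phase_arg_min(1)]
  by (simp add: phase_weight_def)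

text \<open>Quantization turns \<open>z\<close> into the sector of half-width
  \<open>pi / 2 ^ b\<close> around the positive axis, where the support function is the real part;
  rotation by a codebook phase leaves the support function unchanged. So the quantized phase attains
  the bound of \<open>Re_phase_weight_le\<close>.\<close>

lemma Re_phase_weight_self:
  assumes b: "b \<ge> 1"
  shows "Re (phase_weight b z * z) = polygon_support b z"
proof (cases "z = 0")
  case True
  then show ?thesis by (simp add: polygon_support_def)
next
  case False
  define \<psi> where "\<psi> = quantize_phase b (Arg (cnj z))"
  define x where "x = Arg (cis \<psi> * z)"
  have "cos (pi / 2 ^ b) \<le> cos (\<psi> - Arg (cnj z))"
    unfolding \<psi>_def using quantize_phase_dist[OF b] polygon_angle[OF b]
    by (intro cos_ge_dist_mod_2pi) auto
  also have "cos (\<psi> - Arg (cnj z)) = Re (cis \<psi> * z) / cmod z"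
  proof -
    have "z = cnj (complex_of_real (cmod z) * cis (Arg (cnj z)))"
      using rcis_cmod_Arg[of "cnj z"] by (simp add: rcis_def)
    then have "z = complex_of_real (cmod z) * cis (- Arg (cnj z))" by (simp add: cis_cnj)
    then have "cis \<psi> * z = complex_of_real (cmod z) * cis (\<psi> - Arg (cnj z))"
      by (metis (no_types) cis_mult mult.left_commute diff_conv_add_uminus)
    then show ?thesis using False by simp
  qed
  also have "\<dots> = cos x"
    using False by (simp add: x_def cos_Arg norm_mult)
  finally have "cos (pi / 2 ^ b) \<le> cos \<bar>x\<bar>" by simp
  then have "\<bar>x\<bar> \<le> pi / 2 ^ b"
    using polygon_angle[OF b] Arg_bounded[of "cis \<psi> * z"] pi_gt_zero
    by (subst (asm) cos_mono_le_eq) (auto simp: x_def abs_le_iff)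
  then have "polygon_support b (cis \<psi> * z) = Re (cis \<psi> * z)"
    unfolding x_def by (rule polygon_support_sector[OF b])
  then show ?thesis
    using polygon_support_codebook[OF b quantize_phase_arg_min(1)] by (simp add: phase_weight_def \<psi>_def)
qed

lemma polygon_support_nonneg: "b \<ge> 1 \<Longrightarrow> 0 \<le> polygon_support b z"
  unfolding polygon_support_def using polygon_angle[of b] by (intro mult_nonneg_nonneg sum_nonneg) auto

lemma polygon_support_le_norm: "b \<ge> 1 \<Longrightarrow> polygon_support b z \<le> cmod z"
  using Re_phase_weight_self[of b z] complex_Re_le_cmod[of "phase_weight b z * z"]
  by (simp add: norm_mult phase_weight_unit)

section \<open>Measurability of the quantized phases\<close>

lemma borel_measurable_polygon_support [measurable]: "polygon_support b \<in> borel_measurable borel"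
  unfolding polygon_support_def by measurable

text \<open>At ties the minimizer is a Hilbert choice, about which nothing is known. It depends on
  \<theta> only through the set \<open>S \<theta>\<close> of all minimizers, though, which takes
  finitely many values; and every function on a discrete space is measurable.\<close>

lemma borel_measurable_quantize_phase [measurable]: "quantize_phase b \<in> borel_measurable borel"
proof -
  define P where "P \<psi> \<theta> \<longleftrightarrow> (\<forall>x\<in>codebook b. dist_mod_2pi \<psi> \<theta> \<le> dist_mod_2pi x \<theta>)" for \<psi> \<theta>
  define S where "S \<theta> = {\<psi> \<in> codebook b. P \<psi> \<theta>}" for \<theta>
  have d: "(\<lambda>\<theta>. dist_mod_2pi \<psi> \<theta>) \<in> borel_measurable borel" for \<psi>
    unfolding dist_mod_2pi_def by (rule borel_measurable_cINF) (auto intro: dist_mod_2pi_bdd)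
  have P: "Measurable.pred borel (P \<psi>)" for \<psi>
    unfolding P_def using borel_measurable_le[OF d d]
    by (intro pred_intros_finite(3) codebook_finite) (simp add: pred_def)
  have PT: "Measurable.pred borel (\<lambda>\<theta>. \<forall>\<psi>\<in>codebook b. (\<psi> \<in> T \<longleftrightarrow> P \<psi> \<theta>))" for T
  proof (intro pred_intros_finite(3) codebook_finite)
    fix \<psi> show "Measurable.pred borel (\<lambda>\<theta>. \<psi> \<in> T \<longleftrightarrow> P \<psi> \<theta>)"
      using P[of \<psi>] pred_intros_logic(2)[OF P[of \<psi>]] by (cases "\<psi> \<in> T") simp_all
  qed
  have S: "S \<in> borel \<rightarrow>\<^sub>M count_space (Pow (codebook b))"
  proof (subst measurable_count_space_eq2, safe)
    fix T assume T: "T \<subseteq> codebook b"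
    have "S \<theta> = T \<longleftrightarrow> (\<forall>\<psi>\<in>codebook b. (\<psi> \<in> T \<longleftrightarrow> P \<psi> \<theta>))" for \<theta>
      using T unfolding S_def by blast
    then have "S -` {T} \<inter> space borel = {\<theta> \<in> space borel. \<forall>\<psi>\<in>codebook b. (\<psi> \<in> T \<longleftrightarrow> P \<psi> \<theta>)}"
      by auto
    then show "S -` {T} \<inter> space borel \<in> sets borel"
      using PT[of T] by (simp only: pred_def)
  qed (auto simp: S_def codebook_finite)
  have "quantize_phase b = (\<lambda>T. SOME x. x \<in> T) \<circ> S"
    unfolding quantize_phase_def arg_min_on_def arg_min_def is_arg_min_def S_def P_def comp_def
    by (intro ext arg_cong[where f=Eps]) (auto simp: not_less)
  also have "\<dots> \<in> borel_measurable borel" by (rule measurable_comp[OF S]) simp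
  finally show ?thesis .
qed

lemma borel_measurable_phase_weight [measurable]: "phase_weight b \<in> borel_measurable borel"
proof -
  have [measurable]: "cis \<in> borel_measurable borel"
    by (intro borel_measurable_continuous_onI continuous_intros)
  have [measurable]: "cnj \<in> borel_measurable borel"
    by (intro borel_measurable_continuous_onI continuous_intros)
  \<comment> \<open>\<open>Arg\<close> jumps across the negative axis, is constant on it and
    continuous off it; the value at 0 is a convention.\<close>
  have Arg: "Arg = (\<lambda>z. if z = 0 then 0 else if z \<in> \<real>\<^sub>\<le>\<^sub>0 then pi else Arg z)"
  proof
    fix z show "Arg z = (if z = 0 then 0 else if z \<in> \<real>\<^sub>\<le>\<^sub>0 then pi else Arg z)"
    proof (cases "z = 0 \<or> z \<notin> \<real>\<^sub>\<le>\<^sub>0")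
      case False
      then show ?thesis
        using Arg_eq_pi[of z] complex_nonpos_Reals_iff[of z] by (auto simp: complex_eq_iff)
    qed (auto simp: Complex_Transcendental.Arg_def)
  qed
  have [measurable]: "Arg \<in> borel_measurable borel"
    by (subst Arg, intro measurable_If borel_measurable_continuous_on_if continuous_on_Arg)
      (auto simp: closed_nonpos_Reals_complex)
  show ?thesis unfolding phase_weight_def by measurable
qed

subsection \<open>Gaussian moments\<close>

context prob_space
begin

text \<open>Tonelli on two independent copies of the sample space, in both orders. Nonnegative
  integrals ask for no integrability in advance; it follows later from the bounds
  themselves.\<close>

lemma nn_integral_indep_var:
  assumes ind: "indep_var S X T Y" and f: "f \<in> borel_measurable (S \<Otimes>\<^sub>M T)"
  shows "(\<integral>\<^sup>+\<omega>. f (X \<omega>, Y \<omega>) \<partial>M) = (\<integral>\<^sup>+\<omega>'. \<integral>\<^sup>+\<omega>. f (X \<omega>', Y \<omega>) \<partial>M \<partial>M)" (is ?thesis1)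
    and "(\<integral>\<^sup>+\<omega>. f (X \<omega>, Y \<omega>) \<partial>M) = (\<integral>\<^sup>+\<omega>. \<integral>\<^sup>+\<omega>'. f (X \<omega>', Y \<omega>) \<partial>M \<partial>M)" (is ?thesis2)
proof -
  have X [measurable]: "X \<in> M \<rightarrow>\<^sub>M S" and Y [measurable]: "Y \<in> M \<rightarrow>\<^sub>M T"
    and eq: "distr M S X \<Otimes>\<^sub>M distr M T Y = distr M (S \<Otimes>\<^sub>M T) (\<lambda>x. (X x, Y x))"
    using ind by (auto simp: indep_var_distribution_eq)
  interpret X: prob_space "distr M S X" by (rule prob_space_distr[OF X])
  interpret Y: prob_space "distr M T Y" by (rule prob_space_distr[OF Y])
  interpret XY: pair_prob_space "distr M S X" "distr M T Y" ..
  have f': "f \<in> borel_measurable (distr M S X \<Otimes>\<^sub>M distr M T Y)"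
    using f by (simp cong: measurable_cong_sets)
  have "(\<integral>\<^sup>+\<omega>. f (X \<omega>, Y \<omega>) \<partial>M) = (\<integral>\<^sup>+z. f z \<partial>(distr M S X \<Otimes>\<^sub>M distr M T Y))"
    unfolding eq using f by (subst nn_integral_distr) auto
  note * = this
  have "\<dots> = (\<integral>\<^sup>+x. \<integral>\<^sup>+y. f (x, y) \<partial>distr M T Y \<partial>distr M S X)"
    by (rule Y.nn_integral_fst[symmetric, OF f'])
  also have "\<dots> = (\<integral>\<^sup>+x. \<integral>\<^sup>+\<omega>. f (x, Y \<omega>) \<partial>M \<partial>distr M S X)"
    using f by (intro nn_integral_cong nn_integral_distr) auto
  also have "\<dots> = (\<integral>\<^sup>+\<omega>'. \<integral>\<^sup>+\<omega>. f (X \<omega>', Y \<omega>) \<partial>M \<partial>M)"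
    using f by (subst nn_integral_distr) auto
  finally show ?thesis1 unfolding * .
  have "(\<integral>\<^sup>+z. f z \<partial>(distr M S X \<Otimes>\<^sub>M distr M T Y)) = (\<integral>\<^sup>+y. \<integral>\<^sup>+x. f (x, y) \<partial>distr M S X \<partial>distr M T Y)"
    by (rule XY.nn_integral_snd[symmetric]) (use f' in simp)
  also have "\<dots> = (\<integral>\<^sup>+y. \<integral>\<^sup>+\<omega>. f (X \<omega>, y) \<partial>M \<partial>distr M T Y)"
    using f by (intro nn_integral_cong nn_integral_distr) auto
  also have "\<dots> = (\<integral>\<^sup>+\<omega>. \<integral>\<^sup>+\<omega>'. f (X \<omega>', Y \<omega>) \<partial>M \<partial>M)"
    using f by (subst nn_integral_distr) auto
  finally show ?thesis2 unfolding * .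
qed

lemma integrable_nn_integral_le:
  fixes f :: "'a \<Rightarrow> real"
  assumes f: "f \<in> borel_measurable M" "\<And>\<omega>. \<omega> \<in> space M \<Longrightarrow> 0 \<le> f \<omega>"
    and le: "(\<integral>\<^sup>+\<omega>. ennreal (f \<omega>) \<partial>M) \<le> ennreal C" and C: "0 \<le> C"
  shows "integrable M f" "expectation f \<le> C"
proof -
  show *: "integrable M f"
    using f le by (intro integrableI_nonneg) (auto intro: AE_I2 order.strict_trans1)
  have "ennreal (expectation f) \<le> ennreal C"
    using le f by (subst nn_integral_eq_integral[symmetric]) (auto intro: * AE_I2)
  then show "expectation f \<le> C" using C by (simp add: ennreal_le_iff)
qed

lemma indep_vars_imp_indep_var:
  assumes ind: "indep_vars N X J" and ij: "i \<in> J" "j \<in> J" "i \<noteq> j"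
  shows "indep_var (N i) (X i) (N j) (X j)"
proof -
  have "indep_var (N i) ((\<lambda>f. f i) \<circ> (\<lambda>\<omega>. restrict (\<lambda>i. X i \<omega>) {i}))
    (N j) ((\<lambda>f. f j) \<circ> (\<lambda>\<omega>. restrict (\<lambda>i. X i \<omega>) {j}))"
    using ij by (intro indep_var_compose[OF indep_var_restrict[OF ind]]) auto
  then show ?thesis by (simp add: comp_def)
qed

text \<open>An inequality in place of the variance formula: the diagonal products are granted an
  extra squared mean, so that all products of means complete to one square.\<close>

lemma indep_vars_square_sum:
  fixes X :: "'i \<Rightarrow> 'a \<Rightarrow> real"
  assumes fin: "finite J" and ind: "indep_vars (\<lambda>_. borel) X J"
    and sq: "\<And>j. j \<in> J \<Longrightarrow> integrable M (\<lambda>\<omega>. (X j \<omega>)\<^sup>2)"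
  shows "integrable M (\<lambda>\<omega>. (\<Sum>j\<in>J. X j \<omega>)\<^sup>2)"
    and "expectation (\<lambda>\<omega>. (\<Sum>j\<in>J. X j \<omega>)\<^sup>2)
        \<le> (\<Sum>j\<in>J. expectation (\<lambda>\<omega>. (X j \<omega>)\<^sup>2)) + (\<Sum>j\<in>J. expectation (X j))\<^sup>2"
proof -
  have rv: "j \<in> J \<Longrightarrow> X j \<in> borel_measurable M" for j using ind by (auto simp: indep_vars_def)
  have int: "j \<in> J \<Longrightarrow> integrable M (X j)" for j
    by (rule square_integrable_imp_integrable[OF rv sq])
  note iv = indep_vars_imp_indep_var[OF ind]
  have prod: "integrable M (\<lambda>\<omega>. X i \<omega> * X j \<omega>)"
      "expectation (\<lambda>\<omega>. X i \<omega> * X j \<omega>) \<le> expectation (X i) * expectation (X j) +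
        (if i = j then expectation (\<lambda>\<omega>. (X i \<omega>)\<^sup>2) else 0)" if "i \<in> J" "j \<in> J" for i j
  proof -
    have "integrable M (\<lambda>\<omega>. X i \<omega> * X j \<omega>) \<and>
      expectation (\<lambda>\<omega>. X i \<omega> * X j \<omega>) \<le> expectation (X i) * expectation (X j) +
        (if i = j then expectation (\<lambda>\<omega>. (X i \<omega>)\<^sup>2) else 0)"
    proof (cases "i = j")
      case True
      then show ?thesis using sq[OF that(1)] zero_le_square[of "expectation (X j)"]
        by (simp add: power2_eq_square)
    next
      case False
      then show ?thesis
        using indep_var_integrable[OF iv[OF that False] int int] indep_var_lebesgue_integral[OF iv[OF that False] int int] that
        by simp
    qed
    then show "integrable M (\<lambda>\<omega>. X i \<omega> * X j \<omega>)"
      "expectation (\<lambda>\<omega>. X i \<omega> * X j \<omega>) \<le> expectation (X i) * expectation (X j) +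
        (if i = j then expectation (\<lambda>\<omega>. (X i \<omega>)\<^sup>2) else 0)" by blast+
  qed
  have eq: "(\<Sum>j\<in>J. X j \<omega>)\<^sup>2 = (\<Sum>i\<in>J. \<Sum>j\<in>J. X i \<omega> * X j \<omega>)" for \<omega>
    by (simp add: power2_eq_square sum_product)
  show "integrable M (\<lambda>\<omega>. (\<Sum>j\<in>J. X j \<omega>)\<^sup>2)"
    unfolding eq by (intro Bochner_Integration.integrable_sum prod)
  have "expectation (\<lambda>\<omega>. (\<Sum>j\<in>J. X j \<omega>)\<^sup>2) = (\<Sum>i\<in>J. \<Sum>j\<in>J. expectation (\<lambda>\<omega>. X i \<omega> * X j \<omega>))"
    unfolding eq by (subst Bochner_Integration.integral_sum, (intro Bochner_Integration.integrable_sum prod; assumption),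
        intro sum.cong refl Bochner_Integration.integral_sum prod)
  also have "\<dots> \<le> (\<Sum>i\<in>J. \<Sum>j\<in>J. expectation (X i) * expectation (X j) +
        (if i = j then expectation (\<lambda>\<omega>. (X i \<omega>)\<^sup>2) else 0))"
    by (intro sum_mono prod)
  also have "\<dots> = (\<Sum>j\<in>J. expectation (\<lambda>\<omega>. (X j \<omega>)\<^sup>2)) + (\<Sum>j\<in>J. expectation (X j))\<^sup>2"
    using fin by (simp add: sum.distrib power2_eq_square sum_product)
  finally show "expectation (\<lambda>\<omega>. (\<Sum>j\<in>J. X j \<omega>)\<^sup>2)
        \<le> (\<Sum>j\<in>J. expectation (\<lambda>\<omega>. (X j \<omega>)\<^sup>2)) + (\<Sum>j\<in>J. expectation (X j))\<^sup>2" .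
qed

lemma indep_vars_centered_square_sum:
  fixes X :: "'i \<Rightarrow> 'a \<Rightarrow> real"
  assumes fin: "finite J" and ind: "indep_vars (\<lambda>_. borel) X J"
    and sq: "\<And>j. j \<in> J \<Longrightarrow> integrable M (\<lambda>\<omega>. (X j \<omega>)\<^sup>2)"
  shows "integrable M (\<lambda>\<omega>. ((\<Sum>j\<in>J. X j \<omega>) - (\<Sum>j\<in>J. expectation (X j)))\<^sup>2)"
    and "expectation (\<lambda>\<omega>. ((\<Sum>j\<in>J. X j \<omega>) - (\<Sum>j\<in>J. expectation (X j)))\<^sup>2)
        \<le> (\<Sum>j\<in>J. expectation (\<lambda>\<omega>. (X j \<omega>)\<^sup>2))"
proof -
  have rv: "j \<in> J \<Longrightarrow> X j \<in> borel_measurable M" for j using ind by (auto simp: indep_vars_def)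
  have int: "j \<in> J \<Longrightarrow> integrable M (X j)" for j
    by (rule square_integrable_imp_integrable[OF rv sq])
  define m where "m = (\<Sum>j\<in>J. expectation (X j))"
  have S: "integrable M (\<lambda>\<omega>. \<Sum>j\<in>J. X j \<omega>)" "expectation (\<lambda>\<omega>. \<Sum>j\<in>J. X j \<omega>) = m"
    unfolding m_def using int by (auto intro!: Bochner_Integration.integral_sum)
  have eq: "((\<Sum>j\<in>J. X j \<omega>) - m)\<^sup>2 = (\<Sum>j\<in>J. X j \<omega>)\<^sup>2 - 2 * m * (\<Sum>j\<in>J. X j \<omega>) + m\<^sup>2" for \<omega>
    by (simp add: power2_eq_square algebra_simps)
  note S2 = indep_vars_square_sum[OF fin ind sq]
  show "integrable M (\<lambda>\<omega>. ((\<Sum>j\<in>J. X j \<omega>) - (\<Sum>j\<in>J. expectation (X j)))\<^sup>2)"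
    unfolding m_def[symmetric] eq using S(1) S2(1) by auto
  have "expectation (\<lambda>\<omega>. ((\<Sum>j\<in>J. X j \<omega>) - m)\<^sup>2)
      = expectation (\<lambda>\<omega>. (\<Sum>j\<in>J. X j \<omega>)\<^sup>2) - 2 * m * m + m\<^sup>2"
    unfolding eq using S S2(1) by (simp add: prob_space)
  then show "expectation (\<lambda>\<omega>. ((\<Sum>j\<in>J. X j \<omega>) - (\<Sum>j\<in>J. expectation (X j)))\<^sup>2)
        \<le> (\<Sum>j\<in>J. expectation (\<lambda>\<omega>. (X j \<omega>)\<^sup>2))"
    using S2(2) unfolding m_def[symmetric] by (simp add: power2_eq_square)
qed

section \<open>Linear combinations of complex Gaussians\<close>

lemma complex_normal_Re_mult:
  assumes Z: "complex_normal v Z" and v: "0 < v" and a: "a \<noteq> 0"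
  shows "distributed M lborel (\<lambda>\<omega>. Re (Z \<omega> * a)) (normal_density 0 (cmod a * sqrt (v / 2)))"
proof -
  have s: "0 < sqrt (v / 2)" using v by simp
  have R: "distributed M lborel (\<lambda>\<omega>. Re (Z \<omega>)) (normal_density 0 (sqrt (v / 2)))"
    and I: "distributed M lborel (\<lambda>\<omega>. Im (Z \<omega>)) (normal_density 0 (sqrt (v / 2)))"
    and ind: "indep_var borel (\<lambda>\<omega>. Re (Z \<omega>)) borel (\<lambda>\<omega>. Im (Z \<omega>))"
    using Z by (auto simp: complex_normal_def)
  have R': "distributed M lborel (\<lambda>\<omega>. Re a * Re (Z \<omega>)) (normal_density 0 (\<bar>Re a\<bar> * sqrt (v / 2)))"
    if "Re a \<noteq> 0" using normal_density_affine[OF R s that, of 0] by simp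
  have I': "distributed M lborel (\<lambda>\<omega>. - Im a * Im (Z \<omega>)) (normal_density 0 (\<bar>Im a\<bar> * sqrt (v / 2)))"
    if "Im a \<noteq> 0" using normal_density_affine[OF I s, of "- Im a" 0] that by simp
  have eq: "Re (Z \<omega> * a) = Re a * Re (Z \<omega>) + - Im a * Im (Z \<omega>)" for \<omega> by simp
  \<comment> \<open>A normal law of variance 0 has no density, so a vanishing part of
    \<open>a\<close> is treated apart. In all cases circular symmetry leaves only the modulus of
    \<open>a\<close>.\<close>
  consider "Re a = 0" "Im a \<noteq> 0" | "Re a \<noteq> 0" "Im a = 0" | "Re a \<noteq> 0" "Im a \<noteq> 0"
    using a by (auto simp: complex_eq_iff)
  then show ?thesis
  proof cases
    case 1
    then show ?thesis using I' by (simp add: cmod_def mult.commute)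
  next
    case 2
    then show ?thesis using R' by (simp add: cmod_def mult.commute)
  next
    case 3
    have "indep_var borel ((\<lambda>x. Re a * x) \<circ> (\<lambda>\<omega>. Re (Z \<omega>))) borel ((\<lambda>x. - Im a * x) \<circ> (\<lambda>\<omega>. Im (Z \<omega>)))"
      by (rule indep_var_compose[OF ind]) auto
    then have "distributed M lborel (\<lambda>\<omega>. Re a * Re (Z \<omega>) + - Im a * Im (Z \<omega>))
      (normal_density (0 + 0) (sqrt ((\<bar>Re a\<bar> * sqrt (v / 2))\<^sup>2 + (\<bar>Im a\<bar> * sqrt (v / 2))\<^sup>2)))"
      using 3 s by (intro add_indep_normal R' I') (auto simp: comp_def)
    also have "sqrt ((\<bar>Re a\<bar> * sqrt (v / 2))\<^sup>2 + (\<bar>Im a\<bar> * sqrt (v / 2))\<^sup>2) = cmod a * sqrt (v / 2)"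
      using v by (simp add: cmod_def power_mult_distrib distrib_right[symmetric] real_sqrt_mult[symmetric])
    finally show ?thesis unfolding eq by simp
  qed
qed

lemma complex_normal_Re_linear:
  assumes ind: "indep_vars (\<lambda>_. borel) Z I" and fin: "finite I"
    and Z: "\<And>i. i \<in> I \<Longrightarrow> complex_normal v (Z i)" and v: "0 < v" and a: "(\<Sum>i\<in>I. (cmod (a i))\<^sup>2) > 0"
  shows "distributed M lborel (\<lambda>\<omega>. Re (\<Sum>i\<in>I. Z i \<omega> * a i))
           (normal_density 0 (sqrt (v / 2 * (\<Sum>i\<in>I. (cmod (a i))\<^sup>2))))"
proof -
  \<comment> \<open>Zero coefficients are removed because each summand has to have a
    density.\<close>
  define J where "J = {i\<in>I. a i \<noteq> 0}"
  have J: "finite J" "J \<subseteq> I" using fin by (auto simp: J_def)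
  have "J \<noteq> {}"
  proof
    assume "J = {}"
    then have "\<And>i. i \<in> I \<Longrightarrow> a i = 0" by (auto simp: J_def)
    then show False using a by simp
  qed
  have "indep_vars (\<lambda>_. borel) (\<lambda>i \<omega>. Re (Z i \<omega> * a i)) J"
    by (rule indep_vars_compose2[OF indep_vars_subset[OF ind J(2)]]) simp
  then have "distributed M lborel (\<lambda>\<omega>. \<Sum>i\<in>J. Re (Z i \<omega> * a i))
      (normal_density (\<Sum>i\<in>J. 0) (sqrt (\<Sum>i\<in>J. (cmod (a i) * sqrt (v / 2))\<^sup>2)))"
    using J \<open>J \<noteq> {}\<close> v by (intro sum_indep_normal complex_normal_Re_mult Z) (auto simp: J_def)
  also have "(\<Sum>i\<in>J. (cmod (a i) * sqrt (v / 2))\<^sup>2) = v / 2 * (\<Sum>i\<in>J. (cmod (a i))\<^sup>2)"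
    using v by (simp add: power_mult_distrib sum_distrib_left mult_ac)
  also have "(\<Sum>i\<in>J. (cmod (a i))\<^sup>2) = (\<Sum>i\<in>I. (cmod (a i))\<^sup>2)"
    using fin by (intro sum.mono_neutral_left) (auto simp: J_def)
  also have "(\<lambda>\<omega>. \<Sum>i\<in>J. Re (Z i \<omega> * a i)) = (\<lambda>\<omega>. Re (\<Sum>i\<in>I. Z i \<omega> * a i))"
    unfolding Re_sum using fin by (intro ext sum.mono_neutral_left) (auto simp: J_def)
  finally show ?thesis by simp
qed

lemma normal_moments:
  assumes X: "distributed M lborel X (normal_density 0 s)" and s: "0 < s"
  shows "integrable M (\<lambda>\<omega>. \<bar>X \<omega>\<bar>)" "expectation (\<lambda>\<omega>. \<bar>X \<omega>\<bar>) = s * sqrt (2 / pi)"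
    and "integrable M (\<lambda>\<omega>. (X \<omega>)\<^sup>2)" "expectation (\<lambda>\<omega>. (X \<omega>)\<^sup>2) = s\<^sup>2"
    and "integrable M (\<lambda>\<omega>. (X \<omega>) ^ 4)" "expectation (\<lambda>\<omega>. (X \<omega>) ^ 4) = 3 * s ^ 4"
proof -
  have I: "integrable M (\<lambda>\<omega>. f (X \<omega>)) \<longleftrightarrow> integrable lborel (\<lambda>x. normal_density 0 s x * f x)"
    "expectation (\<lambda>\<omega>. f (X \<omega>)) = (\<integral>x. normal_density 0 s x * f x \<partial>lborel)"
    if "f \<in> borel_measurable borel" for f :: "real \<Rightarrow> real"
    using distributed_integrable[OF X, of f] distributed_integral[OF X, of f] that by auto
  show "integrable M (\<lambda>\<omega>. \<bar>X \<omega>\<bar>)"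
    using integrable_normal_moment_abs[OF s, of 0 1] by (subst I) auto
  show "expectation (\<lambda>\<omega>. \<bar>X \<omega>\<bar>) = s * sqrt (2 / pi)"
    using integral_normal_moment_abs_odd[OF s, of 0 0] by (subst I) auto
  show "integrable M (\<lambda>\<omega>. (X \<omega>)\<^sup>2)"
    using integrable_normal_moment[OF s, of 0 2] by (subst I) auto
  show "expectation (\<lambda>\<omega>. (X \<omega>)\<^sup>2) = s\<^sup>2"
    using integral_normal_moment_even[OF s, of 0 1] by (subst I) auto
  show "integrable M (\<lambda>\<omega>. (X \<omega>) ^ 4)"
    using integrable_normal_moment[OF s, of 0 4] by (subst I) auto
  show "expectation (\<lambda>\<omega>. (X \<omega>) ^ 4) = 3 * s ^ 4"
    using integral_normal_moment_even[OF s, of 0 2] s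
    by (subst I) (auto simp: fact_numeral power_divide field_simps)
qed

text \<open>A centered normal variable of deviation s has absolute mean s sqrt (2 / \<pi>); here s
  is \<open>sqrt (v / 2)\<close> times the norm of \<open>a\<close>. The degenerate case
  \<open>a = 0\<close> is included, so that realizations with a zero channel column need no
  exception later.\<close>

lemma complex_normal_linear_abs:
  assumes ind: "indep_vars (\<lambda>_. borel) Z I" and fin: "finite I"
    and Z: "\<And>i. i \<in> I \<Longrightarrow> complex_normal v (Z i)" and v: "0 < v"
  shows "integrable M (\<lambda>\<omega>. \<bar>Re (\<Sum>i\<in>I. Z i \<omega> * a i)\<bar>)"
    and "expectation (\<lambda>\<omega>. \<bar>Re (\<Sum>i\<in>I. Z i \<omega> * a i)\<bar>) = sqrt (v / pi) * L2_set (\<lambda>i. cmod (a i)) I"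
    and "integrable M (\<lambda>\<omega>. (Re (\<Sum>i\<in>I. Z i \<omega> * a i))\<^sup>2)"
    and "expectation (\<lambda>\<omega>. (Re (\<Sum>i\<in>I. Z i \<omega> * a i))\<^sup>2) = v / 2 * (\<Sum>i\<in>I. (cmod (a i))\<^sup>2)"
proof -
  define A where "A = (\<Sum>i\<in>I. (cmod (a i))\<^sup>2)"
  define X where "X \<omega> = Re (\<Sum>i\<in>I. Z i \<omega> * a i)" for \<omega>
  have "integrable M (\<lambda>\<omega>. \<bar>X \<omega>\<bar>) \<and> expectation (\<lambda>\<omega>. \<bar>X \<omega>\<bar>) = sqrt (v / pi) * sqrt A
    \<and> integrable M (\<lambda>\<omega>. (X \<omega>)\<^sup>2) \<and> expectation (\<lambda>\<omega>. (X \<omega>)\<^sup>2) = v / 2 * A"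
  proof (cases "A > 0")
    case True
    have X: "distributed M lborel X (normal_density 0 (sqrt (v / 2 * A)))"
      unfolding X_def A_def using complex_normal_Re_linear[OF ind fin Z v] True by (simp add: A_def)
    have "sqrt (v / 2 * A) * sqrt (2 / pi) = sqrt (v / pi) * sqrt A"
      by (simp add: real_sqrt_mult[symmetric])
    then show ?thesis using normal_moments[OF X] True v by simp
  next
    case False
    then have "A = 0" by (metis A_def less_eq_real_def sum_nonneg zero_le_power2)
    then have "\<And>i. i \<in> I \<Longrightarrow> a i = 0" using fin unfolding A_def by (subst (asm) sum_nonneg_eq_0_iff) auto
    then have "X = (\<lambda>_. 0)" by (auto simp: X_def)
    then show ?thesis using \<open>A = 0\<close> by simp
  qed
  then show "integrable M (\<lambda>\<omega>. \<bar>Re (\<Sum>i\<in>I. Z i \<omega> * a i)\<bar>)"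
    "expectation (\<lambda>\<omega>. \<bar>Re (\<Sum>i\<in>I. Z i \<omega> * a i)\<bar>) = sqrt (v / pi) * L2_set (\<lambda>i. cmod (a i)) I"
    "integrable M (\<lambda>\<omega>. (Re (\<Sum>i\<in>I. Z i \<omega> * a i))\<^sup>2)"
    "expectation (\<lambda>\<omega>. (Re (\<Sum>i\<in>I. Z i \<omega> * a i))\<^sup>2) = v / 2 * (\<Sum>i\<in>I. (cmod (a i))\<^sup>2)"
    unfolding X_def A_def L2_set_def by blast+
qed

lemma complex_normal_linear_square:
  assumes ind: "indep_vars (\<lambda>_. borel) Z I" and fin: "finite I"
    and Z: "\<And>i. i \<in> I \<Longrightarrow> complex_normal v (Z i)" and v: "0 < v"
  shows "integrable M (\<lambda>\<omega>. (cmod (\<Sum>i\<in>I. Z i \<omega> * a i))\<^sup>2)"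
    and "expectation (\<lambda>\<omega>. (cmod (\<Sum>i\<in>I. Z i \<omega> * a i))\<^sup>2) = v * (\<Sum>i\<in>I. (cmod (a i))\<^sup>2)"
proof -
  note R = complex_normal_linear_abs(3,4)[OF ind fin Z v]
  \<comment> \<open>The imaginary part is the real part of the combination with coefficients
    \<open>- \<i> * a i\<close>, so the previous lemma covers both.\<close>
  have eq: "(cmod (\<Sum>i\<in>I. Z i \<omega> * a i))\<^sup>2 = (Re (\<Sum>i\<in>I. Z i \<omega> * a i))\<^sup>2
      + (Re (\<Sum>i\<in>I. Z i \<omega> * (- \<i> * a i)))\<^sup>2" for \<omega>
  proof -
    have "(\<Sum>i\<in>I. Z i \<omega> * (- \<i> * a i)) = - \<i> * (\<Sum>i\<in>I. Z i \<omega> * a i)"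
      by (simp add: sum_distrib_left mult_ac)
    then show ?thesis unfolding cmod_power2 by (simp only:) (simp add: add.commute)
  qed
  show "integrable M (\<lambda>\<omega>. (cmod (\<Sum>i\<in>I. Z i \<omega> * a i))\<^sup>2)"
    unfolding eq by (intro Bochner_Integration.integrable_add R) auto
  show "expectation (\<lambda>\<omega>. (cmod (\<Sum>i\<in>I. Z i \<omega> * a i))\<^sup>2) = v * (\<Sum>i\<in>I. (cmod (a i))\<^sup>2)"
    unfolding eq using R[of a] R[of "\<lambda>i. - \<i> * a i"]
    by (subst Bochner_Integration.integral_add) (auto simp: norm_mult)
qed

lemma complex_normal_moments:
  assumes Z: "complex_normal v Z" and v: "0 < v"
  shows "Z \<in> borel_measurable M"
    and "integrable M (\<lambda>\<omega>. (cmod (Z \<omega>))\<^sup>2)" "expectation (\<lambda>\<omega>. (cmod (Z \<omega>))\<^sup>2) = v"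
    and "integrable M (\<lambda>\<omega>. ((cmod (Z \<omega>))\<^sup>2)\<^sup>2)" "expectation (\<lambda>\<omega>. ((cmod (Z \<omega>))\<^sup>2)\<^sup>2) \<le> 3 * v\<^sup>2"
proof -
  have s: "0 < sqrt (v / 2)" using v by simp
  have "distributed M lborel (\<lambda>\<omega>. Re (Z \<omega>)) (normal_density 0 (sqrt (v / 2)))"
    "distributed M lborel (\<lambda>\<omega>. Im (Z \<omega>)) (normal_density 0 (sqrt (v / 2)))"
    using Z by (auto simp: complex_normal_def)
  note R = normal_moments[OF this(1) s] and I = normal_moments[OF this(2) s]
    and RI = distributed_measurable[OF this(1)] distributed_measurable[OF this(2)]
  have ri [measurable]: "(\<lambda>\<omega>. Re (Z \<omega>)) \<in> borel_measurable M" "(\<lambda>\<omega>. Im (Z \<omega>)) \<in> borel_measurable M"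
    using RI by auto
  then show [measurable]: "Z \<in> borel_measurable M" by (simp add: borel_measurable_complex_iff)
  show "integrable M (\<lambda>\<omega>. (cmod (Z \<omega>))\<^sup>2)" unfolding cmod_power2 using R I by auto
  show "expectation (\<lambda>\<omega>. (cmod (Z \<omega>))\<^sup>2) = v" unfolding cmod_power2 using R I v by simp
  have v4: "sqrt (v / 2) ^ 4 = v\<^sup>2 / 4"
    using v using power_mult[of "sqrt (v / 2)" 2 2] by (simp add: power_divide)
  \<comment> \<open>A crude bound without mixed moments. Each part has fourth moment 3 (v/2)^2,
    which adds up to 3 v^2; any multiple of v^2 would do for Chebyshev.\<close>
  have le: "((cmod z)\<^sup>2)\<^sup>2 \<le> 2 * Re z ^ 4 + 2 * Im z ^ 4" for z
  proof -
    have "0 \<le> ((Re z)\<^sup>2 - (Im z)\<^sup>2)\<^sup>2" by simp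
    then show ?thesis unfolding cmod_power2 by (simp add: power2_eq_square power4_eq_xxxx algebra_simps)
  qed
  have B: "integrable M (\<lambda>\<omega>. 2 * Re (Z \<omega>) ^ 4 + 2 * Im (Z \<omega>) ^ 4)" using R I by auto
  show *: "integrable M (\<lambda>\<omega>. ((cmod (Z \<omega>))\<^sup>2)\<^sup>2)"
    by (rule Bochner_Integration.integrable_bound[OF B]) (use le in \<open>auto intro!: AE_I2 intro: order_trans[OF _ abs_ge_self]\<close>)
  have "expectation (\<lambda>\<omega>. ((cmod (Z \<omega>))\<^sup>2)\<^sup>2) \<le> expectation (\<lambda>\<omega>. 2 * Re (Z \<omega>) ^ 4 + 2 * Im (Z \<omega>) ^ 4)"
    by (intro integral_mono * B le)
  also have "\<dots> = 3 * v\<^sup>2" using R I by (simp add: v4)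
  finally show "expectation (\<lambda>\<omega>. ((cmod (Z \<omega>))\<^sup>2)\<^sup>2) \<le> 3 * v\<^sup>2" .
qed

lemma complex_normal_norm_concentration:
  fixes v :: real
  assumes ind: "indep_vars (\<lambda>_. borel) Z I" and fin: "finite I"
    and Z: "\<And>i. i \<in> I \<Longrightarrow> complex_normal v (Z i)" and v: "0 < v"
  shows "integrable M (\<lambda>\<omega>. ((\<Sum>i\<in>I. (cmod (Z i \<omega>))\<^sup>2) - card I * v)\<^sup>2)"
    and "expectation (\<lambda>\<omega>. ((\<Sum>i\<in>I. (cmod (Z i \<omega>))\<^sup>2) - card I * v)\<^sup>2) \<le> card I * (3 * v\<^sup>2)"
proof -
  note m = complex_normal_moments[OF Z v]
  have ind': "indep_vars (\<lambda>_. borel) (\<lambda>i \<omega>. (cmod (Z i \<omega>))\<^sup>2) I"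
    by (rule indep_vars_compose2[OF ind]) simp
  have e: "(\<Sum>i\<in>I. expectation (\<lambda>\<omega>. (cmod (Z i \<omega>))\<^sup>2)) = card I * v" using m(3) by simp
  note * = indep_vars_centered_square_sum[OF fin ind' m(4), unfolded e]
  show "integrable M (\<lambda>\<omega>. ((\<Sum>i\<in>I. (cmod (Z i \<omega>))\<^sup>2) - card I * v)\<^sup>2)" using *(1) .
  have "(\<Sum>i\<in>I. expectation (\<lambda>\<omega>. ((cmod (Z i \<omega>))\<^sup>2)\<^sup>2)) \<le> (\<Sum>i\<in>I. 3 * v\<^sup>2)"
    by (intro sum_mono m(5))
  then show "expectation (\<lambda>\<omega>. ((\<Sum>i\<in>I. (cmod (Z i \<omega>))\<^sup>2) - card I * v)\<^sup>2) \<le> card I * (3 * v\<^sup>2)"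
    using *(2) by simp
qed

end

text \<open>The mean of \<open>polygon_support b\<close> under CN(0, v): each of its
  \<open>2 ^ (b - 1)\<close> absolute values has mean \<open>sqrt (v / pi)\<close>.\<close>

definition polygon_mean :: "nat \<Rightarrow> real \<Rightarrow> real" where
  "polygon_mean b v = sin (pi / 2 ^ b) * 2 ^ (b - 1) * sqrt (v / pi)"

lemma sum_row: "(\<Sum>p\<in>{j} \<times> I. f p) = (\<Sum>l\<in>I. f (j, l))"
proof -
  have "{j} \<times> I = Pair j ` I" by auto
  then show ?thesis by (simp add: sum.reindex inj_on_def)
qed

lemma polygon_mean_pos: "b \<ge> 1 \<Longrightarrow> 0 < v \<Longrightarrow> 0 < polygon_mean b v"
  unfolding polygon_mean_def using polygon_angle[of b] by simp

context prob_space
begin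

lemma polygon_support_linear:
  assumes ind: "indep_vars (\<lambda>_. borel) Z I" and fin: "finite I"
    and Z: "\<And>i. i \<in> I \<Longrightarrow> complex_normal v (Z i)" and v: "0 < v"
  shows "integrable M (\<lambda>\<omega>. polygon_support b (\<Sum>i\<in>I. Z i \<omega> * a i))"
    and "expectation (\<lambda>\<omega>. polygon_support b (\<Sum>i\<in>I. Z i \<omega> * a i))
      = polygon_mean b v * L2_set (\<lambda>i. cmod (a i)) I"
proof -
  have eq: "cis t * (\<Sum>i\<in>I. Z i \<omega> * a i) = (\<Sum>i\<in>I. Z i \<omega> * (cis t * a i))" for t \<omega>
    by (simp add: sum_distrib_left mult_ac)
  have R1: "integrable M (\<lambda>\<omega>. \<bar>Re (cis t * (\<Sum>i\<in>I. Z i \<omega> * a i))\<bar>)" for t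
    unfolding eq by (rule complex_normal_linear_abs(1)[OF ind fin Z v])
  have R2: "expectation (\<lambda>\<omega>. \<bar>Re (cis t * (\<Sum>i\<in>I. Z i \<omega> * a i))\<bar>) = sqrt (v / pi) * L2_set (\<lambda>i. cmod (a i)) I" for t
    using complex_normal_linear_abs(2)[OF ind fin Z v, of "\<lambda>i. cis t * a i"]
    unfolding eq by (simp only: norm_mult norm_cis mult_1)
  show "integrable M (\<lambda>\<omega>. polygon_support b (\<Sum>i\<in>I. Z i \<omega> * a i))"
    unfolding polygon_support_def
    by (intro Bochner_Integration.integrable_mult_right Bochner_Integration.integrable_sum R1)
  show "expectation (\<lambda>\<omega>. polygon_support b (\<Sum>i\<in>I. Z i \<omega> * a i))
      = polygon_mean b v * L2_set (\<lambda>i. cmod (a i)) I"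
    unfolding polygon_support_def integral_mult_right_zero
    by (subst Bochner_Integration.integral_sum, rule R1) (unfold R2, simp add: polygon_mean_def)
qed

section \<open>Rows of a Gaussian matrix weighted by quantized phases\<close>

lemma rows_indep:
  assumes ind: "indep_vars (\<lambda>_. borel) Z ({..<N} \<times> {..<n::nat})"
    and F: "\<And>j. j < N \<Longrightarrow> F j \<in> Pi\<^sub>M ({j} \<times> {..<n}) (\<lambda>_. borel) \<rightarrow>\<^sub>M borel"
    and X: "\<And>j \<omega>. j < N \<Longrightarrow> X j \<omega> = F j (restrict (\<lambda>p. Z p \<omega>) ({j} \<times> {..<n}))"
  shows "indep_vars (\<lambda>_. borel) X {..<N::nat}"
proof -
  have "indep_vars (\<lambda>j. Pi\<^sub>M ({j} \<times> {..<n}) (\<lambda>_. borel))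
      (\<lambda>j \<omega>. restrict (\<lambda>p. Z p \<omega>) ({j} \<times> {..<n})) {..<N}"
    by (rule indep_vars_restrict[OF ind]) (auto simp: disjoint_family_on_def)
  then have "indep_vars (\<lambda>_. borel) (\<lambda>j \<omega>. F j (restrict (\<lambda>p. Z p \<omega>) ({j} \<times> {..<n}))) {..<N}"
    by (rule indep_vars_compose2) (use F in auto)
  then show ?thesis
    by (subst indep_vars_cong[OF refl]) (use X in auto)
qed

lemma measurable_row_component:
  "l < n \<Longrightarrow> (\<lambda>f. f (j, l)) \<in> Pi\<^sub>M ({j} \<times> {..<n}) (\<lambda>_. borel) \<rightarrow>\<^sub>M borel"
  by (rule measurable_component_singleton) auto

text \<open>For a fixed column \<open>a\<close> the rows give independent values of the support
  function with equal means. Their second moments are at most those of the inner products, because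
  the support function is at most the modulus; this bounds the variance of the sum.\<close>

lemma gaussian_rows_support:
  fixes a :: "nat \<Rightarrow> complex" and N n :: nat and v :: real
  assumes ind: "indep_vars (\<lambda>_. borel) Z ({..<N} \<times> {..<n})"
    and Z: "\<And>p. p \<in> {..<N} \<times> {..<n} \<Longrightarrow> complex_normal v (Z p)" and v: "0 < v" and b: "b \<ge> 1"
  shows "(\<integral>\<^sup>+\<omega>. ennreal (((\<Sum>j<N. polygon_support b (\<Sum>l<n. Z (j, l) \<omega> * a l))
      - N * (polygon_mean b v * L2_set (\<lambda>l. cmod (a l)) {..<n}))\<^sup>2) \<partial>M)
    \<le> ennreal (N * (v * (\<Sum>l<n. (cmod (a l))\<^sup>2)))"
proof -
  define X where "X j \<omega> = polygon_support b (\<Sum>l<n. Z (j, l) \<omega> * a l)" for j \<omega>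
  have row: "(\<Sum>l<n. Z (j, l) \<omega> * a l) = (\<Sum>p\<in>{j} \<times> {..<n}. Z p \<omega> * a (snd p))" for j \<omega>
    by (simp add: sum_row)
  have rind: "indep_vars (\<lambda>_. borel) Z ({j} \<times> {..<n})" if "j < N" for j
    by (rule indep_vars_subset[OF ind]) (use that in auto)
  have rZ: "p \<in> {j} \<times> {..<n} \<Longrightarrow> complex_normal v (Z p)" if "j < N" for j p
    using Z that by auto
  note lin = polygon_support_linear[OF rind _ rZ v, where b=b and a="\<lambda>p. a (snd p)"]
  note sq = complex_normal_linear_square[OF rind _ rZ v, where a="\<lambda>p. a (snd p)"]
  have L2: "L2_set (\<lambda>p. cmod (a (snd p))) ({j} \<times> {..<n}) = L2_set (\<lambda>l. cmod (a l)) {..<n}" for j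
    by (simp add: L2_set_def sum_row)
  have E: "integrable M (X j)" "expectation (X j) = polygon_mean b v * L2_set (\<lambda>l. cmod (a l)) {..<n}"
    if "j < N" for j
    using lin[OF that] that unfolding X_def row L2 by auto
  have le: "(X j \<omega>)\<^sup>2 \<le> (cmod (\<Sum>l<n. Z (j, l) \<omega> * a l))\<^sup>2" for j \<omega>
    unfolding X_def by (intro power_mono polygon_support_le_norm polygon_support_nonneg b)
  have S: "integrable M (\<lambda>\<omega>. (cmod (\<Sum>l<n. Z (j, l) \<omega> * a l))\<^sup>2)"
      "expectation (\<lambda>\<omega>. (cmod (\<Sum>l<n. Z (j, l) \<omega> * a l))\<^sup>2) = v * (\<Sum>l<n. (cmod (a l))\<^sup>2)" if "j < N" for j
    using sq[OF that] that unfolding row by (auto simp: sum_row)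
  have X2: "integrable M (\<lambda>\<omega>. (X j \<omega>)\<^sup>2)" if "j < N" for j
    by (rule Bochner_Integration.integrable_bound[OF S(1)[OF that]])
      (use le borel_measurable_integrable[OF E(1)[OF that]] in auto)
  have X2le: "expectation (\<lambda>\<omega>. (X j \<omega>)\<^sup>2) \<le> v * (\<Sum>l<n. (cmod (a l))\<^sup>2)" if "j < N" for j
    using integral_mono[OF X2[OF that] S(1)[OF that] le] S(2)[OF that] by simp
  have indX: "indep_vars (\<lambda>_. borel) X {..<N}"
  proof (rule rows_indep[OF ind])
    fix j assume "j < N"
    show "(\<lambda>f. polygon_support b (\<Sum>l<n. f (j, l) * a l)) \<in> Pi\<^sub>M ({j} \<times> {..<n}) (\<lambda>_. borel) \<rightarrow>\<^sub>M borel"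
      by (intro measurable_compose[OF _ borel_measurable_polygon_support] borel_measurable_sum
          borel_measurable_times measurable_row_component borel_measurable_const) auto
  qed (auto simp: X_def intro!: arg_cong[where f="polygon_support b"] sum.cong)
  have m: "(\<Sum>j<N. expectation (X j)) = N * (polygon_mean b v * L2_set (\<lambda>l. cmod (a l)) {..<n})"
    using E by simp
  note C = indep_vars_centered_square_sum[OF finite_lessThan indX X2, unfolded m, simplified]
  have "(\<Sum>j<N. expectation (\<lambda>\<omega>. (X j \<omega>)\<^sup>2)) \<le> (\<Sum>j<N. v * (\<Sum>l<n. (cmod (a l))\<^sup>2))"
    by (intro sum_mono X2le) auto
  then have "expectation (\<lambda>\<omega>. ((\<Sum>j<N. X j \<omega>) - N * (polygon_mean b v * L2_set (\<lambda>l. cmod (a l)) {..<n}))\<^sup>2)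
      \<le> N * (v * (\<Sum>l<n. (cmod (a l))\<^sup>2))"
    using C(2) by simp
  then show ?thesis
    using C(1) unfolding X_def by (subst nn_integral_eq_integral) (auto intro!: ennreal_leI)
qed

text \<open>The weights have modulus 1, so the fluctuations contribute at most
  \<open>N * n * v\<close>. The means form a vector \<open>m\<close> of squared norm
  \<open>Q\<close>. Pairing \<open>m\<close> with itself turns \<open>Q\<close> into a sum over the
  rows of expectations of Re (u z), where z is the row applied to the conjugate of \<open>m\<close>;
  bounding each by the support function gives \<open>Q \<le> N * polygon_mean b v * sqrt Q\<close>.
  Thus the direction of the mean never has to be determined.\<close>

lemma gaussian_rows_combined:
  fixes a :: "nat \<Rightarrow> complex" and N n :: nat and v :: real
  assumes ind: "indep_vars (\<lambda>_. borel) Z ({..<N} \<times> {..<n})"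
    and Z: "\<And>p. p \<in> {..<N} \<times> {..<n} \<Longrightarrow> complex_normal v (Z p)" and v: "0 < v" and b: "b \<ge> 1"
  shows "(\<integral>\<^sup>+\<omega>. ennreal (\<Sum>l<n. (cmod (\<Sum>j<N. phase_weight b (\<Sum>l<n. Z (j, l) \<omega> * a l) * Z (j, l) \<omega>))\<^sup>2) \<partial>M)
    \<le> ennreal (real N * real n * v + (real N * polygon_mean b v)\<^sup>2)"
proof -
  define u where "u j \<omega> = phase_weight b (\<Sum>l<n. Z (j, l) \<omega> * a l)" for j \<omega>
  define X where "X l j \<omega> = u j \<omega> * Z (j, l) \<omega>" for l j \<omega>
  define m where "m l = Complex (\<Sum>j<N. expectation (\<lambda>\<omega>. Re (X l j \<omega>))) (\<Sum>j<N. expectation (\<lambda>\<omega>. Im (X l j \<omega>)))" for l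
  define Q where "Q = (\<Sum>l<n. (cmod (m l))\<^sup>2)"
  note mom = complex_normal_moments[OF Z v]
  have Zm: "Z (j, l) \<in> borel_measurable M" if "j < N" "l < n" for j l using mom(1) that by auto
  have um: "u j \<in> borel_measurable M" if "j < N" for j
    unfolding u_def using that
    by (intro measurable_compose[OF _ borel_measurable_phase_weight] borel_measurable_sum borel_measurable_times Zm) auto
  have Xm: "X l j \<in> borel_measurable M" if "j < N" "l < n" for l j
    unfolding X_def using that by (intro borel_measurable_times um Zm)
  have nX: "cmod (X l j \<omega>) = cmod (Z (j, l) \<omega>)" for l j \<omega>
    by (simp add: X_def u_def norm_mult phase_weight_unit)
  have X2: "integrable M (\<lambda>\<omega>. (cmod (X l j \<omega>))\<^sup>2)" "expectation (\<lambda>\<omega>. (cmod (X l j \<omega>))\<^sup>2) = v"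
    if "j < N" "l < n" for l j
    unfolding nX using mom(2,3) that by auto
  have RI: "integrable M (\<lambda>\<omega>. (Re (X l j \<omega>))\<^sup>2)" "integrable M (\<lambda>\<omega>. (Im (X l j \<omega>))\<^sup>2)"
    if "j < N" "l < n" for l j
    by (rule Bochner_Integration.integrable_bound[OF X2(1)[OF that]];
        use Xm[OF that] in \<open>auto simp: cmod_power2\<close>)+
  have RI1: "integrable M (\<lambda>\<omega>. Re (X l j \<omega>))" "integrable M (\<lambda>\<omega>. Im (X l j \<omega>))"
    if "j < N" "l < n" for l j
    using square_integrable_imp_integrable[OF _ RI(1)[OF that]] square_integrable_imp_integrable[OF _ RI(2)[OF that]] Xm[OF that]
    by simp_all
  have row: "(\<lambda>f. phase_weight b (\<Sum>l<n. f (j, l) * a l) * f (j, l)) \<in> Pi\<^sub>M ({j} \<times> {..<n}) (\<lambda>_. borel) \<rightarrow>\<^sub>M borel"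
    if "l < n" for j l
    using that by (intro borel_measurable_times measurable_compose[OF _ borel_measurable_phase_weight] borel_measurable_sum
          measurable_row_component borel_measurable_const) auto
  have rowX: "X l j \<omega> = phase_weight b (\<Sum>l'<n. restrict (\<lambda>p. Z p \<omega>) ({j} \<times> {..<n}) (j, l') * a l')
      * restrict (\<lambda>p. Z p \<omega>) ({j} \<times> {..<n}) (j, l)" if "l < n" for l j \<omega>
    using that by (auto simp: X_def u_def intro!: arg_cong[where f="phase_weight b"] sum.cong)
  have indR: "indep_vars (\<lambda>_. borel) (\<lambda>j \<omega>. Re (X l j \<omega>)) {..<N}" if "l < n" for l
    by (rule rows_indep[OF ind, where F="\<lambda>j f. Re (phase_weight b (\<Sum>l<n. f (j, l) * a l) * f (j, l))"],
        rule measurable_compose[OF row[OF that]]) (simp_all only: rowX[OF that] borel_measurable_Re)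
  have indI: "indep_vars (\<lambda>_. borel) (\<lambda>j \<omega>. Im (X l j \<omega>)) {..<N}" if "l < n" for l
    by (rule rows_indep[OF ind, where F="\<lambda>j f. Im (phase_weight b (\<Sum>l<n. f (j, l) * a l) * f (j, l))"],
        rule measurable_compose[OF row[OF that]]) (simp_all only: rowX[OF that] borel_measurable_Im)
  \<comment> \<open>The phases couple the entries within a row, but different rows stay independent;
    so each column of the weighted matrix is a sum of independent terms.\<close>
  have col: "integrable M (\<lambda>\<omega>. (cmod (\<Sum>j<N. X l j \<omega>))\<^sup>2) \<and>
      expectation (\<lambda>\<omega>. (cmod (\<Sum>j<N. X l j \<omega>))\<^sup>2) \<le> N * v + (cmod (m l))\<^sup>2" if l: "l < n" for l
  proof -
    note R = indep_vars_square_sum[OF finite_lessThan indR[OF l] RI(1)[OF _ l], simplified]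
    note I = indep_vars_square_sum[OF finite_lessThan indI[OF l] RI(2)[OF _ l], simplified]
    have e: "(cmod (\<Sum>j<N. X l j \<omega>))\<^sup>2 = (\<Sum>j<N. Re (X l j \<omega>))\<^sup>2 + (\<Sum>j<N. Im (X l j \<omega>))\<^sup>2" for \<omega>
      by (simp add: cmod_power2)
    have "(\<Sum>j<N. expectation (\<lambda>\<omega>. (Re (X l j \<omega>))\<^sup>2)) + (\<Sum>j<N. expectation (\<lambda>\<omega>. (Im (X l j \<omega>))\<^sup>2))
        = (\<Sum>j<N. expectation (\<lambda>\<omega>. (cmod (X l j \<omega>))\<^sup>2))"
      unfolding sum.distrib[symmetric] cmod_power2
      by (intro sum.cong refl Bochner_Integration.integral_add[symmetric] RI l) auto
    also have "\<dots> = N * v" using X2(2) l by simp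
    finally show ?thesis unfolding e using R I by (simp add: m_def cmod_power2)
  qed
  have "Q = (\<Sum>l<n. \<Sum>j<N. expectation (\<lambda>\<omega>. Re (u j \<omega> * (Z (j, l) \<omega> * cnj (m l)))))"
  proof -
    have "(cmod (m l))\<^sup>2 = (\<Sum>j<N. expectation (\<lambda>\<omega>. Re (u j \<omega> * (Z (j, l) \<omega> * cnj (m l)))))" if l: "l < n" for l
    proof -
      have "(cmod (m l))\<^sup>2 = Re (m l) * (\<Sum>j<N. expectation (\<lambda>\<omega>. Re (X l j \<omega>)))
          + Im (m l) * (\<Sum>j<N. expectation (\<lambda>\<omega>. Im (X l j \<omega>)))"
        unfolding cmod_power2 by (simp add: m_def power2_eq_square)
      also have "\<dots> = (\<Sum>j<N. expectation (\<lambda>\<omega>. Re (m l) * Re (X l j \<omega>) + Im (m l) * Im (X l j \<omega>)))"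
        using RI1[OF _ l] by (simp add: sum_distrib_left sum.distrib)
      also have "\<dots> = (\<Sum>j<N. expectation (\<lambda>\<omega>. Re (u j \<omega> * (Z (j, l) \<omega> * cnj (m l)))))"
        by (intro sum.cong refl Bochner_Integration.integral_cong) (auto simp: X_def algebra_simps)
      finally show ?thesis .
    qed
    then show ?thesis by (simp add: Q_def)
  qed
  also have "\<dots> = (\<Sum>j<N. \<Sum>l<n. expectation (\<lambda>\<omega>. Re (u j \<omega> * (Z (j, l) \<omega> * cnj (m l)))))"
    by (rule sum.swap)
  also have "\<dots> \<le> (\<Sum>j<N. polygon_mean b v * sqrt Q)"
  proof (rule sum_mono)
    fix j assume "j \<in> {..<N}"
    then have j: "j < N" by simp
    have rind: "indep_vars (\<lambda>_. borel) Z ({j} \<times> {..<n})"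
      by (rule indep_vars_subset[OF ind]) (use j in auto)
    have rZ: "p \<in> {j} \<times> {..<n} \<Longrightarrow> complex_normal v (Z p)" for p
      using Z j by auto
    have fin: "finite ({j} \<times> {..<n})" by simp
    note lin = polygon_support_linear[OF rind fin rZ v, where b=b and a="\<lambda>p. cnj (m (snd p))", unfolded sum_row snd_conv]
    have int: "integrable M (\<lambda>\<omega>. Re (u j \<omega> * (Z (j, l) \<omega> * cnj (m l))))" if l: "l < n" for l
    proof -
      have "Re (u j \<omega> * (Z (j, l) \<omega> * cnj (m l))) = Re (m l) * Re (X l j \<omega>) + Im (m l) * Im (X l j \<omega>)" for \<omega>
        by (simp add: X_def algebra_simps)
      then show ?thesis using RI1[OF j l] by simp
    qed
    have "(\<Sum>l<n. expectation (\<lambda>\<omega>. Re (u j \<omega> * (Z (j, l) \<omega> * cnj (m l)))))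
        = expectation (\<lambda>\<omega>. \<Sum>l<n. Re (u j \<omega> * (Z (j, l) \<omega> * cnj (m l))))"
      by (rule Bochner_Integration.integral_sum[symmetric]) (use int in auto)
    also have "\<dots> \<le> expectation (\<lambda>\<omega>. polygon_support b (\<Sum>l<n. Z (j, l) \<omega> * cnj (m l)))"
    proof (rule integral_mono)
      show "integrable M (\<lambda>\<omega>. \<Sum>l<n. Re (u j \<omega> * (Z (j, l) \<omega> * cnj (m l))))"
        by (intro Bochner_Integration.integrable_sum int) auto
      show "integrable M (\<lambda>\<omega>. polygon_support b (\<Sum>l<n. Z (j, l) \<omega> * cnj (m l)))"
        using lin(1) .
      fix \<omega>
      have "(\<Sum>l<n. Re (u j \<omega> * (Z (j, l) \<omega> * cnj (m l)))) = Re (u j \<omega> * (\<Sum>l<n. Z (j, l) \<omega> * cnj (m l)))"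
        by (simp only: Re_sum[symmetric] sum_distrib_left)
      also have "\<dots> \<le> polygon_support b (\<Sum>l<n. Z (j, l) \<omega> * cnj (m l))"
        unfolding u_def by (rule Re_phase_weight_le[OF b])
      finally show "(\<Sum>l<n. Re (u j \<omega> * (Z (j, l) \<omega> * cnj (m l)))) \<le> polygon_support b (\<Sum>l<n. Z (j, l) \<omega> * cnj (m l))" .
    qed
    also have "\<dots> = polygon_mean b v * sqrt Q"
      using lin(2) by (simp only: L2_set_def sum_row Q_def snd_conv complex_mod_cnj)
    finally show "(\<Sum>l<n. expectation (\<lambda>\<omega>. Re (u j \<omega> * (Z (j, l) \<omega> * cnj (m l))))) \<le> polygon_mean b v * sqrt Q" .
  qed
  finally have Q1: "Q \<le> N * polygon_mean b v * sqrt Q" by simp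
  have Q0: "0 \<le> Q" by (simp add: Q_def sum_nonneg)
  have Q: "Q \<le> (N * polygon_mean b v)\<^sup>2"
  proof (cases "Q = 0")
    case False
    then have pos: "0 < sqrt Q" using Q0 by simp
    have "sqrt Q * sqrt Q \<le> N * polygon_mean b v * sqrt Q" using Q1 Q0 by simp
    then have "sqrt Q \<le> N * polygon_mean b v" by (rule mult_right_le_imp_le[OF _ pos])
    then show ?thesis using power_mono[of "sqrt Q" "N * polygon_mean b v" 2] Q0 by simp
  qed simp
  have "expectation (\<lambda>\<omega>. \<Sum>l<n. (cmod (\<Sum>j<N. X l j \<omega>))\<^sup>2) = (\<Sum>l<n. expectation (\<lambda>\<omega>. (cmod (\<Sum>j<N. X l j \<omega>))\<^sup>2))"
    by (rule Bochner_Integration.integral_sum) (use col in auto)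
  also have "\<dots> \<le> (\<Sum>l<n. N * v + (cmod (m l))\<^sup>2)" by (intro sum_mono) (use col in auto)
  also have "\<dots> \<le> N * real n * v + (N * polygon_mean b v)\<^sup>2"
    using Q by (simp add: sum.distrib Q_def mult_ac)
  finally have "expectation (\<lambda>\<omega>. \<Sum>l<n. (cmod (\<Sum>j<N. X l j \<omega>))\<^sup>2) \<le> N * real n * v + (N * polygon_mean b v)\<^sup>2" .
  then show ?thesis
    unfolding u_def[symmetric] X_def[symmetric]
    by (subst nn_integral_eq_integral)
      (use col in \<open>auto intro!: ennreal_leI Bochner_Integration.integrable_sum sum_nonneg\<close>)
qed

end

subsection \<open>Zero forcing with a diagonally dominant channel\<close>

lemma mat_adjoint_carrier [simp]: "A \<in> carrier_mat n m \<Longrightarrow> mat_adjoint A \<in> carrier_mat m n"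
  by (auto simp: mat_adjoint_def)

lemma mat_adjoint_index [simp]:
  "i < dim_col A \<Longrightarrow> j < dim_row A \<Longrightarrow> mat_adjoint A $$ (i, j) = cnj (A $$ (j, i))"
  for A :: "complex mat"
  by (simp add: mat_adjoint_def mat_of_rows_def)

lemma mult_mat_index_sum:
  "A \<in> carrier_mat n m \<Longrightarrow> B \<in> carrier_mat m p \<Longrightarrow> i < n \<Longrightarrow> j < p \<Longrightarrow>
    (A * B) $$ (i, j) = (\<Sum>l<m. A $$ (i, l) * B $$ (l, j))"
  by (auto simp: scalar_prod_def atLeast0LessThan intro!: sum.cong)

lemma mat_adjoint_mult:
  fixes A B :: "complex mat"
  assumes A: "A \<in> carrier_mat n m" and B: "B \<in> carrier_mat m p"
  shows "mat_adjoint (A * B) = mat_adjoint B * mat_adjoint A"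
proof (rule eq_matI)
  have AB: "A * B \<in> carrier_mat n p" using A B by simp
  have BA: "mat_adjoint B * mat_adjoint A \<in> carrier_mat p n" using A B by (intro mult_carrier_mat mat_adjoint_carrier)
  show "dim_row (mat_adjoint (A * B)) = dim_row (mat_adjoint B * mat_adjoint A)"
    "dim_col (mat_adjoint (A * B)) = dim_col (mat_adjoint B * mat_adjoint A)"
    using mat_adjoint_carrier[OF AB] BA by auto
  fix i j assume "i < dim_row (mat_adjoint B * mat_adjoint A)" "j < dim_col (mat_adjoint B * mat_adjoint A)"
  then have ij: "i < p" "j < n" using BA by auto
  have "mat_adjoint (A * B) $$ (i, j) = cnj ((A * B) $$ (j, i))"
    by (rule mat_adjoint_index) (use A B ij in auto)
  also have "\<dots> = (\<Sum>l<m. mat_adjoint B $$ (i, l) * mat_adjoint A $$ (l, j))"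
    unfolding mult_mat_index_sum[OF A B ij(2,1)] using A B ij by (auto simp: mult.commute intro!: sum.cong)
  also have "\<dots> = (mat_adjoint B * mat_adjoint A) $$ (i, j)"
    using A B ij by (intro mult_mat_index_sum[symmetric]) auto
  finally show "mat_adjoint (A * B) $$ (i, j) = (mat_adjoint B * mat_adjoint A) $$ (i, j)" .
qed

lemma mult_adjoint_diag:
  fixes A :: "complex mat"
  assumes A: "A \<in> carrier_mat n m" and k: "k < n"
  shows "Re ((A * mat_adjoint A) $$ (k, k)) = (\<Sum>j<m. (cmod (A $$ (k, j)))\<^sup>2)"
proof -
  have "(A * mat_adjoint A) $$ (k, k) = (\<Sum>l<m. A $$ (k, l) * mat_adjoint A $$ (l, k))"
    using A k by (intro mult_mat_index_sum) auto
  also have "\<dots> = complex_of_real (\<Sum>j<m. (cmod (A $$ (k, j)))\<^sup>2)"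
    unfolding of_real_sum complex_norm_square using A k by (intro sum.cong) auto
  finally show ?thesis by simp
qed

text \<open>Each weight is split into two square roots, one per factor. If the weights nearly
  concentrate on one index, so does the right-hand side, whereas the plain inequality would charge
  all \<open>K\<close> terms in full and lose the sharp constant.\<close>

lemma cauchy_schwarz_weighted:
  fixes v z :: "nat \<Rightarrow> complex"
  assumes "\<And>i. i < K \<Longrightarrow> cmod (v i) \<le> c i"
  shows "(cmod (\<Sum>i<K. v i * z i))\<^sup>2 \<le> (\<Sum>i<K. c i) * (\<Sum>i<K. c i * (cmod (z i))\<^sup>2)"
proof -
  have c: "i < K \<Longrightarrow> 0 \<le> c i" for i using assms[of i] norm_ge_zero[of "v i"] by linarith
  have "cmod (\<Sum>i<K. v i * z i) \<le> (\<Sum>i<K. cmod (v i) * cmod (z i))"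
    by (rule order_trans[OF norm_sum]) (simp add: norm_mult)
  also have "\<dots> \<le> (\<Sum>i<K. c i * cmod (z i))"
    by (intro sum_mono mult_right_mono) (use assms in auto)
  also have "\<dots> = (\<Sum>i<K. sqrt (c i) * (sqrt (c i) * cmod (z i)))"
    using c by (intro sum.cong) (auto simp: mult.assoc[symmetric])
  finally have "(cmod (\<Sum>i<K. v i * z i))\<^sup>2 \<le> (\<Sum>i<K. sqrt (c i) * (sqrt (c i) * cmod (z i)))\<^sup>2"
    by (intro power_mono) auto
  also have "\<dots> \<le> (\<Sum>i<K. (sqrt (c i))\<^sup>2) * (\<Sum>i<K. (sqrt (c i) * cmod (z i))\<^sup>2)"
    by (rule Cauchy_Schwarz_ineq_sum)
  also have "\<dots> = (\<Sum>i<K. c i) * (\<Sum>i<K. c i * (cmod (z i))\<^sup>2)"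
    using c by (simp add: power_mult_distrib)
  finally show ?thesis .
qed

lemma cauchy_schwarz_complex:
  fixes x y :: "nat \<Rightarrow> complex"
  shows "(cmod (\<Sum>i<n. x i * y i))\<^sup>2 \<le> (\<Sum>i<n. (cmod (x i))\<^sup>2) * (\<Sum>i<n. (cmod (y i))\<^sup>2)"
proof -
  have "cmod (\<Sum>i<n. x i * y i) \<le> (\<Sum>i<n. cmod (x i) * cmod (y i))"
    by (rule order_trans[OF norm_sum]) (simp add: norm_mult)
  then have "(cmod (\<Sum>i<n. x i * y i))\<^sup>2 \<le> (\<Sum>i<n. cmod (x i) * cmod (y i))\<^sup>2"
    by (intro power_mono) auto
  also have "\<dots> \<le> (\<Sum>i<n. (cmod (x i))\<^sup>2) * (\<Sum>i<n. (cmod (y i))\<^sup>2)"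
    by (rule Cauchy_Schwarz_ineq_sum)
  finally show ?thesis .
qed

text \<open>Common core of nonsingularity and of the bound on the inverse. Summing the inequalities,
  \<open>K * e \<le> 1 / 2\<close> absorbs half of the weighted sum \<open>P\<close>; then
  \<open>P \<le> 2 * D\<close> is inserted back into a single inequality. A kernel vector has
  \<open>D = 0\<close>, a row of the inverse \<open>D = 1\<close>.\<close>

lemma dominant_sum_bound:
  fixes x :: "nat \<Rightarrow> real" and b :: "nat \<Rightarrow> real"
  assumes x: "\<And>i. i < K \<Longrightarrow> 0 \<le> x i" and e: "0 \<le> e" "real K * e \<le> 1 / 2"
    and b: "0 < b0" "\<And>i. i < K \<Longrightarrow> b0 \<le> b i"
    and le: "\<And>i. i < K \<Longrightarrow> x i * b i \<le> d i + e * b0 * (\<Sum>j<K. x j)"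
    and d: "(\<Sum>i<K. d i) \<le> D" and i: "i < K"
  shows "x i * b i \<le> d i + 2 * e * D"
proof -
  define P where "P = (\<Sum>j<K. x j * b j)"
  have "b0 * (\<Sum>j<K. x j) \<le> P"
    unfolding P_def sum_distrib_left using mult_right_mono[OF b(2) x]
    by (intro sum_mono) (auto simp: mult.commute)
  then have le2: "x i * b i \<le> d i + e * P" if "i < K" for i
    using le[OF that] mult_left_mono[of _ P e] e(1) by (fastforce simp: mult.assoc)
  have "P \<le> (\<Sum>i<K. d i + e * P)" unfolding P_def[symmetric] by (subst (1) P_def, rule sum_mono) (use le2 in auto)
  also have "\<dots> = (\<Sum>i<K. d i) + real K * e * P" by (simp add: sum.distrib)
  finally have "P \<le> D + real K * e * P" using d by linarith
  moreover have "0 \<le> P" unfolding P_def using x b by (intro sum_nonneg) (auto intro!: mult_nonneg_nonneg intro: order_trans[OF less_imp_le])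
  then have "real K * e * P \<le> 1 / 2 * P" using e by (intro mult_right_mono) auto
  ultimately have "P \<le> 2 * D" by linarith
  then have "e * P \<le> 2 * e * D" using mult_left_mono[of P "2 * D" e] e by simp
  then show ?thesis using le2[OF i] by linarith
qed

lemma diagonally_dominant_det:
  fixes B :: "complex mat" and b :: "nat \<Rightarrow> real"
  assumes B: "B \<in> carrier_mat K K" and e: "0 \<le> e" "real K * e \<le> 1 / 2"
    and b: "0 < b0" "\<And>i. i < K \<Longrightarrow> b0 \<le> b i"
    and diag: "\<And>i. i < K \<Longrightarrow> b i \<le> cmod (B $$ (i, i))"
    and off: "\<And>i j. i < K \<Longrightarrow> j < K \<Longrightarrow> i \<noteq> j \<Longrightarrow> cmod (B $$ (i, j)) \<le> e * b0"
  shows "det B \<noteq> 0"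
proof
  assume "det B = 0"
  then obtain v where v: "v \<in> carrier_vec K" "v \<noteq> 0\<^sub>v K" "B *\<^sub>v v = 0\<^sub>v K"
    using det_0_iff_vec_prod_zero_field[OF B] by auto
  have "v $ i = 0" if i: "i < K" for i
  proof -
    have "cmod (v $ i) * b i \<le> 0 + 2 * e * 0"
    proof (rule dominant_sum_bound[OF _ e b _ _ i, where x="\<lambda>i. cmod (v $ i)" and d="\<lambda>_. 0"])
      fix i assume i: "i < K"
      have "(B *\<^sub>v v) $ i = (\<Sum>j<K. B $$ (i, j) * v $ j)"
      proof -
        have "(B *\<^sub>v v) $ i = row B i \<bullet> v" using B i by simp
        also have "\<dots> = (\<Sum>j\<in>{0..<K}. row B i $ j * v $ j)" using v(1) by (simp add: scalar_prod_def)
        also have "\<dots> = (\<Sum>j<K. B $$ (i, j) * v $ j)"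
          unfolding atLeast0LessThan using B i by (intro sum.cong) auto
        finally show ?thesis .
      qed
      moreover have "(B *\<^sub>v v) $ i = 0" unfolding v(3) using i by simp
      ultimately have "0 = (\<Sum>j<K. B $$ (i, j) * v $ j)" by simp
      also have "\<dots> = B $$ (i, i) * v $ i + (\<Sum>j\<in>{..<K} - {i}. B $$ (i, j) * v $ j)"
        using i by (subst sum.remove[of _ i]) auto
      finally have "B $$ (i, i) * v $ i = - (\<Sum>j\<in>{..<K} - {i}. B $$ (i, j) * v $ j)"
        by (simp add: eq_neg_iff_add_eq_0)
      then have "cmod (B $$ (i, i)) * cmod (v $ i) = cmod (\<Sum>j\<in>{..<K} - {i}. B $$ (i, j) * v $ j)"
        by (metis norm_minus_cancel norm_mult)
      also have "\<dots> \<le> (\<Sum>j\<in>{..<K} - {i}. e * b0 * cmod (v $ j))"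
        by (rule order_trans[OF norm_sum]) (use off i in \<open>auto simp: norm_mult intro!: sum_mono mult_right_mono\<close>)
      also have "\<dots> \<le> (\<Sum>j<K. e * b0 * cmod (v $ j))"
        using e b by (intro sum_mono2) auto
      finally have "cmod (B $$ (i, i)) * cmod (v $ i) \<le> e * b0 * (\<Sum>j<K. cmod (v $ j))"
        by (simp add: sum_distrib_left)
      then show "cmod (v $ i) * b i \<le> 0 + e * b0 * (\<Sum>j<K. cmod (v $ j))"
        using mult_right_mono[OF diag[OF i], of "cmod (v $ i)"] by (simp add: mult.commute)
    qed auto
    moreover have "0 < b i" using b(1) b(2)[OF i] by linarith
    ultimately show ?thesis by (simp add: mult_le_0_iff)
  qed
  then have "v = 0\<^sub>v K" by (intro eq_vecI) (use v(1) in auto)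
  then show False using v(2) by contradiction
qed

text \<open>Column \<open>i\<close> of \<open>W * B = 1\<^sub>m K\<close> expresses
  \<open>W $$ (k, i) * B $$ (i, i)\<close> by a Kronecker delta minus off-diagonal terms. Dividing
  by the individual \<open>b i\<close> keeps the leading constant of entry \<open>k\<close>
  sharp.\<close>

lemma diagonally_dominant_inverse_row:
  fixes B W :: "complex mat" and b :: "nat \<Rightarrow> real"
  assumes B: "B \<in> carrier_mat K K" and W: "W \<in> carrier_mat K K" and WB: "W * B = 1\<^sub>m K"
    and e: "0 \<le> e" "real K * e \<le> 1 / 2"
    and b: "0 < b0" "\<And>i. i < K \<Longrightarrow> b0 \<le> b i"
    and diag: "\<And>i. i < K \<Longrightarrow> b i \<le> cmod (B $$ (i, i))"
    and off: "\<And>i j. i < K \<Longrightarrow> j < K \<Longrightarrow> i \<noteq> j \<Longrightarrow> cmod (B $$ (i, j)) \<le> e * b0"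
    and k: "k < K" and i: "i < K"
  shows "cmod (W $$ (k, i)) \<le> ((if i = k then 1 else 0) + 2 * e) / b i"
proof -
  have "cmod (W $$ (k, i)) * b i \<le> (if i = k then 1 else 0) + 2 * e * 1"
  proof (rule dominant_sum_bound[OF _ e b _ _ i, where x="\<lambda>i. cmod (W $$ (k, i))" and d="\<lambda>i. if i = k then 1 else 0"])
    fix i assume i: "i < K"
    have "(W * B) $$ (k, i) = (\<Sum>j<K. W $$ (k, j) * B $$ (j, i))"
      by (rule mult_mat_index_sum[OF W B k i])
    also have "\<dots> = W $$ (k, i) * B $$ (i, i) + (\<Sum>j\<in>{..<K} - {i}. W $$ (k, j) * B $$ (j, i))"
      using i by (subst sum.remove[of _ i]) auto
    finally have "W $$ (k, i) * B $$ (i, i)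
        = (if i = k then 1 else 0) - (\<Sum>j\<in>{..<K} - {i}. W $$ (k, j) * B $$ (j, i))"
      using WB i k by (auto simp: algebra_simps)
    then have "cmod (W $$ (k, i)) * cmod (B $$ (i, i))
        = cmod ((if i = k then 1 else 0) - (\<Sum>j\<in>{..<K} - {i}. W $$ (k, j) * B $$ (j, i)))"
      by (metis norm_mult)
    also have "\<dots> \<le> (if i = k then 1 else 0) + cmod (\<Sum>j\<in>{..<K} - {i}. W $$ (k, j) * B $$ (j, i))"
      by (rule order_trans[OF norm_triangle_ineq4]) auto
    also have "cmod (\<Sum>j\<in>{..<K} - {i}. W $$ (k, j) * B $$ (j, i)) \<le> (\<Sum>j\<in>{..<K} - {i}. cmod (W $$ (k, j)) * (e * b0))"
      by (rule order_trans[OF norm_sum]) (use off i in \<open>auto simp: norm_mult intro!: sum_mono mult_left_mono\<close>)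
    also have "\<dots> \<le> (\<Sum>j<K. cmod (W $$ (k, j)) * (e * b0))"
      using e b by (intro sum_mono2) auto
    finally have "cmod (W $$ (k, i)) * cmod (B $$ (i, i)) \<le> (if i = k then 1 else 0) + e * b0 * (\<Sum>j<K. cmod (W $$ (k, j)))"
      by (simp add: sum_distrib_left mult_ac)
    then show "cmod (W $$ (k, i)) * b i \<le> (if i = k then 1 else 0) + e * b0 * (\<Sum>j<K. cmod (W $$ (k, j)))"
      using mult_left_mono[OF diag[OF i], of "cmod (W $$ (k, i))"] by simp
  qed (use k in auto)
  moreover have "0 < b i" using b(1) b(2)[OF i] by linarith
  ultimately show ?thesis by (simp add: pos_le_divide_eq)
qed

lemma Re_complex_mult_of_real: "Re (complex_of_real c * z) = c * Re z"
  by simp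

section \<open>A single channel realization\<close>

locale relay_mats =
  fixes b :: nat and G H :: "complex mat" and N n K :: nat
  assumes b: "b \<ge> 1" and G: "G \<in> carrier_mat N n" and H: "H \<in> carrier_mat n K" and N: "N > 0"
begin

definition "Wa = analog_detector b G H"
definition "B = Wa * G * H"

lemma GH: "G * H \<in> carrier_mat N K" using G H by simp

lemma GH_index: "j < N \<Longrightarrow> i < K \<Longrightarrow> (G * H) $$ (j, i) = (\<Sum>l<n. G $$ (j, l) * H $$ (l, i))"
  using mult_mat_index_sum[OF G H] .

lemma Wa_carrier: "Wa \<in> carrier_mat K N"
  using G H by (auto simp: Wa_def analog_detector_def)

lemma Wa_index:
  assumes "i < K" "j < N"
  shows "Wa $$ (i, j) = complex_of_real (1 / sqrt N) * phase_weight b (\<Sum>l<n. G $$ (j, l) * H $$ (l, i))"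
  unfolding GH_index[OF assms(2,1), symmetric] using assms G H GH
  by (auto simp: Wa_def analog_detector_def phase_weight_def)

lemma Wa_norm: "i < K \<Longrightarrow> (\<Sum>j<N. (cmod (Wa $$ (i, j)))\<^sup>2) = 1"
  using N by (simp add: Wa_index norm_mult phase_weight_unit power_divide norm_divide)

lemma WaG_carrier: "Wa * G \<in> carrier_mat K n" using Wa_carrier G by simp

lemma WaG_index:
  assumes "i < K" "l < n"
  shows "(Wa * G) $$ (i, l) = complex_of_real (1 / sqrt N) *
    (\<Sum>j<N. phase_weight b (\<Sum>l<n. G $$ (j, l) * H $$ (l, i)) * G $$ (j, l))"
  unfolding mult_mat_index_sum[OF Wa_carrier G assms] sum_distrib_left
  using assms by (intro sum.cong) (auto simp: Wa_index)

lemma B_carrier: "B \<in> carrier_mat K K" using WaG_carrier H by (simp add: B_def)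

lemma B_index:
  "i < K \<Longrightarrow> j < K \<Longrightarrow> B $$ (i, j) = (\<Sum>l<n. (Wa * G) $$ (i, l) * H $$ (l, j))"
  unfolding B_def by (rule mult_mat_index_sum[OF WaG_carrier H])

text \<open>Row \<open>i\<close> of the phases is matched to column \<open>i\<close> of
  \<open>G * H\<close>, so every antenna contributes the equality case of the support
  function.\<close>

lemma B_diag:
  assumes i: "i < K"
  shows "Re (B $$ (i, i)) = (\<Sum>j<N. polygon_support b (\<Sum>l<n. G $$ (j, l) * H $$ (l, i))) / sqrt N"
proof -
  have "B = Wa * (G * H)" unfolding B_def by (rule assoc_mult_mat[OF Wa_carrier G H])
  then have "B $$ (i, i) = (\<Sum>j<N. Wa $$ (i, j) * (G * H) $$ (j, i))"
    using mult_mat_index_sum[OF Wa_carrier GH i i] by simp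
  also have "\<dots> = (\<Sum>j<N. complex_of_real (1 / sqrt N) *
      (phase_weight b (\<Sum>l<n. G $$ (j, l) * H $$ (l, i)) * (\<Sum>l<n. G $$ (j, l) * H $$ (l, i))))"
    using i by (intro sum.cong) (auto simp: Wa_index GH_index)
  also have "\<dots> = complex_of_real (1 / sqrt N) *
      (\<Sum>j<N. phase_weight b (\<Sum>l<n. G $$ (j, l) * H $$ (l, i)) * (\<Sum>l<n. G $$ (j, l) * H $$ (l, i)))"
    by (rule sum_distrib_left[symmetric])
  also have "Re \<dots> = 1 / sqrt N * (\<Sum>j<N. polygon_support b (\<Sum>l<n. G $$ (j, l) * H $$ (l, i)))"
    unfolding Re_complex_mult_of_real Re_sum Re_phase_weight_self[OF b] ..
  finally show ?thesis by simp
qed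

definition "row_norm2 i = (\<Sum>l<n. (cmod ((Wa * G) $$ (i, l)))\<^sup>2)"
definition noise_gain :: "real \<Rightarrow> real \<Rightarrow> real \<Rightarrow> real" where
  "noise_gain \<sigma>r Pu Pr = (Pu * (\<Sum>i<K. \<Sum>l<n. (cmod (H $$ (l, i)))\<^sup>2) + \<sigma>r\<^sup>2 * n) / Pr"

lemma amplification_square:
  assumes "0 \<le> Pu" "0 < Pr"
  shows "1 / (amplification Pu Pr \<sigma>r H)\<^sup>2 = noise_gain \<sigma>r Pu Pr"
proof -
  have "mat_adjoint H * H \<in> carrier_mat K K" using H by (meson mat_adjoint_carrier mult_carrier_mat)
  then have "mat_trace (mat_adjoint H * H) = (\<Sum>i<K. (mat_adjoint H * H) $$ (i, i))"
    by (auto simp: mat_trace_def)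
  also have "\<dots> = (\<Sum>i<K. \<Sum>l<n. complex_of_real ((cmod (H $$ (l, i)))\<^sup>2))"
  proof (rule sum.cong[OF refl])
    fix i assume "i \<in> {..<K}"
    then have i: "i < K" by simp
    show "(mat_adjoint H * H) $$ (i, i) = (\<Sum>l<n. complex_of_real ((cmod (H $$ (l, i)))\<^sup>2))"
      unfolding mult_mat_index_sum[OF mat_adjoint_carrier[OF H] H i i] complex_norm_square
      using H i by (intro sum.cong) (auto simp: mult.commute)
  qed
  also have "\<dots> = complex_of_real (\<Sum>i<K. \<Sum>l<n. (cmod (H $$ (l, i)))\<^sup>2)" by simp
  finally have "Re (mat_trace (mat_adjoint H * H)) = (\<Sum>i<K. \<Sum>l<n. (cmod (H $$ (l, i)))\<^sup>2)"
    by (simp only: Re_complex_of_real)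
  moreover have "dim_row H = n" using H by simp
  moreover have "0 \<le> Pu * (\<Sum>i<K. \<Sum>l<n. (cmod (H $$ (l, i)))\<^sup>2) + \<sigma>r\<^sup>2 * n"
    using assms by (intro add_nonneg_nonneg mult_nonneg_nonneg sum_nonneg) auto
  ultimately show ?thesis using assms by (simp add: amplification_def noise_gain_def)
qed

lemma sinr_singular:
  assumes "det B = 0"
  shows "sinr b Pu Pr \<sigma>r \<sigma>d G H k = 0 \<or> k \<ge> K"
proof (cases "k < K")
  case True
  have "mat_inverse B = None"
  proof (cases "mat_inverse B")
    case (Some W)
    then have "W * B = 1\<^sub>m K" "W \<in> carrier_mat K K" using mat_inverse(2)[OF B_carrier] by auto
    then have "det W * det B = 1" using det_mult[of W K B] B_carrier by simp
    then show ?thesis using assms by simp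
  qed simp
  then have Wd: "digital_detector b G H = 0\<^sub>m K K"
    using H by (simp add: digital_detector_def B_def[symmetric] Wa_def[symmetric])
  have z: "(0\<^sub>m K K * A) = 0\<^sub>m K m" if "A \<in> carrier_mat K m" for A :: "complex mat" and m
    using left_mult_zero_mat[OF that] by simp
  have aWa: "mat_adjoint Wa \<in> carrier_mat N K" and aG: "mat_adjoint G \<in> carrier_mat n N"
    and aW: "mat_adjoint (0\<^sub>m K K) \<in> carrier_mat K K"
    using Wa_carrier G by simp_all
  have "0\<^sub>m K K * Wa = 0\<^sub>m K N" "0\<^sub>m K N * G = 0\<^sub>m K n" "0\<^sub>m K n * mat_adjoint G = 0\<^sub>m K N"
    "0\<^sub>m K N * mat_adjoint Wa = 0\<^sub>m K K" "0\<^sub>m K K * mat_adjoint (0\<^sub>m K K) = (0\<^sub>m K K :: complex mat)"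
    using left_mult_zero_mat[OF Wa_carrier] left_mult_zero_mat[OF G] left_mult_zero_mat[OF aG]
      left_mult_zero_mat[OF aWa] left_mult_zero_mat[OF aW] by auto
  then show ?thesis using True unfolding sinr_def Let_def Wd Wa_def[symmetric] by simp
qed simp

lemma digital_detector_regular:
  assumes "det B \<noteq> 0"
  shows "digital_detector b G H \<in> carrier_mat K K" "digital_detector b G H * B = 1\<^sub>m K"
proof -
  have "B \<in> Units (ring_mat TYPE(complex) K ())"
    by (rule det_non_zero_imp_unit[OF B_carrier assms])
  then obtain W where W: "mat_inverse B = Some W"
    using mat_inverse(1)[OF B_carrier, of "()"] by (cases "mat_inverse B") auto
  then have "digital_detector b G H = W"
    by (simp add: digital_detector_def B_def[symmetric] Wa_def[symmetric])
  then show "digital_detector b G H \<in> carrier_mat K K" "digital_detector b G H * B = 1\<^sub>m K"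
    using mat_inverse(2)[OF B_carrier W] by auto
qed

lemma sinr_eq:
  assumes W: "digital_detector b G H = W" "W \<in> carrier_mat K K" and k: "k < K" and P: "0 \<le> Pu" "0 < Pr"
  shows "sinr b Pu Pr \<sigma>r \<sigma>d G H k = Pu /
    (\<sigma>r\<^sup>2 * (\<Sum>l<n. (cmod (\<Sum>i<K. W $$ (k, i) * (Wa * G) $$ (i, l)))\<^sup>2) +
     \<sigma>d\<^sup>2 * noise_gain \<sigma>r Pu Pr * (\<Sum>j<N. (cmod (\<Sum>i<K. W $$ (k, i) * Wa $$ (i, j)))\<^sup>2))"
proof -
  have WWa: "W * Wa \<in> carrier_mat K N" using W Wa_carrier by simp
  have WWaG: "W * Wa * G \<in> carrier_mat K n" using WWa G by simp
  have aWa: "mat_adjoint Wa \<in> carrier_mat N K" and aG: "mat_adjoint G \<in> carrier_mat n N"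
    and aW: "mat_adjoint W \<in> carrier_mat K K" using Wa_carrier G W by simp_all
  have "mat_adjoint (W * Wa * G) = mat_adjoint G * (mat_adjoint Wa * mat_adjoint W)"
    unfolding mat_adjoint_mult[OF WWa G] mat_adjoint_mult[OF W(2) Wa_carrier] ..
  also have "\<dots> = mat_adjoint G * mat_adjoint Wa * mat_adjoint W"
    by (rule assoc_mult_mat[symmetric, OF aG aWa aW])
  \<comment> \<open>Regrouped as a matrix times its own adjoint, the noise term on the diagonal
    becomes the squared norm of a row.\<close>
  finally have "W * Wa * G * mat_adjoint (W * Wa * G) = W * Wa * G * (mat_adjoint G * mat_adjoint Wa * mat_adjoint W)"
    by simp
  also have "\<dots> = W * Wa * G * (mat_adjoint G * mat_adjoint Wa) * mat_adjoint W"
    by (rule assoc_mult_mat[symmetric, OF WWaG mult_carrier_mat[OF aG aWa] aW])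
  also have "W * Wa * G * (mat_adjoint G * mat_adjoint Wa) = W * Wa * G * mat_adjoint G * mat_adjoint Wa"
    by (rule assoc_mult_mat[symmetric, OF WWaG aG aWa])
  finally have t1: "Re ((W * Wa * G * mat_adjoint G * mat_adjoint Wa * mat_adjoint W) $$ (k, k))
      = (\<Sum>l<n. (cmod ((W * Wa * G) $$ (k, l)))\<^sup>2)"
    using mult_adjoint_diag[OF WWaG k] by simp
  have "W * Wa * mat_adjoint (W * Wa) = W * Wa * mat_adjoint Wa * mat_adjoint W"
    unfolding mat_adjoint_mult[OF W(2) Wa_carrier]
    by (rule assoc_mult_mat[symmetric, OF WWa aWa aW])
  then have t2: "Re ((W * Wa * mat_adjoint Wa * mat_adjoint W) $$ (k, k)) = (\<Sum>j<N. (cmod ((W * Wa) $$ (k, j)))\<^sup>2)"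
    using mult_adjoint_diag[OF WWa k] by simp
  have a: "\<sigma>d\<^sup>2 / (amplification Pu Pr \<sigma>r H)\<^sup>2 = \<sigma>d\<^sup>2 * noise_gain \<sigma>r Pu Pr"
    using amplification_square[OF P, of \<sigma>r] by (metis times_divide_eq_right mult.right_neutral)
  have e1: "(W * Wa * G) $$ (k, l) = (\<Sum>i<K. W $$ (k, i) * (Wa * G) $$ (i, l))" if "l < n" for l
    unfolding assoc_mult_mat[OF W(2) Wa_carrier G] by (rule mult_mat_index_sum[OF W(2) WaG_carrier k that])
  have e2: "(W * Wa) $$ (k, j) = (\<Sum>i<K. W $$ (k, i) * Wa $$ (i, j))" if "j < N" for j
    by (rule mult_mat_index_sum[OF W(2) Wa_carrier k that])
  show ?thesis
    unfolding sinr_def Let_def Wa_def[symmetric] W(1) t1 t2 a using e1 e2 by simp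
qed

text \<open>The upper bound is what makes the rate integrable. Entry \<open>(k, k)\<close> of
  \<open>W * B = 1\<^sub>m K\<close> is the inner product of row \<open>k\<close> of
  \<open>W * Wa\<close> with column \<open>k\<close> of \<open>G * H\<close>, so Cauchy-Schwarz
  gives \<open>1 \<le> t * (g * h)\<close>. The noise gain is at least \<open>Pu * h / Pr\<close>;
  thus the column norm \<open>h\<close> cancels and only the norm of \<open>G\<close>
  remains.\<close>

lemma sinr_bounds:
  assumes k: "k < K" and P: "0 < Pu" "0 < Pr" and s: "0 < \<sigma>d"
  shows "0 \<le> sinr b Pu Pr \<sigma>r \<sigma>d G H k"
    and "det B \<noteq> 0 \<Longrightarrow> 0 < sinr b Pu Pr \<sigma>r \<sigma>d G H k"
    and "sinr b Pu Pr \<sigma>r \<sigma>d G H k \<le> Pr / \<sigma>d\<^sup>2 * (\<Sum>j<N. \<Sum>l<n. (cmod (G $$ (j, l)))\<^sup>2)"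
proof -
  define g where "g = (\<Sum>j<N. \<Sum>l<n. (cmod (G $$ (j, l)))\<^sup>2)"
  define \<gamma> where "\<gamma> = sinr b Pu Pr \<sigma>r \<sigma>d G H k"
  have g0: "0 \<le> g" by (simp add: g_def sum_nonneg)
  have main: "0 < \<gamma> \<and> \<gamma> \<le> Pr / \<sigma>d\<^sup>2 * g" if d: "det B \<noteq> 0"
  proof -
    define W where "W = digital_detector b G H"
    have W: "W \<in> carrier_mat K K" "W * B = 1\<^sub>m K" using digital_detector_regular[OF d] by (auto simp: W_def)
    define x where "x j = (\<Sum>i<K. W $$ (k, i) * Wa $$ (i, j))" for j
    define t where "t = (\<Sum>j<N. (cmod (x j))\<^sup>2)"
    define h where "h = (\<Sum>l<n. (cmod (H $$ (l, k)))\<^sup>2)"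
    define T where "T = (\<Sum>i<K. \<Sum>l<n. (cmod (H $$ (l, i)))\<^sup>2)"
    define s1 where "s1 = (\<Sum>l<n. (cmod (\<Sum>i<K. W $$ (k, i) * (Wa * G) $$ (i, l)))\<^sup>2)"
    have t0: "0 \<le> t" "0 \<le> h" "0 \<le> s1" by (simp_all add: t_def h_def s1_def sum_nonneg)
    have hT: "h \<le> T" unfolding h_def T_def
      using member_le_sum[of k "{..<K}" "\<lambda>i. \<Sum>l<n. (cmod (H $$ (l, i)))\<^sup>2"] k by (simp add: sum_nonneg)
    have eq: "\<gamma> = Pu / (\<sigma>r\<^sup>2 * s1 + \<sigma>d\<^sup>2 * noise_gain \<sigma>r Pu Pr * t)"
      unfolding \<gamma>_def s1_def t_def x_def by (rule sinr_eq[OF W_def[symmetric] W(1) k]) (use P in auto)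
    have "(W * B) $$ (k, k) = (\<Sum>j<N. x j * (G * H) $$ (j, k))"
    proof -
      have WWa: "W * Wa \<in> carrier_mat K N" using W Wa_carrier by simp
      have "W * B = W * (Wa * (G * H))" unfolding B_def assoc_mult_mat[OF Wa_carrier G H] ..
      also have "\<dots> = W * Wa * (G * H)" by (rule assoc_mult_mat[symmetric, OF W(1) Wa_carrier GH])
      finally have "(W * B) $$ (k, k) = (\<Sum>j<N. (W * Wa) $$ (k, j) * (G * H) $$ (j, k))"
        using mult_mat_index_sum[OF WWa GH k k] by simp
      then show ?thesis using mult_mat_index_sum[OF W(1) Wa_carrier k] by (simp add: x_def)
    qed
    then have "1 = (cmod (\<Sum>j<N. x j * (G * H) $$ (j, k)))\<^sup>2" using W(2) k by simp
    also have "\<dots> \<le> t * (\<Sum>j<N. (cmod ((G * H) $$ (j, k)))\<^sup>2)"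
      unfolding t_def by (rule cauchy_schwarz_complex)
    also have "\<dots> \<le> t * (g * h)"
    proof (rule mult_left_mono[OF _ t0(1)])
      have "(\<Sum>j<N. (cmod ((G * H) $$ (j, k)))\<^sup>2) \<le> (\<Sum>j<N. (\<Sum>l<n. (cmod (G $$ (j, l)))\<^sup>2) * h)"
        unfolding h_def using GH_index[OF _ k] by (intro sum_mono) (simp add: cauchy_schwarz_complex)
      then show "(\<Sum>j<N. (cmod ((G * H) $$ (j, k)))\<^sup>2) \<le> g * h"
        by (simp add: g_def sum_distrib_right)
    qed
    finally have one: "1 \<le> t * (g * h)" .
    then have "0 < t * (g * h)" by linarith
    then have pos: "0 < t" "0 < g" "0 < h" using t0 g0 by (auto simp: zero_less_mult_iff)
    have ng: "Pu * h / Pr \<le> noise_gain \<sigma>r Pu Pr"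
      unfolding noise_gain_def T_def[symmetric] using hT P
      by (intro divide_right_mono) (auto intro: order_trans[OF mult_left_mono[OF hT]] simp: add_increasing2)
    have "\<sigma>d\<^sup>2 * (Pu / Pr) / g \<le> \<sigma>d\<^sup>2 * (Pu * h / Pr) * t"
    proof -
      have "\<sigma>d\<^sup>2 * (Pu / Pr) / g * 1 \<le> \<sigma>d\<^sup>2 * (Pu / Pr) / g * (t * (g * h))"
        using one P pos by (intro mult_left_mono) auto
      also have "\<dots> = \<sigma>d\<^sup>2 * (Pu * h / Pr) * t" using pos by (simp add: field_simps)
      finally show ?thesis by simp
    qed
    also have "\<dots> \<le> \<sigma>d\<^sup>2 * noise_gain \<sigma>r Pu Pr * t"
      using ng pos by (intro mult_right_mono mult_left_mono) auto
    also have "\<dots> \<le> \<sigma>r\<^sup>2 * s1 + \<sigma>d\<^sup>2 * noise_gain \<sigma>r Pu Pr * t" using t0 by simp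
    finally have den: "\<sigma>d\<^sup>2 * (Pu / Pr) / g \<le> \<sigma>r\<^sup>2 * s1 + \<sigma>d\<^sup>2 * noise_gain \<sigma>r Pu Pr * t" .
    have den0: "0 < \<sigma>d\<^sup>2 * (Pu / Pr) / g" using s P pos by simp
    have "\<gamma> \<le> Pu / (\<sigma>d\<^sup>2 * (Pu / Pr) / g)"
      unfolding eq using den den0 P by (intro divide_left_mono mult_pos_pos) auto
    also have "\<dots> = Pr / \<sigma>d\<^sup>2 * g" using s P pos by (simp add: field_simps)
    finally have "\<gamma> \<le> Pr / \<sigma>d\<^sup>2 * g" .
    moreover have "0 < \<gamma>" unfolding eq using den den0 P by (intro divide_pos_pos) auto
    ultimately show ?thesis by simp
  qed
  show "det B \<noteq> 0 \<Longrightarrow> 0 < sinr b Pu Pr \<sigma>r \<sigma>d G H k" using main by (simp add: \<gamma>_def)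
  show "0 \<le> sinr b Pu Pr \<sigma>r \<sigma>d G H k"
    using main sinr_singular[of Pu Pr \<sigma>r \<sigma>d k] k unfolding \<gamma>_def by force
  show "sinr b Pu Pr \<sigma>r \<sigma>d G H k \<le> Pr / \<sigma>d\<^sup>2 * (\<Sum>j<N. \<Sum>l<n. (cmod (G $$ (j, l)))\<^sup>2)"
  proof (cases "det B = 0")
    case True
    then show ?thesis using sinr_singular[OF True, of Pu Pr \<sigma>r \<sigma>d k] k P g0 by (auto simp: g_def)
  qed (use main in \<open>simp add: \<gamma>_def g_def\<close>)
qed

text \<open>The weights \<open>c\<close> bound the entries of row \<open>k\<close> of the zero-forcing matrix.\<close>

lemma inverse_sinr_le:
  assumes k: "k < K" and P: "0 < Pu" "0 < Pr" and s: "0 < \<sigma>d"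
    and e: "0 \<le> e" "real K * e \<le> 1 / 2"
    and \<beta>: "0 < \<beta>0" "\<And>i. i < K \<Longrightarrow> \<beta>0 \<le> \<beta> i"
    and diag: "\<And>i. i < K \<Longrightarrow> \<beta> i \<le> cmod (B $$ (i, i))"
    and off: "\<And>i j. i < K \<Longrightarrow> j < K \<Longrightarrow> i \<noteq> j \<Longrightarrow> cmod (B $$ (i, j)) \<le> e * \<beta>0"
    and c: "\<And>i. c i = ((if i = k then 1 else 0) + 2 * e) / \<beta> i"
  shows "1 / (1 + sinr b Pu Pr \<sigma>r \<sigma>d G H k) \<le>
    (\<sigma>r\<^sup>2 * ((\<Sum>i<K. c i) * (\<Sum>i<K. c i * row_norm2 i)) + \<sigma>d\<^sup>2 * noise_gain \<sigma>r Pu Pr * (\<Sum>i<K. c i)\<^sup>2) / Pu"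
proof -
  define \<gamma> where "\<gamma> = sinr b Pu Pr \<sigma>r \<sigma>d G H k"
  have d: "det B \<noteq> 0" by (rule diagonally_dominant_det[OF B_carrier e \<beta> diag off])
  define W where "W = digital_detector b G H"
  have W: "W \<in> carrier_mat K K" "W * B = 1\<^sub>m K" using digital_detector_regular[OF d] by (auto simp: W_def)
  have Wc: "cmod (W $$ (k, i)) \<le> c i" if "i < K" for i
    unfolding c by (rule diagonally_dominant_inverse_row[OF B_carrier W e \<beta> diag off k that])
  define s1 where "s1 = (\<Sum>l<n. (cmod (\<Sum>i<K. W $$ (k, i) * (Wa * G) $$ (i, l)))\<^sup>2)"
  define t where "t = (\<Sum>j<N. (cmod (\<Sum>i<K. W $$ (k, i) * Wa $$ (i, j)))\<^sup>2)"
  have "s1 \<le> (\<Sum>l<n. (\<Sum>i<K. c i) * (\<Sum>i<K. c i * (cmod ((Wa * G) $$ (i, l)))\<^sup>2))"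
    unfolding s1_def by (intro sum_mono cauchy_schwarz_weighted Wc)
  also have "\<dots> = (\<Sum>i<K. c i) * (\<Sum>i<K. c i * row_norm2 i)"
    unfolding sum_distrib_left[symmetric] row_norm2_def by (subst sum.swap) (simp add: sum_distrib_left)
  finally have s1: "s1 \<le> (\<Sum>i<K. c i) * (\<Sum>i<K. c i * row_norm2 i)" .
  have "t \<le> (\<Sum>j<N. (\<Sum>i<K. c i) * (\<Sum>i<K. c i * (cmod (Wa $$ (i, j)))\<^sup>2))"
    unfolding t_def by (intro sum_mono cauchy_schwarz_weighted Wc)
  also have "\<dots> = (\<Sum>i<K. c i) * (\<Sum>i<K. c i * (\<Sum>j<N. (cmod (Wa $$ (i, j)))\<^sup>2))"
    unfolding sum_distrib_left[symmetric] by (subst sum.swap) (simp add: sum_distrib_left)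
  also have "\<dots> = (\<Sum>i<K. c i)\<^sup>2" using Wa_norm by (simp add: power2_eq_square)
  finally have t: "t \<le> (\<Sum>i<K. c i)\<^sup>2" .
  have ng: "0 \<le> noise_gain \<sigma>r Pu Pr" unfolding noise_gain_def using P
    by (intro divide_nonneg_pos add_nonneg_nonneg mult_nonneg_nonneg sum_nonneg) auto
  have eq: "\<gamma> = Pu / (\<sigma>r\<^sup>2 * s1 + \<sigma>d\<^sup>2 * noise_gain \<sigma>r Pu Pr * t)"
    unfolding \<gamma>_def s1_def t_def by (rule sinr_eq[OF W_def[symmetric] W(1) k]) (use P in auto)
  have pos: "0 < \<gamma>" using sinr_bounds(2)[OF k P s d] by (simp add: \<gamma>_def)
  \<comment> \<open>Dropping the 1 leaves a bound that is linear in the row norms and in the noise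
    gain, whose expectations can be controlled.\<close>
  have "1 / (1 + \<gamma>) \<le> 1 / \<gamma>" using pos by (intro divide_left_mono) auto
  also have "\<dots> = (\<sigma>r\<^sup>2 * s1 + \<sigma>d\<^sup>2 * noise_gain \<sigma>r Pu Pr * t) / Pu" unfolding eq by simp
  also have "\<dots> \<le> (\<sigma>r\<^sup>2 * ((\<Sum>i<K. c i) * (\<Sum>i<K. c i * row_norm2 i)) + \<sigma>d\<^sup>2 * noise_gain \<sigma>r Pu Pr * (\<Sum>i<K. c i)\<^sup>2) / Pu"
    using P s1 t ng by (intro divide_right_mono add_mono mult_left_mono mult_nonneg_nonneg) auto
  finally show ?thesis by (simp add: \<gamma>_def)
qed

end

subsection \<open>Expectations for the random channels\<close>

lemma borel_measurable_cmod: "f \<in> borel_measurable M \<Longrightarrow> (\<lambda>x. cmod (f x)) \<in> borel_measurable M"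
  and borel_measurable_sqrt_comp: "g \<in> borel_measurable M \<Longrightarrow> (\<lambda>x. sqrt (g x)) \<in> borel_measurable M"
proof -
  show "f \<in> borel_measurable M \<Longrightarrow> (\<lambda>x. cmod (f x)) \<in> borel_measurable M" by measurable
  show "g \<in> borel_measurable M \<Longrightarrow> (\<lambda>x. sqrt (g x)) \<in> borel_measurable M"
    by (rule measurable_compose[OF _ borel_measurable_continuous_onI[OF continuous_on_real_sqrt[OF continuous_on_id]]])
qed

section \<open>Measurability of the SINR\<close>

definition measurable_mat :: "'a measure \<Rightarrow> nat \<Rightarrow> nat \<Rightarrow> ('a \<Rightarrow> complex mat) \<Rightarrow> bool" where
  "measurable_mat M n m A \<longleftrightarrow> (\<forall>\<omega>\<in>space M. A \<omega> \<in> carrier_mat n m) \<and>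
     (\<forall>i<n. \<forall>j<m. (\<lambda>\<omega>. A \<omega> $$ (i, j)) \<in> borel_measurable M)"

lemma measurable_mat_mult:
  assumes A: "measurable_mat M n m A" and B: "measurable_mat M m p B"
  shows "measurable_mat M n p (\<lambda>\<omega>. A \<omega> * B \<omega>)"
  unfolding measurable_mat_def
proof (intro conjI allI impI ballI)
  fix i j assume ij: "i < n" "j < p"
  have "(\<lambda>\<omega>. \<Sum>l<m. A \<omega> $$ (i, l) * B \<omega> $$ (l, j)) \<in> borel_measurable M"
    using A B ij by (intro borel_measurable_sum borel_measurable_times) (auto simp: measurable_mat_def)
  then show "(\<lambda>\<omega>. (A \<omega> * B \<omega>) $$ (i, j)) \<in> borel_measurable M"
    by (rule measurable_cong[THEN iffD1, rotated])
      (rule mult_mat_index_sum[symmetric], use A B ij in \<open>auto simp: measurable_mat_def\<close>)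
qed (use A B in \<open>auto simp: measurable_mat_def\<close>)

lemma measurable_mat_det:
  assumes A: "measurable_mat M n n A"
  shows "(\<lambda>\<omega>. det (A \<omega>)) \<in> borel_measurable M"
proof -
  have "(\<lambda>\<omega>. \<Sum>p\<in>{p. p permutes {0..<n}}. signof p * (\<Prod>i = 0..<n. A \<omega> $$ (i, p i))) \<in> borel_measurable M"
  proof (intro borel_measurable_sum borel_measurable_times borel_measurable_prod borel_measurable_const)
    fix p i assume "p \<in> {p. p permutes {0..<n}}" "i \<in> {0..<n}"
    then have "p i < n" "i < n" using permutes_in_image[of p "{0..<n}" i] by auto
    then show "(\<lambda>\<omega>. A \<omega> $$ (i, p i)) \<in> borel_measurable M" using A by (auto simp: measurable_mat_def)
  qed
  then show ?thesis
    by (rule measurable_cong[THEN iffD1, rotated]) (rule det_def'[symmetric], use A in \<open>auto simp: measurable_mat_def\<close>)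
qed

lemma measurable_mat_adj_mat:
  assumes A: "measurable_mat M n n A" and ij: "i < n" "j < n"
  shows "(\<lambda>\<omega>. adj_mat (A \<omega>) $$ (i, j)) \<in> borel_measurable M"
proof -
  have "measurable_mat M (n - 1) (n - 1) (\<lambda>\<omega>. mat_delete (A \<omega>) j i)"
    unfolding measurable_mat_def
  proof (intro conjI allI impI ballI)
    fix i' j' assume l: "i' < n - 1" "j' < n - 1"
    define r where "r = (if i' < j then i' else Suc i')"
    define s where "s = (if j' < i then j' else Suc j')"
    have "r < n" "s < n" using l by (auto simp: r_def s_def)
    then have "(\<lambda>\<omega>. A \<omega> $$ (r, s)) \<in> borel_measurable M" using A by (auto simp: measurable_mat_def)
    then show "(\<lambda>\<omega>. mat_delete (A \<omega>) j i $$ (i', j')) \<in> borel_measurable M"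
      by (rule measurable_cong[THEN iffD1, rotated])
        (use A l in \<open>auto simp: measurable_mat_def mat_delete_def r_def s_def\<close>)
  qed (use A in \<open>auto simp: measurable_mat_def mat_delete_def\<close>)
  then have "(\<lambda>\<omega>. (-1) ^ (j + i) * det (mat_delete (A \<omega>) j i)) \<in> borel_measurable M"
    by (intro borel_measurable_times measurable_mat_det borel_measurable_const)
  then show ?thesis
    by (rule measurable_cong[THEN iffD1, rotated])
      (use A ij in \<open>auto simp: measurable_mat_def adj_mat_def cofactor_def\<close>)
qed

text \<open>\<open>mat_inverse\<close> is computed by elimination, which branches on the entries.
  Adjugate over determinant is a quotient of polynomials in them, from which measurability is
  visible; on singular channels the SINR is 0.\<close>

lemma inverse_eq_adj_mat:
  fixes B W :: "complex mat"
  assumes B: "B \<in> carrier_mat K K" and W: "W \<in> carrier_mat K K" "W * B = 1\<^sub>m K" and d: "det B \<noteq> 0"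
    and ij: "i < K" "j < K"
  shows "W $$ (i, j) = adj_mat B $$ (i, j) / det B"
proof -
  note adj = adj_mat[OF B]
  have "adj_mat B = W * B * adj_mat B" using W adj(1) by simp
  also have "\<dots> = W * (B * adj_mat B)" by (rule assoc_mult_mat[OF W(1) B adj(1)])
  also have "\<dots> = det B \<cdot>\<^sub>m W" unfolding adj(2) using W(1) mult_smult_distrib[OF W(1), of "1\<^sub>m K" K] by simp
  finally have "adj_mat B $$ (i, j) = (det B \<cdot>\<^sub>m W) $$ (i, j)" by simp
  then show ?thesis using W ij d by simp
qed

lemma measurable_sinr:
  assumes G: "measurable_mat M N n G" and H: "measurable_mat M n K H"
    and b: "b \<ge> 1" and N: "N > 0" and k: "k < K" and P: "0 \<le> Pu" "0 < Pr"
  shows "(\<lambda>\<omega>. sinr b Pu Pr \<sigma>r \<sigma>d (G \<omega>) (H \<omega>) k) \<in> borel_measurable M"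
proof -
  have rm: "relay_mats b (G \<omega>) (H \<omega>) N n K" if "\<omega> \<in> space M" for \<omega>
    using G H b N that by unfold_locales (auto simp: measurable_mat_def)
  define Wf where "Wf \<omega> = relay_mats.Wa b (G \<omega>) (H \<omega>)" for \<omega>
  define Bf where "Bf \<omega> = relay_mats.B b (G \<omega>) (H \<omega>)" for \<omega>
  have Wf: "measurable_mat M K N Wf"
    unfolding measurable_mat_def
  proof (intro conjI allI impI ballI)
    show "Wf \<omega> \<in> carrier_mat K N" if "\<omega> \<in> space M" for \<omega>
      unfolding Wf_def by (rule relay_mats.Wa_carrier[OF rm[OF that]])
    fix i j assume ij: "i < K" "j < N"
    have "(\<lambda>\<omega>. complex_of_real (1 / sqrt N) * phase_weight b (\<Sum>l<n. G \<omega> $$ (j, l) * H \<omega> $$ (l, i))) \<in> borel_measurable M"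
      using G H ij by (intro borel_measurable_times borel_measurable_const borel_measurable_sum
          measurable_compose[OF _ borel_measurable_phase_weight]) (auto simp: measurable_mat_def)
    then show "(\<lambda>\<omega>. Wf \<omega> $$ (i, j)) \<in> borel_measurable M"
      by (rule measurable_cong[THEN iffD1, rotated])
        (simp add: Wf_def relay_mats.Wa_index[OF rm ij])
  qed
  have WaG: "measurable_mat M K n (\<lambda>\<omega>. Wf \<omega> * G \<omega>)" by (rule measurable_mat_mult[OF Wf G])
  have "measurable_mat M K K (\<lambda>\<omega>. Wf \<omega> * G \<omega> * H \<omega>)" by (rule measurable_mat_mult[OF WaG H])
  then have Bf: "measurable_mat M K K Bf"
    unfolding measurable_mat_def Bf_def Wf_def by (simp add: relay_mats.B_def[OF rm] cong: measurable_cong)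
  define s1 where "s1 \<omega> = (\<Sum>l<n. (cmod (\<Sum>i<K. adj_mat (Bf \<omega>) $$ (k, i) / det (Bf \<omega>) * (Wf \<omega> * G \<omega>) $$ (i, l)))\<^sup>2)" for \<omega>
  define t where "t \<omega> = (\<Sum>j<N. (cmod (\<Sum>i<K. adj_mat (Bf \<omega>) $$ (k, i) / det (Bf \<omega>) * Wf \<omega> $$ (i, j)))\<^sup>2)" for \<omega>
  define ng where "ng \<omega> = (Pu * (\<Sum>i<K. \<Sum>l<n. (cmod (H \<omega> $$ (l, i)))\<^sup>2) + \<sigma>r\<^sup>2 * n) / Pr" for \<omega>
  have [measurable]: "(\<lambda>\<omega>. det (Bf \<omega>)) \<in> borel_measurable M" by (rule measurable_mat_det[OF Bf])
  have adj: "i < K \<Longrightarrow> (\<lambda>\<omega>. adj_mat (Bf \<omega>) $$ (k, i)) \<in> borel_measurable M" for i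
    by (rule measurable_mat_adj_mat[OF Bf k])
  have [measurable]: "s1 \<in> borel_measurable M" unfolding s1_def using WaG adj
    by (intro borel_measurable_sum borel_measurable_power borel_measurable_cmod borel_measurable_times borel_measurable_divide)
      (auto simp: measurable_mat_def)
  have [measurable]: "t \<in> borel_measurable M" unfolding t_def using Wf adj
    by (intro borel_measurable_sum borel_measurable_power borel_measurable_cmod borel_measurable_times borel_measurable_divide)
      (auto simp: measurable_mat_def)
  have [measurable]: "ng \<in> borel_measurable M" unfolding ng_def using H
    by (intro borel_measurable_sum borel_measurable_power borel_measurable_cmod borel_measurable_times borel_measurable_divide
        borel_measurable_add borel_measurable_const)
      (auto simp: measurable_mat_def)
  have "(\<lambda>\<omega>. if det (Bf \<omega>) = 0 then 0 else Pu / (\<sigma>r\<^sup>2 * s1 \<omega> + \<sigma>d\<^sup>2 * ng \<omega> * t \<omega>)) \<in> borel_measurable M"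
    by measurable
  then show ?thesis
  proof (rule measurable_cong[THEN iffD1, rotated])
    fix \<omega> assume \<omega>: "\<omega> \<in> space M"
    interpret relay_mats b "G \<omega>" "H \<omega>" N n K by (rule rm[OF \<omega>])
    show "(if det (Bf \<omega>) = 0 then 0 else Pu / (\<sigma>r\<^sup>2 * s1 \<omega> + \<sigma>d\<^sup>2 * ng \<omega> * t \<omega>)) = sinr b Pu Pr \<sigma>r \<sigma>d (G \<omega>) (H \<omega>) k"
    proof (cases "det (Bf \<omega>) = 0")
      case True
      then have "det B = 0" by (simp add: Bf_def)
      from sinr_singular[OF this, of Pu Pr \<sigma>r \<sigma>d k] True k show ?thesis by auto
    next
      case False
      then have d: "det B \<noteq> 0" by (simp add: Bf_def)
      note W = digital_detector_regular[OF d]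
      show ?thesis
        using False inverse_eq_adj_mat[OF B_carrier W d k]
        unfolding sinr_eq[OF refl W(1) k P] s1_def t_def ng_def noise_gain_def Bf_def Wf_def by simp
    qed
  qed
qed

section \<open>Averages over both random channels\<close>

locale gaussian_relay = relay_channel M K Nr Nd \<xi> \<eta> H G
  for M :: "'a measure" and K Nr Nd :: nat and \<xi> :: "nat \<Rightarrow> real" and \<eta> :: real
    and H G :: "'a \<Rightarrow> complex mat" +
  fixes b :: nat
  assumes b: "b \<ge> 1" and Nd: "Nd > 0" and Nr: "Nr > 0" and \<eta>: "\<eta> > 0" and \<xi>: "\<And>j. j < K \<Longrightarrow> \<xi> j > 0"
begin

text \<open>With \<open>h\<close> the column \<open>i\<close> of \<open>H\<close>, this is row
  \<open>i\<close> of \<open>Wa * G\<close> without the factor \<open>1 / sqrt Nd\<close>. Functions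
  replace matrices so that it can be evaluated on the coordinates of the product spaces in which
  independence is stated.\<close>

definition combined :: "(nat \<times> nat \<Rightarrow> complex) \<Rightarrow> (nat \<Rightarrow> complex) \<Rightarrow> nat \<Rightarrow> complex" where
  "combined g h l = (\<Sum>j<Nd. phase_weight b (\<Sum>l<Nr. g (j, l) * h l) * g (j, l))"

lemma combined_cong:
  assumes "\<And>j l. j < Nd \<Longrightarrow> l < Nr \<Longrightarrow> g (j, l) = g' (j, l)" "\<And>l. l < Nr \<Longrightarrow> h l = h' l" "l < Nr"
  shows "combined g h l = combined g' h' l"
  using assms unfolding combined_def
  by (intro sum.cong arg_cong2[where f="(*)"] arg_cong[where f="phase_weight b"]) auto

lemma combined_measurable:
  assumes "\<And>j l. j < Nd \<Longrightarrow> l < Nr \<Longrightarrow> (\<lambda>z. g z (j, l)) \<in> borel_measurable A"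
    and "\<And>l. l < Nr \<Longrightarrow> (\<lambda>z. h z l) \<in> borel_measurable A" and "l < Nr"
  shows "(\<lambda>z. combined (g z) (h z) l) \<in> borel_measurable A"
  using assms unfolding combined_def
  by (intro borel_measurable_sum borel_measurable_times measurable_compose[OF _ borel_measurable_phase_weight]) auto

abbreviation "SH \<equiv> Pi\<^sub>M ({..<Nr} \<times> {..<K}) (\<lambda>_. borel :: complex measure)"
abbreviation "SG \<equiv> Pi\<^sub>M ({..<Nd} \<times> {..<Nr}) (\<lambda>_. borel :: complex measure)"
abbreviation "XH \<omega> \<equiv> restrict (\<lambda>p. H \<omega> $$ p) ({..<Nr} \<times> {..<K})"
abbreviation "XG \<omega> \<equiv> restrict (\<lambda>p. G \<omega> $$ p) ({..<Nd} \<times> {..<Nr})"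
abbreviation "hcol i \<omega> \<equiv> (\<lambda>l. H \<omega> $$ (l, i))"
abbreviation "gent \<omega> \<equiv> (\<lambda>p. G \<omega> $$ p)"

lemma mats: "\<omega> \<in> space M \<Longrightarrow> relay_mats b (G \<omega>) (H \<omega>) Nd Nr K"
  using H_carrier G_carrier b Nd by unfold_locales auto

lemma G_normal: "p \<in> {..<Nd} \<times> {..<Nr} \<Longrightarrow> complex_normal \<eta> (\<lambda>\<omega>. G \<omega> $$ p)"
  using G_entry by auto

lemma G_meas: "j < Nd \<Longrightarrow> l < Nr \<Longrightarrow> (\<lambda>\<omega>. G \<omega> $$ (j, l)) \<in> borel_measurable M"
  using complex_normal_moments(1)[OF G_normal \<eta>] by auto

lemma col_H: "\<omega> \<in> space M \<Longrightarrow> l < Nr \<Longrightarrow> k < K \<Longrightarrow> col (H \<omega>) k $ l = H \<omega> $$ (l, k)"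
  using H_carrier[of \<omega>] by auto

lemma H_col_indep: "k < K \<Longrightarrow> indep_vars (\<lambda>_. borel) (\<lambda>l \<omega>. col (H \<omega>) k $ l) {..<Nr}"
  and H_col_normal: "k < K \<Longrightarrow> l < Nr \<Longrightarrow> complex_normal (\<xi> k) (\<lambda>\<omega>. col (H \<omega>) k $ l)"
  using H_col unfolding complex_normal_vec_def by auto

lemma H_meas: "l < Nr \<Longrightarrow> k < K \<Longrightarrow> (\<lambda>\<omega>. H \<omega> $$ (l, k)) \<in> borel_measurable M"
  using complex_normal_moments(1)[OF H_col_normal \<xi>] measurable_cong[of M "\<lambda>\<omega>. col (H \<omega>) k $ l" "\<lambda>\<omega>. H \<omega> $$ (l, k)"]
    col_H by auto

lemma comp_meas [simp]:
  "l < Nr \<Longrightarrow> k < K \<Longrightarrow> (\<lambda>x. x (l, k)) \<in> borel_measurable SH"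
  "j < Nd \<Longrightarrow> l < Nr \<Longrightarrow> (\<lambda>x. x (j, l)) \<in> borel_measurable SG"
  by (rule measurable_component_singleton; simp)+

lemma pair_comp_meas:
  "l < Nr \<Longrightarrow> k < K \<Longrightarrow> (\<lambda>z. fst z (l, k)) \<in> borel_measurable (SH \<Otimes>\<^sub>M SG)"
  "j < Nd \<Longrightarrow> l < Nr \<Longrightarrow> (\<lambda>z. snd z (j, l)) \<in> borel_measurable (SH \<Otimes>\<^sub>M SG)"
  by (rule measurable_compose[OF measurable_fst] measurable_compose[OF measurable_snd]; simp)+

text \<open>By independence, expectations can be taken over two independent copies of the sample space,
  one for each channel, so that one channel is deterministic while integrating over the other.\<close>

lemma decouple:
  assumes f: "f \<in> borel_measurable (SH \<Otimes>\<^sub>M SG)"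
  shows "(\<integral>\<^sup>+\<omega>. f (XH \<omega>, XG \<omega>) \<partial>M) = (\<integral>\<^sup>+\<omega>'. \<integral>\<^sup>+\<omega>. f (XH \<omega>', XG \<omega>) \<partial>M \<partial>M)"
    and "(\<integral>\<^sup>+\<omega>. f (XH \<omega>, XG \<omega>) \<partial>M) = (\<integral>\<^sup>+\<omega>. \<integral>\<^sup>+\<omega>'. f (XH \<omega>', XG \<omega>) \<partial>M \<partial>M)"
  using nn_integral_indep_var[OF H_G_indep f] by simp_all

definition "mean_amp = polygon_mean b \<eta>"
text \<open>The incoherent part of a row of \<open>Wa * G\<close> and the coherent part created by
  the matched phases. For a fixed ratio of the array sizes both are of order
  \<open>Nr\<close>.\<close>

definition "gain_bound = Nr * \<eta> + Nd * mean_amp\<^sup>2"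

lemma mean_amp_pos: "0 < mean_amp"
  unfolding mean_amp_def by (rule polygon_mean_pos[OF b \<eta>])

lemma gain_bound_nonneg: "0 \<le> gain_bound"
  using \<eta> by (simp add: gain_bound_def)

lemma combined_norm_expectation:
  assumes i: "i < K"
  shows "(\<integral>\<^sup>+\<omega>. ennreal (\<Sum>l<Nr. (cmod (combined (gent \<omega>) (hcol i \<omega>) l))\<^sup>2) \<partial>M) \<le> ennreal (Nd * gain_bound)"
proof -
  define f where "f z = ennreal (\<Sum>l<Nr. (cmod (combined (snd z) (\<lambda>l. fst z (l, i)) l))\<^sup>2)" for z
  have f: "f \<in> borel_measurable (SH \<Otimes>\<^sub>M SG)" unfolding f_def
    by (intro measurable_compose[OF _ measurable_ennreal] borel_measurable_sum borel_measurable_power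
        borel_measurable_cmod combined_measurable pair_comp_meas i) auto
  have fX: "f (XH \<omega>', XG \<omega>) = ennreal (\<Sum>l<Nr. (cmod (combined (gent \<omega>) (hcol i \<omega>') l))\<^sup>2)" for \<omega> \<omega>'
    unfolding f_def fst_conv snd_conv
    by (intro arg_cong[where f=ennreal] sum.cong refl arg_cong[where f="\<lambda>x. (cmod x)\<^sup>2"] combined_cong) (use i in auto)
  have "(\<integral>\<^sup>+\<omega>. f (XH \<omega>', XG \<omega>) \<partial>M) \<le> ennreal (Nd * gain_bound)" for \<omega>'
  proof -
    have "Nd * gain_bound = real Nd * real Nr * \<eta> + (real Nd * mean_amp)\<^sup>2"
      by (simp add: gain_bound_def power2_eq_square algebra_simps)
    then show ?thesis
      unfolding fX combined_def mean_amp_def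
      using gaussian_rows_combined[OF G_entries_indep G_normal \<eta> b, of "hcol i \<omega>'"] by simp
  qed
  then have "(\<integral>\<^sup>+\<omega>. f (XH \<omega>, XG \<omega>) \<partial>M) \<le> (\<integral>\<^sup>+\<omega>'. ennreal (Nd * gain_bound) \<partial>M)"
    unfolding decouple(1)[OF f] by (intro nn_integral_mono)
  then show ?thesis unfolding fX by (simp add: emeasure_space_1)
qed

text \<open>With \<open>G\<close> and column \<open>i\<close> of \<open>H\<close> fixed, the
  combined row is a constant vector, and the independent Gaussian column \<open>k\<close> multiplies
  its squared norm by \<xi> k on average. Off-diagonal entries therefore miss the coherent growth
  and are smaller than diagonal ones by a factor of order sqrt Nd.\<close>

lemma cross_term_expectation:
  assumes i: "i < K" and k: "k < K" and ik: "i \<noteq> k"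
  shows "(\<integral>\<^sup>+\<omega>. ennreal ((cmod (\<Sum>l<Nr. combined (gent \<omega>) (hcol i \<omega>) l * H \<omega> $$ (l, k)))\<^sup>2) \<partial>M)
    \<le> ennreal (\<xi> k * (Nd * gain_bound))"
proof -
  define f where "f z = ennreal ((cmod (\<Sum>l<Nr. combined (snd z) (\<lambda>l. fst z (l, i)) l * fst z (l, k)))\<^sup>2)" for z
  have f: "f \<in> borel_measurable (SH \<Otimes>\<^sub>M SG)" unfolding f_def
    by (intro measurable_compose[OF _ measurable_ennreal] borel_measurable_sum borel_measurable_power
        borel_measurable_cmod borel_measurable_times combined_measurable pair_comp_meas i k) auto
  have fX: "f (XH \<omega>', XG \<omega>) = ennreal ((cmod (\<Sum>l<Nr. combined (gent \<omega>) (hcol i \<omega>') l * H \<omega>' $$ (l, k)))\<^sup>2)" for \<omega> \<omega>'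
    unfolding f_def fst_conv snd_conv
    by (intro arg_cong[where f=ennreal] sum.cong refl arg_cong[where f="\<lambda>x. (cmod x)\<^sup>2"] combined_cong arg_cong2[where f="(*)"]) (use i k in auto)
  define f2 where "f2 z = ennreal (\<Sum>l<Nr. (cmod (combined (snd z) (\<lambda>l. fst z (l, i)) l))\<^sup>2)" for z
  have f2: "f2 \<in> borel_measurable (SH \<Otimes>\<^sub>M SG)" unfolding f2_def
    by (intro measurable_compose[OF _ measurable_ennreal] borel_measurable_sum borel_measurable_power
        borel_measurable_cmod combined_measurable pair_comp_meas i) auto
  have f2X: "f2 (XH \<omega>', XG \<omega>) = ennreal (\<Sum>l<Nr. (cmod (combined (gent \<omega>) (hcol i \<omega>') l))\<^sup>2)" for \<omega> \<omega>'
    unfolding f2_def fst_conv snd_conv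
    by (intro arg_cong[where f=ennreal] sum.cong refl arg_cong[where f="\<lambda>x. (cmod x)\<^sup>2"] combined_cong) (use i in auto)
  let ?S = "Pi\<^sub>M {..<Nr} (\<lambda>_. borel :: complex measure)"
  let ?R = "\<lambda>j \<omega>. \<lambda>l\<in>{..<Nr}. H \<omega> $$ (l, j)"
  have ind: "indep_var ?S (?R i) ?S (?R k)"
    by (rule indep_vars_imp_indep_var[OF H_cols_indep]) (use i k ik in auto)
  \<comment> \<open>A second decoupling, now between two columns of the same \<open>H\<close>, while
    \<open>G\<close> stays fixed.\<close>
  have inner: "(\<integral>\<^sup>+\<omega>'. f (XH \<omega>', XG \<omega>) \<partial>M) = ennreal (\<xi> k) * (\<integral>\<^sup>+\<omega>'. f2 (XH \<omega>', XG \<omega>) \<partial>M)" for \<omega>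
  proof -
    define F where "F z = ennreal ((cmod (\<Sum>l<Nr. combined (gent \<omega>) (fst z) l * snd z l))\<^sup>2)" for z
    have comp: "l < Nr \<Longrightarrow> (\<lambda>x. x l) \<in> borel_measurable ?S" for l
      by (rule measurable_component_singleton) simp
    have F: "F \<in> borel_measurable (?S \<Otimes>\<^sub>M ?S)" unfolding F_def
      by (intro measurable_compose[OF _ measurable_ennreal] borel_measurable_sum borel_measurable_power
          borel_measurable_cmod borel_measurable_times combined_measurable borel_measurable_const
          measurable_compose[OF measurable_fst] measurable_compose[OF measurable_snd] comp) auto
    have FX: "F (?R i \<omega>', ?R k \<omega>'') = ennreal ((cmod (\<Sum>l<Nr. combined (gent \<omega>) (hcol i \<omega>') l * H \<omega>'' $$ (l, k)))\<^sup>2)" for \<omega>' \<omega>''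
      unfolding F_def fst_conv snd_conv
      by (intro arg_cong[where f=ennreal] sum.cong refl arg_cong[where f="\<lambda>x. (cmod x)\<^sup>2"] combined_cong arg_cong2[where f="(*)"]) auto
    have "(\<integral>\<^sup>+\<omega>'. f (XH \<omega>', XG \<omega>) \<partial>M) = (\<integral>\<^sup>+\<omega>'. F (?R i \<omega>', ?R k \<omega>') \<partial>M)" unfolding fX FX ..
    also have "\<dots> = (\<integral>\<^sup>+\<omega>'. \<integral>\<^sup>+\<omega>''. F (?R i \<omega>', ?R k \<omega>'') \<partial>M \<partial>M)"
      by (rule nn_integral_indep_var(1)[OF ind F])
    also have "\<dots> = (\<integral>\<^sup>+\<omega>'. ennreal (\<xi> k) * f2 (XH \<omega>', XG \<omega>) \<partial>M)"
    proof (rule nn_integral_cong)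
      fix \<omega>'
      let ?a = "\<lambda>l. combined (gent \<omega>) (hcol i \<omega>') l"
      note sq = complex_normal_linear_square[OF H_col_indep[OF k] finite_lessThan H_col_normal[OF k] \<xi>[OF k], simplified, where a="?a"]
      have "(\<integral>\<^sup>+\<omega>''. F (?R i \<omega>', ?R k \<omega>'') \<partial>M) = (\<integral>\<^sup>+\<omega>''. ennreal ((cmod (\<Sum>l<Nr. col (H \<omega>'') k $ l * ?a l))\<^sup>2) \<partial>M)"
        unfolding FX by (intro nn_integral_cong) (simp add: col_H k mult.commute)
      also have "\<dots> = ennreal (\<xi> k * (\<Sum>l<Nr. (cmod (?a l))\<^sup>2))"
        using sq by (subst nn_integral_eq_integral) auto
      also have "\<dots> = ennreal (\<xi> k) * f2 (XH \<omega>', XG \<omega>)"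
        unfolding f2X using \<xi>[OF k] by (intro ennreal_mult) (auto intro: sum_nonneg)
      finally show "(\<integral>\<^sup>+\<omega>''. F (?R i \<omega>', ?R k \<omega>'') \<partial>M) = ennreal (\<xi> k) * f2 (XH \<omega>', XG \<omega>)" .
    qed
    also have "\<dots> = ennreal (\<xi> k) * (\<integral>\<^sup>+\<omega>'. f2 (XH \<omega>', XG \<omega>) \<partial>M)"
      unfolding f2X
      by (intro nn_integral_cmult measurable_compose[OF _ measurable_ennreal] borel_measurable_sum borel_measurable_power
        borel_measurable_cmod combined_measurable borel_measurable_const H_meas i) auto
    finally show ?thesis .
  qed
  have f2m: "(\<lambda>\<omega>. \<integral>\<^sup>+\<omega>'. f2 (XH \<omega>', XG \<omega>) \<partial>M) \<in> borel_measurable M"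
  proof -
    have [measurable]: "XG \<in> M \<rightarrow>\<^sub>M SG" "XH \<in> M \<rightarrow>\<^sub>M SH"
      using H_G_indep by (auto dest: indep_var_rv1 indep_var_rv2)
    have "(\<lambda>p. f2 (XH (snd p), XG (fst p))) \<in> borel_measurable (M \<Otimes>\<^sub>M M)"
      by (rule measurable_compose[OF _ f2]) measurable
    then show ?thesis by (intro borel_measurable_nn_integral) (simp add: case_prod_beta')
  qed
  have "(\<integral>\<^sup>+\<omega>. f (XH \<omega>, XG \<omega>) \<partial>M) = (\<integral>\<^sup>+\<omega>. ennreal (\<xi> k) * (\<integral>\<^sup>+\<omega>'. f2 (XH \<omega>', XG \<omega>) \<partial>M) \<partial>M)"
    unfolding decouple(2)[OF f] inner ..
  also have "\<dots> = ennreal (\<xi> k) * (\<integral>\<^sup>+\<omega>. \<integral>\<^sup>+\<omega>'. f2 (XH \<omega>', XG \<omega>) \<partial>M \<partial>M)"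
    by (rule nn_integral_cmult[OF f2m])
  also have "\<dots> = ennreal (\<xi> k) * (\<integral>\<^sup>+\<omega>. f2 (XH \<omega>, XG \<omega>) \<partial>M)"
    unfolding decouple(2)[OF f2] ..
  also have "\<dots> \<le> ennreal (\<xi> k) * ennreal (Nd * gain_bound)"
    unfolding f2X by (intro mult_left_mono combined_norm_expectation i) auto
  also have "\<dots> = ennreal (\<xi> k * (Nd * gain_bound))"
    using \<xi>[OF k] gain_bound_nonneg by (intro ennreal_mult[symmetric]) auto
  finally show ?thesis unfolding fX .
qed

lemma column_norm:
  assumes i: "i < K"
  shows "integrable M (\<lambda>\<omega>. \<Sum>l<Nr. (cmod (H \<omega> $$ (l, i)))\<^sup>2)"
    and "expectation (\<lambda>\<omega>. \<Sum>l<Nr. (cmod (H \<omega> $$ (l, i)))\<^sup>2) = Nr * \<xi> i"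
    and "integrable M (\<lambda>\<omega>. ((\<Sum>l<Nr. (cmod (H \<omega> $$ (l, i)))\<^sup>2) - Nr * \<xi> i)\<^sup>2)"
    and "expectation (\<lambda>\<omega>. ((\<Sum>l<Nr. (cmod (H \<omega> $$ (l, i)))\<^sup>2) - Nr * \<xi> i)\<^sup>2) \<le> Nr * (3 * (\<xi> i)\<^sup>2)"
proof -
  have eq: "(\<Sum>l<Nr. (cmod (H \<omega> $$ (l, i)))\<^sup>2) = (\<Sum>l<Nr. (cmod (col (H \<omega>) i $ l))\<^sup>2)" if "\<omega> \<in> space M" for \<omega>
    using col_H[OF that _ i] by simp
  note m = complex_normal_moments(2,3)[OF H_col_normal[OF i] \<xi>[OF i]]
  note c = complex_normal_norm_concentration[OF H_col_indep[OF i] finite_lessThan H_col_normal[OF i] \<xi>[OF i], simplified]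
  have "integrable M (\<lambda>\<omega>. \<Sum>l<Nr. (cmod (col (H \<omega>) i $ l))\<^sup>2)" using m by (intro Bochner_Integration.integrable_sum) auto
  then show "integrable M (\<lambda>\<omega>. \<Sum>l<Nr. (cmod (H \<omega> $$ (l, i)))\<^sup>2)"
    by (subst Bochner_Integration.integrable_cong[OF refl eq]) auto
  have "expectation (\<lambda>\<omega>. \<Sum>l<Nr. (cmod (H \<omega> $$ (l, i)))\<^sup>2) = expectation (\<lambda>\<omega>. \<Sum>l<Nr. (cmod (col (H \<omega>) i $ l))\<^sup>2)"
    by (rule Bochner_Integration.integral_cong[OF refl eq])
  also have "\<dots> = Nr * \<xi> i" using m by (subst Bochner_Integration.integral_sum) auto
  finally show "expectation (\<lambda>\<omega>. \<Sum>l<Nr. (cmod (H \<omega> $$ (l, i)))\<^sup>2) = Nr * \<xi> i" .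
  have eq2: "((\<Sum>l<Nr. (cmod (H \<omega> $$ (l, i)))\<^sup>2) - Nr * \<xi> i)\<^sup>2 = ((\<Sum>l<Nr. (cmod (col (H \<omega>) i $ l))\<^sup>2) - Nr * \<xi> i)\<^sup>2"
    if "\<omega> \<in> space M" for \<omega> using eq[OF that] by simp
  show "integrable M (\<lambda>\<omega>. ((\<Sum>l<Nr. (cmod (H \<omega> $$ (l, i)))\<^sup>2) - Nr * \<xi> i)\<^sup>2)"
    using c(1) by (subst Bochner_Integration.integrable_cong[OF refl eq2]) auto
  show "expectation (\<lambda>\<omega>. ((\<Sum>l<Nr. (cmod (H \<omega> $$ (l, i)))\<^sup>2) - Nr * \<xi> i)\<^sup>2) \<le> Nr * (3 * (\<xi> i)\<^sup>2)"
    using c(2) by (subst Bochner_Integration.integral_cong[OF refl eq2]) auto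
qed

definition "colnorm i \<omega> = L2_set (\<lambda>l. cmod (H \<omega> $$ (l, i))) {..<Nr}"

lemma colnorm_square: "(colnorm i \<omega>)\<^sup>2 = (\<Sum>l<Nr. (cmod (H \<omega> $$ (l, i)))\<^sup>2)"
  by (simp add: colnorm_def L2_set_def sum_nonneg)

definition "support_total i \<omega> = (\<Sum>j<Nd. polygon_support b (\<Sum>l<Nr. G \<omega> $$ (j, l) * H \<omega> $$ (l, i)))"

text \<open>The center still contains the random column norm: given \<open>H\<close>, it is the
  conditional mean, and only the fluctuation of \<open>G\<close> is measured. The column norm is
  controlled separately by \<open>column_norm\<close>.\<close>

lemma support_total_expectation:
  assumes i: "i < K"
  shows "(\<integral>\<^sup>+\<omega>. ennreal ((support_total i \<omega> - Nd * (mean_amp * colnorm i \<omega>))\<^sup>2) \<partial>M) \<le> ennreal (Nd * (\<eta> * (Nr * \<xi> i)))"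
proof -
  define f where "f z = ennreal (((\<Sum>j<Nd. polygon_support b (\<Sum>l<Nr. snd z (j, l) * fst z (l, i)))
    - Nd * (mean_amp * L2_set (\<lambda>l. cmod (fst z (l, i))) {..<Nr}))\<^sup>2)" for z
  have f: "f \<in> borel_measurable (SH \<Otimes>\<^sub>M SG)" unfolding f_def L2_set_def
    by (intro measurable_compose[OF _ measurable_ennreal] borel_measurable_sum borel_measurable_power borel_measurable_diff
        borel_measurable_cmod borel_measurable_times measurable_compose[OF _ borel_measurable_polygon_support]
        borel_measurable_const borel_measurable_sqrt_comp pair_comp_meas i) auto
  have fX: "f (XH \<omega>', XG \<omega>) = ennreal (((\<Sum>j<Nd. polygon_support b (\<Sum>l<Nr. G \<omega> $$ (j, l) * H \<omega>' $$ (l, i)))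
    - Nd * (mean_amp * L2_set (\<lambda>l. cmod (H \<omega>' $$ (l, i))) {..<Nr}))\<^sup>2)" for \<omega> \<omega>'
    unfolding f_def fst_conv snd_conv L2_set_def using i by simp
  have "(\<integral>\<^sup>+\<omega>. f (XH \<omega>', XG \<omega>) \<partial>M) \<le> ennreal (Nd * (\<eta> * (\<Sum>l<Nr. (cmod (H \<omega>' $$ (l, i)))\<^sup>2)))" for \<omega>'
    unfolding fX mean_amp_def by (rule gaussian_rows_support[OF G_entries_indep G_normal \<eta> b])
  then have "(\<integral>\<^sup>+\<omega>. f (XH \<omega>, XG \<omega>) \<partial>M) \<le> (\<integral>\<^sup>+\<omega>'. ennreal (Nd * (\<eta> * (\<Sum>l<Nr. (cmod (H \<omega>' $$ (l, i)))\<^sup>2))) \<partial>M)"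
    unfolding decouple(1)[OF f] by (intro nn_integral_mono)
  also have "\<dots> = ennreal (Nd * (\<eta> * (Nr * \<xi> i)))"
    using column_norm(1,2)[OF i] \<eta> by (subst nn_integral_eq_integral) (auto intro!: mult_nonneg_nonneg sum_nonneg)
  finally show ?thesis unfolding fX support_total_def colnorm_def .
qed

end

subsection \<open>The ergodic rate\<close>

text \<open>As a function of 1 / (1 + x) the left side is the tangent at \<open>x = g\<close> to the
  convex function \<open>ln (1 + x)\<close>. Hence the mean of an upper bound for 1 / (1 + x) is all
  that the rate requires.\<close>

lemma ln_tangent_lower:
  fixes x g :: real
  assumes "0 \<le> x" "0 < g"
  shows "ln (1 + g) + 1 - (1 + g) * (1 / (1 + x)) \<le> ln (1 + x)"
proof -
  have "ln ((1 + g) / (1 + x)) \<le> (1 + g) / (1 + x) - 1"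
    using assms by (intro ln_le_minus_one) auto
  moreover have "ln ((1 + g) / (1 + x)) = ln (1 + g) - ln (1 + x)"
    using assms by (intro ln_divide_pos) auto
  ultimately show ?thesis by simp
qed

lemma integral_divide_le:
  fixes C Q :: real
  shows "integral\<^sup>L M f \<le> C \<Longrightarrow> 0 \<le> Q \<Longrightarrow> (\<integral>\<omega>. f \<omega> / Q \<partial>M) \<le> C / Q"
  by (simp add: divide_right_mono)

lemma less_of_square_diff_less: "(x - y)\<^sup>2 < t\<^sup>2 \<Longrightarrow> 0 < t \<Longrightarrow> y - t < x" for x y t :: real
  using abs_le_square_iff[of t "x - y"] by linarith

context gaussian_relay
begin

definition "cross i j \<omega> = (\<Sum>l<Nr. combined (gent \<omega>) (hcol i \<omega>) l * H \<omega> $$ (l, j))"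
definition "gain i \<omega> = (\<Sum>l<Nr. (cmod (combined (gent \<omega>) (hcol i \<omega>) l))\<^sup>2) / Nd"

lemma gain_expectation:
  assumes i: "i < K"
  shows "integrable M (gain i)" "expectation (gain i) \<le> gain_bound"
proof -
  define f where "f \<omega> = (\<Sum>l<Nr. (cmod (combined (gent \<omega>) (hcol i \<omega>) l))\<^sup>2)" for \<omega>
  have m: "f \<in> borel_measurable M" unfolding f_def
    by (intro borel_measurable_sum borel_measurable_power borel_measurable_cmod combined_measurable G_meas H_meas i) auto
  have nn: "0 \<le> f \<omega>" for \<omega> by (simp add: f_def sum_nonneg)
  have C: "0 \<le> Nd * gain_bound" using gain_bound_nonneg by simp
  note * = integrable_nn_integral_le[OF m nn combined_norm_expectation[OF i, folded f_def] C]
  have g: "gain i = (\<lambda>\<omega>. f \<omega> / Nd)" by (auto simp: gain_def f_def)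
  show "integrable M (gain i)" unfolding g using *(1) by simp
  show "expectation (gain i) \<le> gain_bound" unfolding g using *(2) Nd by (simp add: field_simps)
qed

lemma cross_expectation:
  assumes i: "i < K" and j: "j < K" and ij: "i \<noteq> j"
  shows "integrable M (\<lambda>\<omega>. (cmod (cross i j \<omega>))\<^sup>2)" "expectation (\<lambda>\<omega>. (cmod (cross i j \<omega>))\<^sup>2) \<le> \<xi> j * (Nd * gain_bound)"
proof -
  have m: "(\<lambda>\<omega>. (cmod (cross i j \<omega>))\<^sup>2) \<in> borel_measurable M" unfolding cross_def
    by (intro borel_measurable_sum borel_measurable_power borel_measurable_cmod borel_measurable_times combined_measurable G_meas H_meas i j) auto
  have C: "0 \<le> \<xi> j * (Nd * gain_bound)" using gain_bound_nonneg \<xi>[OF j] by simp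
  show "integrable M (\<lambda>\<omega>. (cmod (cross i j \<omega>))\<^sup>2)" "expectation (\<lambda>\<omega>. (cmod (cross i j \<omega>))\<^sup>2) \<le> \<xi> j * (Nd * gain_bound)"
    using integrable_nn_integral_le[OF m zero_le_power2 cross_term_expectation[OF i j ij, folded cross_def] C] by auto
qed

lemma support_total_deviation:
  assumes i: "i < K"
  shows "integrable M (\<lambda>\<omega>. (support_total i \<omega> - Nd * (mean_amp * colnorm i \<omega>))\<^sup>2)"
    and "expectation (\<lambda>\<omega>. (support_total i \<omega> - Nd * (mean_amp * colnorm i \<omega>))\<^sup>2) \<le> Nd * (\<eta> * (Nr * \<xi> i))"
proof -
  have m: "(\<lambda>\<omega>. (support_total i \<omega> - Nd * (mean_amp * colnorm i \<omega>))\<^sup>2) \<in> borel_measurable M"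
    unfolding support_total_def colnorm_def L2_set_def
    by (intro borel_measurable_sum borel_measurable_power borel_measurable_diff borel_measurable_cmod borel_measurable_times
        borel_measurable_const borel_measurable_sqrt_comp measurable_compose[OF _ borel_measurable_polygon_support] G_meas H_meas i) auto
  have C: "0 \<le> Nd * (\<eta> * (Nr * \<xi> i))" using \<eta> \<xi>[OF i] by simp
  show "integrable M (\<lambda>\<omega>. (support_total i \<omega> - Nd * (mean_amp * colnorm i \<omega>))\<^sup>2)"
    "expectation (\<lambda>\<omega>. (support_total i \<omega> - Nd * (mean_amp * colnorm i \<omega>))\<^sup>2) \<le> Nd * (\<eta> * (Nr * \<xi> i))"
    using integrable_nn_integral_le[OF m zero_le_power2 support_total_expectation[OF i] C] by auto
qed

lemma ln_sinr_integrable: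
  assumes k: "k < K" and P: "0 < Pu" "0 < Pr" and s: "0 < \<sigma>d"
  shows "integrable M (\<lambda>\<omega>. ln (1 + sinr b Pu Pr \<sigma>r \<sigma>d (G \<omega>) (H \<omega>) k))"
proof -
  have G: "measurable_mat M Nd Nr G" and H: "measurable_mat M Nr K H"
    using G_carrier H_carrier G_meas H_meas by (auto simp: measurable_mat_def)
  have [measurable]: "(\<lambda>\<omega>. sinr b Pu Pr \<sigma>r \<sigma>d (G \<omega>) (H \<omega>) k) \<in> borel_measurable M"
    using P by (intro measurable_sinr[OF G H b Nd k]) auto
  note g = complex_normal_moments(2)[OF G_normal \<eta>]
  have int: "integrable M (\<lambda>\<omega>. Pr / \<sigma>d\<^sup>2 * (\<Sum>j<Nd. \<Sum>l<Nr. (cmod (G \<omega> $$ (j, l)))\<^sup>2))"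
    by (intro Bochner_Integration.integrable_mult_right Bochner_Integration.integrable_sum g) auto
  show ?thesis
  proof (rule Bochner_Integration.integrable_bound[OF int])
    show "AE \<omega> in M. norm (ln (1 + sinr b Pu Pr \<sigma>r \<sigma>d (G \<omega>) (H \<omega>) k))
        \<le> norm (Pr / \<sigma>d\<^sup>2 * (\<Sum>j<Nd. \<Sum>l<Nr. (cmod (G \<omega> $$ (j, l)))\<^sup>2))"
    proof (rule AE_I2)
      fix \<omega> assume \<omega>: "\<omega> \<in> space M"
      define x where "x = sinr b Pu Pr \<sigma>r \<sigma>d (G \<omega>) (H \<omega>) k"
      have x: "0 \<le> x" "x \<le> Pr / \<sigma>d\<^sup>2 * (\<Sum>j<Nd. \<Sum>l<Nr. (cmod (G \<omega> $$ (j, l)))\<^sup>2)"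
        using relay_mats.sinr_bounds(1,3)[OF mats[OF \<omega>] k P s] by (auto simp: x_def)
      have "0 \<le> ln (1 + x)" "ln (1 + x) \<le> x" using x(1) ln_add_one_self_le_self[of x] by auto
      then show "norm (ln (1 + x)) \<le> norm (Pr / \<sigma>d\<^sup>2 * (\<Sum>j<Nd. \<Sum>l<Nr. (cmod (G \<omega> $$ (j, l)))\<^sup>2))"
        using x unfolding real_norm_def by linarith
    qed
  qed measurable
qed

lemma noise_gain_expectation:
  fixes Pu Pr \<sigma>r :: real
  assumes "0 < Pr"
  shows "integrable M (\<lambda>\<omega>. (Pu * (\<Sum>i<K. \<Sum>l<Nr. (cmod (H \<omega> $$ (l, i)))\<^sup>2) + \<sigma>r\<^sup>2 * Nr) / Pr)"
    and "expectation (\<lambda>\<omega>. (Pu * (\<Sum>i<K. \<Sum>l<Nr. (cmod (H \<omega> $$ (l, i)))\<^sup>2) + \<sigma>r\<^sup>2 * Nr) / Pr)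
      = Nr * (Pu * (\<Sum>i<K. \<xi> i) + \<sigma>r\<^sup>2) / Pr"
proof -
  have I: "integrable M (\<lambda>\<omega>. \<Sum>i<K. \<Sum>l<Nr. (cmod (H \<omega> $$ (l, i)))\<^sup>2)"
    by (intro Bochner_Integration.integrable_sum[of "{..<K}"] column_norm) auto
  then show "integrable M (\<lambda>\<omega>. (Pu * (\<Sum>i<K. \<Sum>l<Nr. (cmod (H \<omega> $$ (l, i)))\<^sup>2) + \<sigma>r\<^sup>2 * Nr) / Pr)" by simp
  have "expectation (\<lambda>\<omega>. \<Sum>i<K. \<Sum>l<Nr. (cmod (H \<omega> $$ (l, i)))\<^sup>2) = (\<Sum>i<K. Nr * \<xi> i)"
    by (subst Bochner_Integration.integral_sum) (use column_norm(1,2) in auto)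
  then show "expectation (\<lambda>\<omega>. (Pu * (\<Sum>i<K. \<Sum>l<Nr. (cmod (H \<omega> $$ (l, i)))\<^sup>2) + \<sigma>r\<^sup>2 * Nr) / Pr)
      = Nr * (Pu * (\<Sum>i<K. \<xi> i) + \<sigma>r\<^sup>2) / Pr"
    using I by (simp add: prob_space sum_distrib_left[symmetric] algebra_simps)
qed

section \<open>Distance of the effective channel from a diagonal one\<close>

text \<open>The three sums measure, relative to the tolerance \<open>e\<close>, how far the effective channel is from
  being diagonal with the expected entries; below 1 it is diagonally dominant.\<close>

definition deviation :: "real \<Rightarrow> real \<Rightarrow> 'a \<Rightarrow> real" where
  "deviation e \<rho> \<omega> =
    (\<Sum>i<K. \<Sum>j<K. if i = j then 0 else (cmod (cross i j \<omega>))\<^sup>2 / (Nd * (e * ((1 - e) * mean_amp * \<rho> * sqrt (Nd * Nr)))\<^sup>2))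
  + (\<Sum>i<K. (support_total i \<omega> - Nd * (mean_amp * colnorm i \<omega>))\<^sup>2 / (Nd * (e / 2 * (mean_amp * sqrt (\<xi> i) * sqrt (Nd * Nr)))\<^sup>2))
  + (\<Sum>i<K. ((\<Sum>l<Nr. (cmod (H \<omega> $$ (l, i)))\<^sup>2) - Nr * \<xi> i)\<^sup>2 / (e / 2 * (Nr * \<xi> i))\<^sup>2)"

text \<open>Since \<open>gain_bound\<close> is of order \<open>Nr\<close>, all three sums are of
  order 1 / Nd for a fixed ratio. The 4 comes from the tolerance \<open>e / 2\<close>, and 12 is 4
  times the 3 of the fourth moment bound.\<close>

definition deviation_bound :: "real \<Rightarrow> real \<Rightarrow> real" where
  "deviation_bound e \<rho> =
    (\<Sum>i<K. \<Sum>j<K. \<xi> j * gain_bound / ((e * (1 - e) * mean_amp * \<rho>)\<^sup>2 * (Nd * Nr)))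
  + (\<Sum>i<K. 4 * \<eta> / (e\<^sup>2 * mean_amp\<^sup>2 * Nd)) + (\<Sum>i<K. 12 / (e\<^sup>2 * Nr))"

lemma deviation_expectation:
  assumes e: "0 < e" "e < 1" and \<rho>: "0 < \<rho>"
  shows "integrable M (deviation e \<rho>)" "expectation (deviation e \<rho>) \<le> deviation_bound e \<rho>"
proof -
  note pos = mean_amp_pos Nd Nr
  define c0 where "c0 = Nd * (e * ((1 - e) * mean_amp * \<rho> * sqrt (Nd * Nr)))\<^sup>2"
  define d1 where "d1 i j \<omega> = (if i = j then 0 else (cmod (cross i j \<omega>))\<^sup>2 / c0)" for i j \<omega>
  define d2 where "d2 i \<omega> = (support_total i \<omega> - Nd * (mean_amp * colnorm i \<omega>))\<^sup>2 / (Nd * (e / 2 * (mean_amp * sqrt (\<xi> i) * sqrt (Nd * Nr)))\<^sup>2)" for i \<omega>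
  define d3 where "d3 i \<omega> = ((\<Sum>l<Nr. (cmod (H \<omega> $$ (l, i)))\<^sup>2) - Nr * \<xi> i)\<^sup>2 / (e / 2 * (Nr * \<xi> i))\<^sup>2" for i \<omega>
  have eq: "deviation e \<rho> = (\<lambda>\<omega>. (\<Sum>i<K. \<Sum>j<K. d1 i j \<omega>) + (\<Sum>i<K. d2 i \<omega>) + (\<Sum>i<K. d3 i \<omega>))"
    unfolding deviation_def d1_def d2_def d3_def c0_def ..
  have D1: "integrable M (d1 i j)" "expectation (d1 i j) \<le> \<xi> j * gain_bound / ((e * (1 - e) * mean_amp * \<rho>)\<^sup>2 * (Nd * Nr))"
    if "i < K" "j < K" for i j
  proof -
    have "integrable M (d1 i j) \<and> expectation (d1 i j) \<le> \<xi> j * gain_bound / ((e * (1 - e) * mean_amp * \<rho>)\<^sup>2 * (Nd * Nr))"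
    proof (cases "i = j")
      case True
      then have "d1 i j = (\<lambda>_. 0)" by (auto simp: d1_def)
      then show ?thesis using \<xi>[OF that(2)] gain_bound_nonneg by simp
    next
      case False
      then have d: "d1 i j = (\<lambda>\<omega>. (cmod (cross i j \<omega>))\<^sup>2 / c0)" by (auto simp: d1_def)
      note c = cross_expectation[OF that False]
      have c0: "0 < c0" unfolding c0_def using pos e \<rho> by simp
      have "expectation (d1 i j) \<le> \<xi> j * (Nd * gain_bound) / c0"
        unfolding d using c0 by (intro integral_divide_le[OF c(2)]) simp
      also have "\<dots> = \<xi> j * gain_bound / ((e * (1 - e) * mean_amp * \<rho>)\<^sup>2 * (Nd * Nr))"
      proof -
        have "c0 = Nd * ((e * (1 - e) * mean_amp * \<rho>)\<^sup>2 * (Nd * Nr))"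
          unfolding c0_def by (simp add: power_mult_distrib mult_ac)
        then show ?thesis using pos by simp
      qed
      finally show ?thesis unfolding d using c(1) by simp
    qed
    then show "integrable M (d1 i j)" "expectation (d1 i j) \<le> \<xi> j * gain_bound / ((e * (1 - e) * mean_amp * \<rho>)\<^sup>2 * (Nd * Nr))"
      by auto
  qed
  have D2: "integrable M (d2 i)" "expectation (d2 i) \<le> 4 * \<eta> / (e\<^sup>2 * mean_amp\<^sup>2 * Nd)" if i: "i < K" for i
  proof -
    note s = support_total_deviation[OF i]
    show "integrable M (d2 i)" unfolding d2_def using s(1) by simp
    have "expectation (d2 i) \<le> Nd * (\<eta> * (Nr * \<xi> i)) / (Nd * (e / 2 * (mean_amp * sqrt (\<xi> i) * sqrt (Nd * Nr)))\<^sup>2)"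
      unfolding d2_def by (rule integral_divide_le[OF s(2)]) simp
    also have "\<dots> = 4 * \<eta> / (e\<^sup>2 * mean_amp\<^sup>2 * Nd)"
      using pos e \<xi>[OF i] by (simp add: power_mult_distrib power_divide field_simps)
    finally show "expectation (d2 i) \<le> 4 * \<eta> / (e\<^sup>2 * mean_amp\<^sup>2 * Nd)" .
  qed
  have D3: "integrable M (d3 i)" "expectation (d3 i) \<le> 12 / (e\<^sup>2 * Nr)" if i: "i < K" for i
  proof -
    note s = column_norm(3,4)[OF i]
    show "integrable M (d3 i)" unfolding d3_def using s(1) by simp
    have "expectation (d3 i) \<le> Nr * (3 * (\<xi> i)\<^sup>2) / (e / 2 * (Nr * \<xi> i))\<^sup>2"
      unfolding d3_def by (rule integral_divide_le[OF s(2)]) simp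
    also have "\<dots> = 12 / (e\<^sup>2 * Nr)"
      using pos e \<xi>[OF i] by (simp add: power2_eq_square field_simps)
    finally show "expectation (d3 i) \<le> 12 / (e\<^sup>2 * Nr)" .
  qed
  have I: "integrable M (\<lambda>\<omega>. \<Sum>i<K. \<Sum>j<K. d1 i j \<omega>)" "integrable M (\<lambda>\<omega>. \<Sum>i<K. d2 i \<omega>)" "integrable M (\<lambda>\<omega>. \<Sum>i<K. d3 i \<omega>)"
    by (intro Bochner_Integration.integrable_sum D1 D2 D3; simp)+
  show "integrable M (deviation e \<rho>)" unfolding eq using I by simp
  have "expectation (deviation e \<rho>) = (\<Sum>i<K. \<Sum>j<K. expectation (d1 i j)) + (\<Sum>i<K. expectation (d2 i)) + (\<Sum>i<K. expectation (d3 i))"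
  proof -
    have "expectation (\<lambda>\<omega>. \<Sum>i<K. \<Sum>j<K. d1 i j \<omega>) = (\<Sum>i<K. expectation (\<lambda>\<omega>. \<Sum>j<K. d1 i j \<omega>))"
      by (rule Bochner_Integration.integral_sum) (intro Bochner_Integration.integrable_sum D1; simp)
    also have "\<dots> = (\<Sum>i<K. \<Sum>j<K. expectation (d1 i j))"
      by (intro sum.cong refl Bochner_Integration.integral_sum D1) auto
    finally show ?thesis unfolding eq using I D2(1) D3(1) by simp
  qed
  also have "\<dots> \<le> deviation_bound e \<rho>" unfolding deviation_bound_def
    by (intro add_mono sum_mono D1 D2 D3) auto
  finally show "expectation (deviation e \<rho>) \<le> deviation_bound e \<rho>" .
qed

text \<open>Chebyshev in pointwise form: the summands of \<open>deviation\<close> are nonnegative,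
  so each of them is below 1. The tolerance on the diagonal is spent in two halves, one for
  \<open>support_total\<close> around its conditional mean and one for the column norm.\<close>

lemma deviation_small:
  assumes \<omega>: "\<omega> \<in> space M" and e: "0 < e" "e < 1" and \<rho>: "0 < \<rho>" and dev: "deviation e \<rho> \<omega> < 1"
  defines "B \<equiv> relay_mats.B b (G \<omega>) (H \<omega>)"
  shows "\<And>i. i < K \<Longrightarrow> (1 - e) * mean_amp * sqrt (\<xi> i) * sqrt (Nd * Nr) \<le> cmod (B $$ (i, i))"
    and "\<And>i j. i < K \<Longrightarrow> j < K \<Longrightarrow> i \<noteq> j \<Longrightarrow> cmod (B $$ (i, j)) \<le> e * ((1 - e) * mean_amp * \<rho> * sqrt (Nd * Nr))"
proof -
  note pos = mean_amp_pos Nd Nr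
  interpret R: relay_mats b "G \<omega>" "H \<omega>" Nd Nr K by (rule mats[OF \<omega>])
  define c0 where "c0 = e * ((1 - e) * mean_amp * \<rho> * sqrt (Nd * Nr))"
  define d1 where "d1 i j = (if i = j then 0 else (cmod (cross i j \<omega>))\<^sup>2 / (Nd * c0\<^sup>2))" for i j
  define d2 where "d2 i = (support_total i \<omega> - Nd * (mean_amp * colnorm i \<omega>))\<^sup>2 / (Nd * (e / 2 * (mean_amp * sqrt (\<xi> i) * sqrt (Nd * Nr)))\<^sup>2)" for i
  define d3 where "d3 i = ((\<Sum>l<Nr. (cmod (H \<omega> $$ (l, i)))\<^sup>2) - Nr * \<xi> i)\<^sup>2 / (e / 2 * (Nr * \<xi> i))\<^sup>2" for i
  have c0: "0 < c0" unfolding c0_def using pos e \<rho> by simp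
  have nn: "0 \<le> d1 i j" "0 \<le> d2 i" "0 \<le> d3 i" for i j
    by (auto simp: d1_def d2_def d3_def)
  have tot: "(\<Sum>i<K. \<Sum>j<K. d1 i j) + (\<Sum>i<K. d2 i) + (\<Sum>i<K. d3 i) < 1"
    using dev unfolding deviation_def d1_def d2_def d3_def c0_def .
  have nn': "0 \<le> (\<Sum>i<K. \<Sum>j<K. d1 i j)" "0 \<le> (\<Sum>i<K. d2 i)" "0 \<le> (\<Sum>i<K. d3 i)" by (intro sum_nonneg nn)+
  have l1: "d1 i j < 1" if "i < K" "j < K" for i j
  proof -
    have "d1 i j \<le> (\<Sum>j<K. d1 i j)" using that nn by (intro member_le_sum) auto
    also have "\<dots> \<le> (\<Sum>i<K. \<Sum>j<K. d1 i j)"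
      using that nn by (intro member_le_sum[where f="\<lambda>i. \<Sum>j<K. d1 i j"]) (auto intro: sum_nonneg)
    finally show ?thesis using tot nn' by linarith
  qed
  have l2: "d2 i < 1" if "i < K" for i
  proof -
    have "d2 i \<le> (\<Sum>i<K. d2 i)" using that nn by (intro member_le_sum) auto
    then show ?thesis using tot nn' by linarith
  qed
  have l3: "d3 i < 1" if "i < K" for i
  proof -
    have "d3 i \<le> (\<Sum>i<K. d3 i)" using that nn by (intro member_le_sum) auto
    then show ?thesis using tot nn' by linarith
  qed
  have sN: "0 < sqrt Nd" "sqrt Nd * sqrt Nd = Nd" using Nd by simp_all
  show "cmod (B $$ (i, j)) \<le> e * ((1 - e) * mean_amp * \<rho> * sqrt (Nd * Nr))" if ij: "i < K" "j < K" "i \<noteq> j" for i j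
  proof -
    have "B $$ (i, j) = (\<Sum>l<Nr. complex_of_real (1 / sqrt Nd) * combined (gent \<omega>) (hcol i \<omega>) l * H \<omega> $$ (l, j))"
      unfolding B_def R.B_index[OF ij(1,2)] combined_def using R.WaG_index[OF ij(1)] by simp
    also have "\<dots> = complex_of_real (1 / sqrt Nd) * cross i j \<omega>"
      unfolding cross_def sum_distrib_left by (simp add: mult.assoc)
    finally have B: "cmod (B $$ (i, j)) = cmod (cross i j \<omega>) / sqrt Nd"
      using sN by (simp add: norm_divide)
    have "(cmod (cross i j \<omega>))\<^sup>2 / (Nd * c0\<^sup>2) < 1" using l1[OF ij(1,2)] ij(3) by (simp add: d1_def)
    then have "(cmod (cross i j \<omega>))\<^sup>2 / Nd < c0\<^sup>2" using c0 Nd by (simp add: field_simps)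
    also have "(cmod (cross i j \<omega>))\<^sup>2 / Nd = (cmod (B $$ (i, j)))\<^sup>2"
      unfolding B power_divide by simp
    finally have "cmod (B $$ (i, j)) < c0" by (rule power2_less_imp_less) (use c0 in simp)
    then show ?thesis unfolding c0_def by (rule less_imp_le)
  qed
  show "(1 - e) * mean_amp * sqrt (\<xi> i) * sqrt (Nd * Nr) \<le> cmod (B $$ (i, i))" if i: "i < K" for i
  proof -
    define T where "T = mean_amp * sqrt (\<xi> i) * sqrt (Nd * Nr)"
    have x: "0 < \<xi> i" by (rule \<xi>[OF i])
    have T: "0 < T" unfolding T_def using pos x by simp
    have reB: "Re (B $$ (i, i)) = support_total i \<omega> / sqrt Nd"
      unfolding B_def R.B_diag[OF i] support_total_def ..
    have "(support_total i \<omega> - Nd * (mean_amp * colnorm i \<omega>))\<^sup>2 / (Nd * (e / 2 * T)\<^sup>2) < 1"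
      using l2[OF i] by (simp add: d2_def T_def)
    then have "(support_total i \<omega> - Nd * (mean_amp * colnorm i \<omega>))\<^sup>2 / Nd < (e / 2 * T)\<^sup>2"
      using T e Nd by (simp add: field_simps)
    moreover have "(support_total i \<omega> - Nd * (mean_amp * colnorm i \<omega>))\<^sup>2 / Nd
        = (support_total i \<omega> / sqrt Nd - sqrt Nd * (mean_amp * colnorm i \<omega>))\<^sup>2"
    proof -
      have "support_total i \<omega> / sqrt Nd - sqrt Nd * (mean_amp * colnorm i \<omega>)
          = (support_total i \<omega> - Nd * (mean_amp * colnorm i \<omega>)) / sqrt Nd"
        using sN by (simp add: field_simps)
      then show ?thesis by (simp add: power_divide)
    qed
    ultimately have "(support_total i \<omega> / sqrt Nd - sqrt Nd * (mean_amp * colnorm i \<omega>))\<^sup>2 < (e / 2 * T)\<^sup>2" by simp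
    then have a: "sqrt Nd * (mean_amp * colnorm i \<omega>) - e / 2 * T < Re (B $$ (i, i))"
      unfolding reB by (rule less_of_square_diff_less) (use T e in simp)
    have "((colnorm i \<omega>)\<^sup>2 - Nr * \<xi> i)\<^sup>2 < (e / 2 * (Nr * \<xi> i))\<^sup>2"
      using l3[OF i] e x Nr unfolding d3_def colnorm_square by (simp add: field_simps)
    then have "Nr * \<xi> i - e / 2 * (Nr * \<xi> i) < (colnorm i \<omega>)\<^sup>2"
      by (rule less_of_square_diff_less) (use e x Nr in simp)
    then have "(1 - e / 2) * (Nr * \<xi> i) \<le> (colnorm i \<omega>)\<^sup>2" by (simp add: left_diff_distrib)
    \<comment> \<open>Concentration is known for the squared norm, while the norm itself is needed.
      Taking the root costs nothing, because \<open>1 - e / 2\<close> lies between 0 and 1.\<close>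
    moreover have "((1 - e / 2) * sqrt (Nr * \<xi> i))\<^sup>2 \<le> (1 - e / 2) * (Nr * \<xi> i)"
    proof -
      have "(1 - e / 2)\<^sup>2 \<le> (1 - e / 2) * 1" unfolding power2_eq_square using e by (intro mult_left_mono) auto
      then have "(1 - e / 2)\<^sup>2 * (Nr * \<xi> i) \<le> (1 - e / 2) * 1 * (Nr * \<xi> i)" using x by (intro mult_right_mono) auto
      then show ?thesis using x by (simp add: power_mult_distrib)
    qed
    ultimately have "((1 - e / 2) * sqrt (Nr * \<xi> i))\<^sup>2 \<le> (colnorm i \<omega>)\<^sup>2" by linarith
    then have "(1 - e / 2) * sqrt (Nr * \<xi> i) \<le> colnorm i \<omega>"
      by (rule power2_le_imp_le) (simp add: colnorm_def L2_set_nonneg)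
    then have "sqrt Nd * (mean_amp * ((1 - e / 2) * sqrt (Nr * \<xi> i))) \<le> sqrt Nd * (mean_amp * colnorm i \<omega>)"
      using pos by (intro mult_left_mono) auto
    moreover have "sqrt Nd * (mean_amp * ((1 - e / 2) * sqrt (Nr * \<xi> i))) = (1 - e / 2) * T"
      unfolding T_def by (simp add: real_sqrt_mult mult_ac)
    ultimately have "(1 - e / 2) * T - e / 2 * T < Re (B $$ (i, i))" using a by linarith
    then have "(1 - e) * T \<le> Re (B $$ (i, i))" by (simp add: algebra_simps)
    also have "\<dots> \<le> cmod (B $$ (i, i))" by (rule complex_Re_le_cmod)
    finally show ?thesis by (simp add: T_def mult_ac)
  qed
qed

text \<open>An upper bound for the mean denominator of the SINR if the zero-forcing row were a unit
  vector. Dividing the nominal signal power by it gives the \<open>g\<close> of the next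
  lemma.\<close>

definition noise_total :: "real \<Rightarrow> real \<Rightarrow> real \<Rightarrow> real \<Rightarrow> real" where
  "noise_total Pu Pr \<sigma>r \<sigma>d = \<sigma>r\<^sup>2 * gain_bound + \<sigma>d\<^sup>2 * (Nr * (Pu * (\<Sum>i<K. \<xi> i) + \<sigma>r\<^sup>2) / Pr)"

text \<open>No indicator functions are used: the factor
  \<open>1 - deviation e \<rho> \<omega>\<close> is at most 1 everywhere and nonpositive where the
  channel fails to be dominant, which makes the pointwise lower bound negative or 0 there. Averaging
  then involves only the means of \<open>deviation\<close> and of \<open>Z\<close>.\<close>

lemma ergodic_ln_lower:
  assumes k: "k < K" and P: "0 < Pu" "0 < Pr" and s: "0 < \<sigma>d" "0 < \<sigma>r"
    and e: "0 < e" "e < 1" "real K * e \<le> 1 / 2" and \<rho>: "0 < \<rho>" "\<And>i. i < K \<Longrightarrow> \<rho> \<le> sqrt (\<xi> i)"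
    and g: "g = Pu * mean_amp\<^sup>2 * \<xi> k * (Nd * Nr) / noise_total Pu Pr \<sigma>r \<sigma>d"
  shows "(1 - deviation_bound e \<rho>) * (ln (1 + g) + 1)
      - (1 + 1 / g) * ((\<Sum>i<K. ((if i = k then 1 else 0) + 2 * e) * (sqrt (\<xi> k) / sqrt (\<xi> i))) / (1 - e))\<^sup>2
    \<le> expectation (\<lambda>\<omega>. ln (1 + sinr b Pu Pr \<sigma>r \<sigma>d (G \<omega>) (H \<omega>) k))"
proof -
  note pos = mean_amp_pos Nd Nr
  define S where "S = sqrt (Nd * Nr)"
  define \<beta> where "\<beta> i = (1 - e) * mean_amp * sqrt (\<xi> i) * S" for i
  define \<beta>0 where "\<beta>0 = (1 - e) * mean_amp * \<rho> * S"
  define c where "c i = ((if i = k then 1 else 0) + 2 * e) / \<beta> i" for i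
  define V where "V = (\<Sum>i<K. c i)"
  define q where "q = (\<Sum>i<K. ((if i = k then 1 else 0) + 2 * e) * (sqrt (\<xi> k) / sqrt (\<xi> i))) / (1 - e)"
  define ng where "ng \<omega> = (Pu * (\<Sum>i<K. \<Sum>l<Nr. (cmod (H \<omega> $$ (l, i)))\<^sup>2) + \<sigma>r\<^sup>2 * Nr) / Pr" for \<omega>
  \<comment> \<open>The bound of \<open>inverse_sinr_le\<close> as a random variable. Its weights
    are deterministic, so it makes sense and is nonnegative also where the channel is not dominant,
    and its mean needs no conditioning.\<close>
  define Z where "Z \<omega> = (\<sigma>r\<^sup>2 * (V * (\<Sum>i<K. c i * gain i \<omega>)) + \<sigma>d\<^sup>2 * ng \<omega> * V\<^sup>2) / Pu" for \<omega>
  have S: "0 < S" "S\<^sup>2 = Nd * Nr" using Nd Nr by (simp_all add: S_def)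
  have \<beta>0: "0 < \<beta>0" unfolding \<beta>0_def using pos e \<rho> S by simp
  have \<beta>le: "\<beta>0 \<le> \<beta> i" if "i < K" for i
    unfolding \<beta>_def \<beta>0_def using \<rho>(2)[OF that] pos e S by (intro mult_right_mono mult_left_mono) auto
  have cn: "0 \<le> c i" if "i < K" for i using \<beta>0 \<beta>le[OF that] e by (auto simp: c_def)
  have Vn: "0 \<le> V" unfolding V_def by (intro sum_nonneg) (use cn in auto)
  have gn: "0 \<le> gain i \<omega>" for i \<omega> by (simp add: gain_def sum_nonneg)
  have nt: "0 < noise_total Pu Pr \<sigma>r \<sigma>d"
  proof -
    have "0 \<le> \<sigma>d\<^sup>2 * (Nr * (Pu * (\<Sum>i<K. \<xi> i) + \<sigma>r\<^sup>2) / Pr)"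
      using P by (intro mult_nonneg_nonneg divide_nonneg_pos add_nonneg_nonneg sum_nonneg) (auto intro: less_imp_le \<xi>)
    moreover have "0 < \<sigma>r\<^sup>2 * gain_bound"
      unfolding gain_bound_def using s pos \<eta> by (intro mult_pos_pos add_pos_nonneg) auto
    ultimately show ?thesis by (simp add: noise_total_def)
  qed
  have g0: "0 < g" unfolding g using nt P pos \<xi>[OF k] by simp
  have Zn: "0 \<le> Z \<omega>" for \<omega> unfolding Z_def ng_def using P Vn cn gn
    by (intro divide_nonneg_pos add_nonneg_nonneg mult_nonneg_nonneg sum_nonneg) auto
  have EZ: "integrable M Z" "expectation Z \<le> q\<^sup>2 / g"
  proof -
    note n = noise_gain_expectation[OF P(2), of Pu \<sigma>r, folded ng_def]
    have I: "integrable M (\<lambda>\<omega>. \<Sum>i<K. c i * gain i \<omega>)"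
      by (intro Bochner_Integration.integrable_sum Bochner_Integration.integrable_mult_right gain_expectation) auto
    show "integrable M Z" unfolding Z_def using I n(1) by simp
    have "expectation (\<lambda>\<omega>. \<Sum>i<K. c i * gain i \<omega>) = (\<Sum>i<K. c i * expectation (gain i))"
      using gain_expectation(1) by (subst Bochner_Integration.integral_sum) auto
    also have "\<dots> \<le> (\<Sum>i<K. c i * gain_bound)"
      using gain_expectation(2) cn by (intro sum_mono mult_left_mono) auto
    also have "\<dots> = V * gain_bound" by (simp add: V_def sum_distrib_right)
    finally have gsum: "expectation (\<lambda>\<omega>. \<Sum>i<K. c i * gain i \<omega>) \<le> V * gain_bound" .
    have "expectation Z = (\<sigma>r\<^sup>2 * (V * expectation (\<lambda>\<omega>. \<Sum>i<K. c i * gain i \<omega>)) + \<sigma>d\<^sup>2 * expectation ng * V\<^sup>2) / Pu"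
      unfolding Z_def using I n(1) by simp
    also have "\<dots> \<le> (\<sigma>r\<^sup>2 * (V * (V * gain_bound)) + \<sigma>d\<^sup>2 * expectation ng * V\<^sup>2) / Pu"
      using gsum Vn P by (intro divide_right_mono add_right_mono mult_left_mono) auto
    also have "\<dots> = V\<^sup>2 * noise_total Pu Pr \<sigma>r \<sigma>d / Pu"
      using n(2) by (simp add: noise_total_def power2_eq_square algebra_simps)
    also have "\<dots> = (V * mean_amp * sqrt (\<xi> k) * S)\<^sup>2 / g"
      unfolding g using pos P \<xi>[OF k] S(2) nt by (simp add: power_mult_distrib field_simps)
    \<comment> \<open>The sum of the bounds for row \<open>k\<close> of the inverse, in units of the
      inverse of the nominal diagonal entry \<open>k\<close>. The loss factor \<open>q\<close> is
      free of the array sizes and equals 1 at \<open>e = 0\<close>.\<close>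
    also have "V * mean_amp * sqrt (\<xi> k) * S = q"
    proof -
      have "V * (mean_amp * sqrt (\<xi> k) * S) = (\<Sum>i<K. ((if i = k then 1 else 0) + 2 * e) * (sqrt (\<xi> k) / sqrt (\<xi> i)) / (1 - e))"
        unfolding V_def sum_distrib_right c_def \<beta>_def using pos S e
        by (intro sum.cong refl) (simp add: divide_simps)
      then show ?thesis unfolding q_def sum_divide_distrib by (simp add: mult.assoc)
    qed
    finally show "expectation Z \<le> q\<^sup>2 / g" .
  qed
  have point: "(1 - deviation e \<rho> \<omega>) * (ln (1 + g) + 1) - (1 + g) * Z \<omega>
      \<le> ln (1 + sinr b Pu Pr \<sigma>r \<sigma>d (G \<omega>) (H \<omega>) k)" if \<omega>: "\<omega> \<in> space M" for \<omega>
  proof -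
    interpret R: relay_mats b "G \<omega>" "H \<omega>" Nd Nr K by (rule mats[OF \<omega>])
    define x where "x = sinr b Pu Pr \<sigma>r \<sigma>d (G \<omega>) (H \<omega>) k"
    have x0: "0 \<le> x" unfolding x_def by (rule R.sinr_bounds(1)[OF k P s(1)])
    have L: "0 \<le> ln (1 + g)" using g0 by simp
    have dn: "0 \<le> deviation e \<rho> \<omega>" unfolding deviation_def
      by (intro add_nonneg_nonneg sum_nonneg) auto
    show ?thesis unfolding x_def[symmetric]
    proof (cases "deviation e \<rho> \<omega> < 1")
      case True
      note d = deviation_small[OF \<omega> e(1,2) \<rho>(1) True, folded S_def]
      have rn: "R.row_norm2 i = gain i \<omega>" if "i < K" for i
      proof -
        have "R.row_norm2 i = (\<Sum>l<Nr. (cmod (complex_of_real (1 / sqrt Nd) * combined (gent \<omega>) (hcol i \<omega>) l))\<^sup>2)"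
          unfolding R.row_norm2_def combined_def using R.WaG_index[OF that] by simp
        also have "\<dots> = gain i \<omega>"
          by (simp add: gain_def norm_mult norm_divide power_mult_distrib power_divide sum_divide_distrib)
        finally show ?thesis .
      qed
      have "1 / (1 + x) \<le> (\<sigma>r\<^sup>2 * ((\<Sum>i<K. c i) * (\<Sum>i<K. c i * R.row_norm2 i)) + \<sigma>d\<^sup>2 * R.noise_gain \<sigma>r Pu Pr * (\<Sum>i<K. c i)\<^sup>2) / Pu"
        unfolding x_def
        by (rule R.inverse_sinr_le[OF k P s(1) _ e(3) \<beta>0 \<beta>le, where c=c])
          (use d e in \<open>auto simp: \<beta>_def \<beta>0_def c_def\<close>)
      also have "\<dots> = Z \<omega>" using rn by (simp add: Z_def V_def ng_def R.noise_gain_def)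
      finally have "(1 + g) * (1 / (1 + x)) \<le> (1 + g) * Z \<omega>" using g0 by (intro mult_left_mono) auto
      moreover have "(1 - deviation e \<rho> \<omega>) * (ln (1 + g) + 1) \<le> 1 * (ln (1 + g) + 1)"
        using dn L by (intro mult_right_mono) auto
      ultimately have "(1 - deviation e \<rho> \<omega>) * (ln (1 + g) + 1) - (1 + g) * Z \<omega>
          \<le> 1 * (ln (1 + g) + 1) - (1 + g) * (1 / (1 + x))"
        by (intro diff_mono)
      also have "\<dots> \<le> ln (1 + x)" using ln_tangent_lower[OF x0 g0] by simp
      finally show "(1 - deviation e \<rho> \<omega>) * (ln (1 + g) + 1) - (1 + g) * Z \<omega> \<le> ln (1 + x)" .
    next
      case False
      then have "(1 - deviation e \<rho> \<omega>) * (ln (1 + g) + 1) \<le> 0" using L by (intro mult_nonpos_nonneg) auto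
      moreover have "0 \<le> (1 + g) * Z \<omega>" using g0 Zn by simp
      ultimately have "(1 - deviation e \<rho> \<omega>) * (ln (1 + g) + 1) - (1 + g) * Z \<omega> \<le> 0 - 0"
        by (intro diff_mono)
      also have "\<dots> \<le> ln (1 + x)" using x0 by simp
      finally show "(1 - deviation e \<rho> \<omega>) * (ln (1 + g) + 1) - (1 + g) * Z \<omega> \<le> ln (1 + x)" .
    qed
  qed
  note D = deviation_expectation[OF e(1,2) \<rho>(1)]
  have "(1 - deviation_bound e \<rho>) * (ln (1 + g) + 1) - (1 + g) * (q\<^sup>2 / g)
      \<le> (1 - expectation (deviation e \<rho>)) * (ln (1 + g) + 1) - (1 + g) * expectation Z"
    using D(2) EZ(2) g0 by (intro diff_mono mult_right_mono mult_left_mono) auto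
  also have "\<dots> = expectation (\<lambda>\<omega>. (1 - deviation e \<rho> \<omega>) * (ln (1 + g) + 1) - (1 + g) * Z \<omega>)"
    using D(1) EZ(1) by (simp add: prob_space)
  also have "\<dots> \<le> expectation (\<lambda>\<omega>. ln (1 + sinr b Pu Pr \<sigma>r \<sigma>d (G \<omega>) (H \<omega>) k))"
    using D(1) EZ(1) by (intro integral_mono ln_sinr_integrable k P s point) auto
  also have "(1 + g) * (q\<^sup>2 / g) = (1 + 1 / g) * q\<^sup>2" using g0 by (simp add: field_simps)
  finally show ?thesis unfolding q_def .
qed

end

section \<open>The limit of large arrays\<close>

lemma polygon_mean_square:
  assumes "b \<ge> 1" "0 < v"
  shows "(polygon_mean b v)\<^sup>2 = pi * v * (sinc (pi / 2 ^ b))\<^sup>2 / 4"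
proof -
  define t where "t = sinc (pi / 2 ^ b)"
  have "polygon_mean b v = t * (real (2 ^ (b - 1)) * (pi / 2 ^ b)) * sqrt (v / pi)"
    by (simp add: polygon_mean_def t_def)
  also have "\<dots> = t * (pi / 2) * sqrt (v / pi)"
    by (simp only: half_turn[OF assms(1)])
  finally have e: "polygon_mean b v = t * (pi / 2) * sqrt (v / pi)" .
  have "(polygon_mean b v)\<^sup>2 = t\<^sup>2 * (pi / 2)\<^sup>2 * (v / pi)"
    unfolding e power_mult_distrib using assms by simp
  also have "\<dots> = pi * v * t\<^sup>2 / 4" by (simp add: power2_eq_square)
  finally show ?thesis by (simp only: t_def)
qed

theorem theorem3:
  fixes K b k :: nat
    and \<xi> :: "nat \<Rightarrow> real"
    and \<eta> \<delta> Pu Pr \<sigma>r \<sigma>d :: real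
    and Nd Nr :: "nat \<Rightarrow> nat"
    and M :: "nat \<Rightarrow> 'a measure"
    and G H :: "nat \<Rightarrow> 'a \<Rightarrow> complex mat"
  assumes "K \<ge> 1" and "b \<ge> 1" and "k < K"
    and "\<eta> > 0" and "\<And>j. j < K \<Longrightarrow> \<xi> j > 0" and "\<delta> > 0"
    and "Pu > 0" and "Pr > 0" and "\<sigma>r > 0" and "\<sigma>d > 0"
    and "\<And>n. real (Nd n) / real (Nr n) = \<delta>"
    and "filterlim Nd at_top sequentially"
    and "\<And>n. relay_channel (M n) K (Nr n) (Nd n) \<xi> \<eta> (H n) (G n)"
  shows "liminf (\<lambda>n. ereal (ergodic_rate (M n) b Pu Pr \<sigma>r \<sigma>d (G n) (H n) k
                          - rate_bound K b \<xi> \<eta> \<delta> Pu Pr \<sigma>r \<sigma>d (Nd n) k)) \<ge> 0"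
proof -
  note b = assms(2) and k = assms(3) and \<eta> = assms(4) and \<xi> = assms(5) and \<delta> = assms(6)
    and P = assms(7,8) and sr = assms(9) and sd = assms(10)
  have Nd0: "0 < Nd n" and Nr0: "0 < Nr n" and ratio: "real (Nd n) = \<delta> * real (Nr n)" for n
  proof -
    \<comment> \<open>An empty array would make the ratio 0, also by division by zero, against
      \<delta> > 0.\<close>
    have "Nr n \<noteq> 0" "Nd n \<noteq> 0" using assms(11)[of n] \<delta> by (metis div_by_0 div_0 less_irrefl of_nat_0)+
    then show "0 < Nd n" "0 < Nr n" "real (Nd n) = \<delta> * real (Nr n)"
      using assms(11)[of n] by (auto simp: field_simps)
  qed
  have rel: "gaussian_relay (M n) K (Nr n) (Nd n) \<xi> \<eta> (H n) (G n) b" for n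
    using assms(13)[of n] b Nd0[of n] Nr0[of n] \<eta> \<xi>
    by (auto simp: gaussian_relay_def gaussian_relay_axioms_def)
  define s where "s = (sinc (pi / 2 ^ b))\<^sup>2"
  define c where "c = polygon_mean b \<eta>"
  have c: "0 < c" "c\<^sup>2 = pi * \<eta> * s / 4"
    using polygon_mean_pos[OF b \<eta>] polygon_mean_square[OF b \<eta>] by (auto simp: c_def s_def)
  have "s = 4 * c\<^sup>2 / (pi * \<eta>)" unfolding c(2) using \<eta> by simp
  then have s: "0 < s" using c(1) \<eta> by simp
  define A where "A = Pu * (\<Sum>i<K. \<xi> i) + \<sigma>r\<^sup>2"
  have "0 \<le> (\<Sum>i<K. \<xi> i)" by (intro sum_nonneg) (auto intro: less_imp_le \<xi>)
  then have A: "0 < A" unfolding A_def using P sr by (intro add_nonneg_pos) auto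
  define den where "den = \<sigma>r\<^sup>2 * \<eta> * Pr * (pi * \<delta> * s + 4) + 4 * \<sigma>d\<^sup>2 * A"
  have den: "0 < den" unfolding den_def using A s sr sd \<eta> P \<delta> by (intro add_pos_pos mult_pos_pos) auto
  \<comment> \<open>The slope of the claimed SINR in \<open>Nd\<close>; it does not depend on the
    array sizes.\<close>
  define \<kappa> where "\<kappa> = pi * \<eta> * \<xi> k * Pr * Pu * s / den"
  have \<kappa>: "0 < \<kappa>" unfolding \<kappa>_def using den s \<eta> P \<xi>[OF k] by simp
  have rb: "rate_bound K b \<xi> \<eta> \<delta> Pu Pr \<sigma>r \<sigma>d N k = ln (1 + \<kappa> * real N) / (2 * ln 2)" for N
    by (simp add: rate_bound_def log_def \<kappa>_def den_def A_def s_def mult_ac)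
  \<comment> \<open>One off-diagonal tolerance for all users is measured against the weakest
    diagonal entry.\<close>
  define \<rho> where "\<rho> = Min ((\<lambda>i. sqrt (\<xi> i)) ` {..<K})"
  have ne: "(\<lambda>i. sqrt (\<xi> i)) ` {..<K} \<noteq> {}" using assms(1) by (auto simp: lessThan_empty_iff)
  have \<rho>: "0 < \<rho>" "\<And>i. i < K \<Longrightarrow> \<rho> \<le> sqrt (\<xi> i)"
    unfolding \<rho>_def using \<xi> ne by (auto simp: Min_gr_iff)
  define q where "q e = (\<Sum>i<K. ((if i = k then 1 else 0) + 2 * e) * (sqrt (\<xi> k) / sqrt (\<xi> i))) / (1 - e)" for e
  \<comment> \<open>What remains of \<open>deviation_bound\<close> after
    \<open>Nd = \<delta> * Nr\<close> is inserted and 1 / Nd is factored out.\<close>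
  define C where "C e = (\<Sum>i<K. \<Sum>j<K. \<xi> j * (\<eta> + \<delta> * c\<^sup>2) / (e * (1 - e) * c * \<rho>)\<^sup>2)
      + (\<Sum>i<K. 4 * \<eta> / (e\<^sup>2 * c\<^sup>2)) + (\<Sum>i<K. 12 * \<delta> / e\<^sup>2)" for e
  define L where "L = liminf (\<lambda>n. ereal (ergodic_rate (M n) b Pu Pr \<sigma>r \<sigma>d (G n) (H n) k
                          - rate_bound K b \<xi> \<eta> \<delta> Pu Pr \<sigma>r \<sigma>d (Nd n) k))"
  \<comment> \<open>For a fixed tolerance the remaining error is a constant given by
    \<open>q e\<close>. As \<open>L\<close> does not involve e, it may be removed afterwards by
    letting e tend to 0.\<close>
  have bound: "ereal ((1 - (q e)\<^sup>2) / (2 * ln 2)) \<le> L" if e: "0 < e" "e < 1" "real K * e \<le> 1 / 2" for e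
  proof -
    define l where "l x = (- (C e / x) * (ln (1 + \<kappa> * x) + 1) + 1 - (1 + 1 / (\<kappa> * x)) * (q e)\<^sup>2) / (2 * ln 2)" for x
    have le: "l (real (Nd n)) \<le> ergodic_rate (M n) b Pu Pr \<sigma>r \<sigma>d (G n) (H n) k
                          - rate_bound K b \<xi> \<eta> \<delta> Pu Pr \<sigma>r \<sigma>d (Nd n) k" for n
    proof -
      interpret R: gaussian_relay "M n" K "Nr n" "Nd n" \<xi> \<eta> "H n" "G n" b by (rule rel)
      have amp: "R.mean_amp = c" by (simp add: R.mean_amp_def c_def)
      have gb: "R.gain_bound = real (Nr n) * (\<eta> + \<delta> * c\<^sup>2)"
        by (simp add: R.gain_bound_def amp ratio algebra_simps)
      have Nr: "0 < real (Nr n)" using Nr0 by simp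
      have dev: "R.deviation_bound e \<rho> = C e / Nd n"
      proof -
        have "(\<Sum>i<K. \<Sum>j<K. \<xi> j * R.gain_bound / ((e * (1 - e) * c * \<rho>)\<^sup>2 * real (Nd n * Nr n)))
            = (\<Sum>i<K. \<Sum>j<K. \<xi> j * (\<eta> + \<delta> * c\<^sup>2) / (e * (1 - e) * c * \<rho>)\<^sup>2) / Nd n"
          unfolding sum_divide_distrib gb using Nr by (intro sum.cong refl) simp
        moreover have "(\<Sum>i<K. 4 * \<eta> / (e\<^sup>2 * c\<^sup>2 * real (Nd n))) = (\<Sum>i<K. 4 * \<eta> / (e\<^sup>2 * c\<^sup>2)) / Nd n"
          unfolding sum_divide_distrib by (intro sum.cong refl) simp
        moreover have "(\<Sum>i<K. 12 / (e\<^sup>2 * real (Nr n))) = (\<Sum>i<K. 12 * \<delta> / e\<^sup>2) / Nd n"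
          unfolding sum_divide_distrib ratio using \<delta> by (intro sum.cong refl) simp
        ultimately show ?thesis unfolding R.deviation_bound_def amp C_def by (simp add: add_divide_distrib)
      qed
      \<comment> \<open>The 4 clears the denominator of \<open>c\<^sup>2\<close>, and
        \<open>Pr\<close> that of the noise gain. The factor \<open>Nr n\<close> then cancels
        against the signal power, which makes the SINR proportional to \<open>Nd n\<close>.\<close>
      have noise: "R.noise_total Pu Pr \<sigma>r \<sigma>d = real (Nr n) * den / (4 * Pr)"
        unfolding R.noise_total_def gb A_def[symmetric] den_def c(2) using P by (simp add: field_simps)
      have g: "\<kappa> * real (Nd n) = Pu * R.mean_amp\<^sup>2 * \<xi> k * real (Nd n * Nr n) / R.noise_total Pu Pr \<sigma>r \<sigma>d"
        unfolding noise amp c(2) \<kappa>_def using Nr P den by (simp add: field_simps)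
      define E where "E = (\<integral>\<omega>. ln (1 + sinr b Pu Pr \<sigma>r \<sigma>d (G n \<omega>) (H n \<omega>) k) \<partial>M n)"
      have "(1 - C e / Nd n) * (ln (1 + \<kappa> * real (Nd n)) + 1) - (1 + 1 / (\<kappa> * real (Nd n))) * (q e)\<^sup>2 \<le> E"
        using R.ergodic_ln_lower[OF k P sd sr e \<rho> g] unfolding dev q_def E_def .
      then have "(- (C e / Nd n) * (ln (1 + \<kappa> * real (Nd n)) + 1) + 1 - (1 + 1 / (\<kappa> * real (Nd n))) * (q e)\<^sup>2)
          \<le> E - ln (1 + \<kappa> * real (Nd n))" by (simp add: algebra_simps)
      then have "l (real (Nd n)) \<le> (E - ln (1 + \<kappa> * real (Nd n))) / (2 * ln 2)"
        unfolding l_def by (intro divide_right_mono) auto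
      also have "\<dots> = ergodic_rate (M n) b Pu Pr \<sigma>r \<sigma>d (G n) (H n) k - rate_bound K b \<xi> \<eta> \<delta> Pu Pr \<sigma>r \<sigma>d (Nd n) k"
        unfolding rb ergodic_rate_def log_def E_def by (simp add: diff_divide_distrib)
      finally show ?thesis .
    qed
    have "((\<lambda>x. - (C e / x) * (ln (1 + \<kappa> * x) + 1) + 1 - (1 + 1 / (\<kappa> * x)) * (q e)\<^sup>2) \<longlongrightarrow> 1 - (q e)\<^sup>2) at_top"
      using \<kappa> by real_asymp
    then have "(l \<longlongrightarrow> (1 - (q e)\<^sup>2) / (2 * ln 2)) at_top"
      unfolding l_def by (intro tendsto_divide tendsto_const) auto
    moreover have "filterlim (\<lambda>n. real (Nd n)) at_top sequentially"
      by (rule filterlim_compose[OF filterlim_real_sequentially assms(12)])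
    ultimately have "(\<lambda>n. l (real (Nd n))) \<longlonglongrightarrow> (1 - (q e)\<^sup>2) / (2 * ln 2)"
      by (rule filterlim_compose)
    then have "(\<lambda>n. ereal (l (real (Nd n)))) \<longlonglongrightarrow> ereal ((1 - (q e)\<^sup>2) / (2 * ln 2))" by simp
    then have "ereal ((1 - (q e)\<^sup>2) / (2 * ln 2)) = liminf (\<lambda>n. ereal (l (real (Nd n))))"
      by (intro lim_imp_Liminf[symmetric]) auto
    also have "\<dots> \<le> L" unfolding L_def by (intro Liminf_mono always_eventually allI) (use le in simp)
    finally show ?thesis .
  qed
  have "((\<lambda>e. q e) \<longlongrightarrow> q 0) (at_right 0)"
    unfolding q_def by (intro tendsto_intros) auto
  moreover have "q 0 = 1"
  proof -
    have "((if i = k then 1 else 0) + 2 * 0) * (sqrt (\<xi> k) / sqrt (\<xi> i)) = (if k = i then 1 else 0)" for i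
      using \<xi>[OF k] by (cases "k = i") auto
    then have "q 0 = (\<Sum>i<K. if k = i then 1 else 0)"
      unfolding q_def by (simp only: diff_zero div_by_1)
    also have "\<dots> = 1" using k by (simp add: sum.delta')
    finally show ?thesis .
  qed
  ultimately have "((\<lambda>e. (1 - (q e)\<^sup>2) / (2 * ln 2)) \<longlongrightarrow> (1 - 1\<^sup>2) / (2 * ln 2)) (at_right 0)"
    by (intro tendsto_intros) auto
  then have "((\<lambda>e. ereal ((1 - (q e)\<^sup>2) / (2 * ln 2))) \<longlongrightarrow> 0) (at_right 0)"
    by (simp add: zero_ereal_def)
  moreover have "\<forall>\<^sub>F e in at_right 0. ereal ((1 - (q e)\<^sup>2) / (2 * ln 2)) \<le> L"
  proof (rule eventually_at_rightI[of 0 "min 1 (1 / (2 * real K))"])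
    fix e :: real assume "e \<in> {0<..<min 1 (1 / (2 * real K))}"
    then have e: "0 < e" "e < 1" "e < 1 / (2 * real K)" by auto
    have "real K * e \<le> 1 / 2" using e(3) assms(1) by (simp add: field_simps)
    with e(1,2) show "ereal ((1 - (q e)\<^sup>2) / (2 * ln 2)) \<le> L" by (rule bound)
  qed (use assms(1) in auto)
  ultimately have "0 \<le> L" by (intro tendsto_upperbound) auto
  then show ?thesis by (simp add: L_def)
qed

end
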